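(* Let $m,\omega,c,T,\lambda>0$ be real parameters and consider the system $(\vec p(u),\vec q(u))=(p_i(u),q_i(u))_{i\in\mathbb Z}$ evolving according to $$\begin{cases}dp_i=\big(-m\omega^2q_i+mc^2(q_{i-1}+q_{i+1}-2q_i)-\lambda p_i\big)\,du+\sqrt{2T\lambda m}\,dW_i,\\ dq_i=m^{-1}p_i\,du,\end{cases}\qquad i\in\mathbb Z,$$ where $(W_i)_{i\in\mathbb Z}$ are independent Brownian motions, taken at equilibrium. Let $\eta=(p_i(0),q_i(0))_{i\in\mathbb Z}$ be its state at time $0$ and $\eta'=(p_i(t),q_i(t))_{i\in\mathbb Z}$ its state at time $t$. Then for all $t>0$, $$\{\eta:\eta'\}<1.$$
   Context: At equilibrium means that the system is stationary with the Gibbs law at temperature $T$ of the Hamiltonian $$H(\vec p,\vec q)=m^{-1}\sum_{i\in\mathbb Z}\frac{p_i^2}2+m\omega^2\sum_{i\in\mathbb Z}\frac{q_i^2}2+mc^2\sum_{i\in\mathbb Z}\frac{(q_{i+1}-q_i)^2}2,$$ i.e. $(p_i(u),q_i(u))_{i\in\mathbb Z}$ is a centered Gaussian family with covariance $T\,Q^{-1}$, where $Q$ is the bounded invertible symmetric operator on $\ell^2(\mathbb Z\times\{p,q\})$ with entries $Q_{p_ip_i}=m^{-1}$, $Q_{q_iq_i}=m(\omega^2+2c^2)$, $Q_{q_iq_{i\pm1}}=-mc^2$ and all other entries zero; this law is independent of the future noise. The Hilbertian (maximal) correlation $\{X:Y\}$ of random variables $X,Y$ is the supremum of $|\operatorname{Cov}(f(X),g(Y))|/(\operatorname{sd}(f(X))\operatorname{sd}(g(Y)))$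 over real measurable $f,g$ with $0<\operatorname{sd}(f(X)),\operatorname{sd}(g(Y))<\infty$ ($\operatorname{sd}$ is the standard deviation). *)

theory Defs
  imports "HOL-Probability.Probability"
begin

section \<open>Operators on square-summable families\<close>

definition ell2 :: "('i \<Rightarrow> real) set" where
  "ell2 = {x. (\<lambda>a. (x a)\<^sup>2) summable_on UNIV}"

definition matrix_op :: "('i \<Rightarrow> 'i \<Rightarrow> real) \<Rightarrow> ('i \<Rightarrow> real) \<Rightarrow> 'i \<Rightarrow> real" where
  "matrix_op A x = (\<lambda>a. \<Sum>\<^sub>\<infinity>b. A a b * x b)"

text \<open>Entry at (a, b) of the inverse of the operator on \<^const>\<open>ell2\<close> given by the matrix A: the
  a-th coordinate of the preimage of the b-th unit vector. It is meaningful when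
  \<^term>\<open>matrix_op A\<close> is a bijection of \<^const>\<open>ell2\<close>, which holds for the only instance used
  below, \<open>gibbs_matrix\<close> with positive parameters.\<close>

definition inverse_entry :: "('i \<Rightarrow> 'i \<Rightarrow> real) \<Rightarrow> 'i \<Rightarrow> 'i \<Rightarrow> real" where
  "inverse_entry A a b = inv_into ell2 (matrix_op A) (indicator {b}) a"


section \<open>The Gibbs covariance\<close>

datatype coord = Momentum | Position

type_synonym site = "int \<times> coord"

fun gibbs_matrix :: "real \<Rightarrow> real \<Rightarrow> real \<Rightarrow> site \<Rightarrow> site \<Rightarrow> real" where
  "gibbs_matrix m \<omega> c (i, Momentum) (j, Momentum) = (if i = j then inverse m else 0)"
| "gibbs_matrix m \<omega> c (i, Position) (j, Position) =
     (if i = j then m * (\<omega>\<^sup>2 + 2 * c\<^sup>2)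
      else if j = i + 1 \<or> j = i - 1 then - (m * c\<^sup>2) else 0)"
| "gibbs_matrix m \<omega> c (i, Momentum) (j, Position) = 0"
| "gibbs_matrix m \<omega> c (i, Position) (j, Momentum) = 0"

definition gibbs_covariance :: "real \<Rightarrow> real \<Rightarrow> real \<Rightarrow> real \<Rightarrow> site \<Rightarrow> site \<Rightarrow> real" where
  "gibbs_covariance m \<omega> c T a b = T * inverse_entry (gibbs_matrix m \<omega> c) a b"

text \<open>Processes are functions of the site, the time and the sample point; only times
  \<open>u \<ge> 0\<close> matter.\<close>

definition state :: "(int \<Rightarrow> real \<Rightarrow> 'w \<Rightarrow> real) \<Rightarrow> (int \<Rightarrow> real \<Rightarrow> 'w \<Rightarrow> real) \<Rightarrow>
    real \<Rightarrow> 'w \<Rightarrow> site \<Rightarrow> real" where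
  "state p q u x = (\<lambda>(i, k). case k of Momentum \<Rightarrow> p i u x | Position \<Rightarrow> q i u x)"

abbreviation state_space :: "(site \<Rightarrow> real) measure" where
  "state_space \<equiv> \<Pi>\<^sub>M a\<in>UNIV. borel"


context prob_space
begin

section \<open>Gaussian families and Brownian motion\<close>

definition gaussian_variable :: "('a \<Rightarrow> real) \<Rightarrow> bool" where
  "gaussian_variable X \<longleftrightarrow> random_variable borel X \<and>
     ((\<exists>\<mu>. AE x in M. X x = \<mu>) \<or>
      (\<exists>\<mu> \<sigma>. \<sigma> > 0 \<and> distributed M lborel X (normal_density \<mu> \<sigma>)))"

definition gaussian_family :: "('i \<Rightarrow> 'a \<Rightarrow> real) \<Rightarrow> bool" where
  "gaussian_family X \<longleftrightarrow> (\<forall>J r. finite J \<longrightarrow> gaussian_variable (\<lambda>x. \<Sum>a\<in>J. r a * X a x))"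

definition covariance :: "('a \<Rightarrow> real) \<Rightarrow> ('a \<Rightarrow> real) \<Rightarrow> real" where
  "covariance X Y = expectation (\<lambda>x. (X x - expectation X) * (Y x - expectation Y))"

definition std_dev :: "('a \<Rightarrow> real) \<Rightarrow> real" where
  "std_dev X = sqrt (variance X)"

definition centered_gaussian_family :: "('i \<Rightarrow> 'a \<Rightarrow> real) \<Rightarrow> ('i \<Rightarrow> 'i \<Rightarrow> real) \<Rightarrow> bool" where
  "centered_gaussian_family X C \<longleftrightarrow> gaussian_family X \<and>
     (\<forall>a. expectation (X a) = 0) \<and> (\<forall>a b. covariance (X a) (X b) = C a b)"

definition brownian_motion :: "(real \<Rightarrow> 'a \<Rightarrow> real) \<Rightarrow> bool" where
  "brownian_motion W \<longleftrightarrow>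
     (\<forall>u\<ge>0. random_variable borel (W u)) \<and>
     (AE x in M. W 0 x = 0) \<and>
     (AE x in M. continuous_on {0..} (\<lambda>u. W u x)) \<and>
     (\<forall>u v. 0 \<le> u \<longrightarrow> u < v \<longrightarrow>
        distributed M lborel (\<lambda>x. W v x - W u x) (normal_density 0 (sqrt (v - u)))) \<and>
     (\<forall>n (s::nat \<Rightarrow> real). 0 \<le> s 0 \<longrightarrow> mono s \<longrightarrow>
        indep_vars (\<lambda>_. borel) (\<lambda>k x. W (s (Suc k)) x - W (s k) x) {..<n})"

definition independent_brownian_motions :: "('i \<Rightarrow> real \<Rightarrow> 'a \<Rightarrow> real) \<Rightarrow> bool" where
  "independent_brownian_motions W \<longleftrightarrow> (\<forall>i. brownian_motion (W i)) \<and>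
     indep_vars (\<lambda>_. \<Pi>\<^sub>M u\<in>{0..}. borel) (\<lambda>i x. \<lambda>u\<in>{0..}. W i u x) UNIV"

text \<open>Unlike \<^const>\<open>indep_var\<close>, this allows variables with values in different types.\<close>

definition independent :: "'b measure \<Rightarrow> ('a \<Rightarrow> 'b) \<Rightarrow> 'c measure \<Rightarrow> ('a \<Rightarrow> 'c) \<Rightarrow> bool" where
  "independent S X S' Y \<longleftrightarrow> random_variable S X \<and> random_variable S' Y \<and>
     indep_set (sets (vimage_algebra (space M) X S)) (sets (vimage_algebra (space M) Y S'))"

definition future_noise :: "(int \<Rightarrow> real \<Rightarrow> 'a \<Rightarrow> real) \<Rightarrow> real \<Rightarrow> 'a \<Rightarrow> int \<times> real \<Rightarrow> real" where
  "future_noise W u x = (\<lambda>(i, v)\<in>UNIV \<times> {u..}. W i v x - W i u x)"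


section \<open>The dynamics and its equilibrium\<close>

text \<open>The noise is additive, so the stochastic differential equation is meaningful path by path,
  in integral form. Continuity of the paths makes all the integrals exist.\<close>

definition langevin_solution :: "real \<Rightarrow> real \<Rightarrow> real \<Rightarrow> real \<Rightarrow> real \<Rightarrow>
    (int \<Rightarrow> real \<Rightarrow> 'a \<Rightarrow> real) \<Rightarrow> (int \<Rightarrow> real \<Rightarrow> 'a \<Rightarrow> real) \<Rightarrow>
    (int \<Rightarrow> real \<Rightarrow> 'a \<Rightarrow> real) \<Rightarrow> bool" where
  "langevin_solution m \<omega> c T lam W p q \<longleftrightarrow>
     (\<forall>i. \<forall>u\<ge>0. random_variable borel (p i u) \<and> random_variable borel (q i u)) \<and>
     (AE x in M. \<forall>i.
        continuous_on {0..} (\<lambda>u. p i u x) \<and> continuous_on {0..} (\<lambda>u. q i u x) \<and>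
        (\<forall>u\<ge>0.
           p i u x = p i 0 x +
             integral {0..u} (\<lambda>s. - m * \<omega>\<^sup>2 * q i s x +
               m * c\<^sup>2 * (q (i - 1) s x + q (i + 1) s x - 2 * q i s x) - lam * p i s x) +
             sqrt (2 * T * lam * m) * W i u x \<and>
           q i u x = q i 0 x + integral {0..u} (\<lambda>s. inverse m * p i s x)))"

definition at_equilibrium :: "real \<Rightarrow> real \<Rightarrow> real \<Rightarrow> real \<Rightarrow>
    (int \<Rightarrow> real \<Rightarrow> 'a \<Rightarrow> real) \<Rightarrow> (int \<Rightarrow> real \<Rightarrow> 'a \<Rightarrow> real) \<Rightarrow>
    (int \<Rightarrow> real \<Rightarrow> 'a \<Rightarrow> real) \<Rightarrow> bool" where
  "at_equilibrium m \<omega> c T W p q \<longleftrightarrow>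
     (\<forall>u\<ge>0.
        centered_gaussian_family (\<lambda>a x. state p q u x a) (gibbs_covariance m \<omega> c T) \<and>
        independent state_space (state p q u)
          (\<Pi>\<^sub>M j\<in>UNIV \<times> {u..}. borel) (future_noise W u))"


section \<open>Maximal correlation\<close>

text \<open>For a random variable Z, \<open>sd Z < \<infinity>\<close> is square integrability of Z. The supremum is taken in
  \<^typ>\<open>ennreal\<close>, so it always exists, and it is 0 when there are no admissible test functions.\<close>

definition test_functions :: "'b measure \<Rightarrow> ('a \<Rightarrow> 'b) \<Rightarrow> ('b \<Rightarrow> real) set" where
  "test_functions S X = {f \<in> borel_measurable S.
     integrable M (\<lambda>x. (f (X x))\<^sup>2) \<and> 0 < std_dev (\<lambda>x. f (X x))}"

definition maximal_correlation ::
    "'b measure \<Rightarrow> ('a \<Rightarrow> 'b) \<Rightarrow> 'c measure \<Rightarrow> ('a \<Rightarrow> 'c) \<Rightarrow> ennreal" where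
  "maximal_correlation S X S' Y =
     (SUP f\<in>test_functions S X. SUP g\<in>test_functions S' Y.
        ennreal (\<bar>covariance (\<lambda>x. f (X x)) (\<lambda>x. g (Y x))\<bar> /
          (std_dev (\<lambda>x. f (X x)) * std_dev (\<lambda>x. g (Y x)))))"

end

end

theory Submission
  imports Defs
begin

text \<open>The state at time \<open>t\<close> is a linear image of the state at time 0 plus an independent noise: pairing it
  with a finitely supported \<open>w\<close> gives \<open>\<langle>w, \<eta>'\<rangle> = \<langle>w\<^sub>t, \<eta>\<rangle> + \<xi>\<close>, where \<open>w\<^sub>s\<close> solves the dual equation
  \<open>w\<^sub>s' = B\<^sup>T w\<^sub>s\<close>. Hence the pair is jointly Gaussian with cross covariance \<open>\<langle>v, C w\<^sub>t\<rangle>\<close>. The energy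
  \<open>\<langle>w\<^sub>s, C w\<^sub>s\<rangle>\<close> is dissipated only through the momentum part of \<open>w\<^sub>s\<close>, but a Taylor expansion at
  \<open>s = 0\<close> shows that this part controls all of \<open>w\<close>, uniformly since \<open>B\<close> and \<open>C\<close> are bounded on
  \<open>\<ell>\<^sup>2\<close>; so linear functionals of \<open>\<eta>\<close> and \<open>\<eta>'\<close> have correlation at most some \<open>\<rho> < 1\<close>. For Gaussian families
  this bound passes to all square integrable functions: on trigonometric polynomials the covariances are
  power series with nonnegative coefficients in the linear covariances, to which the Schur product theorem
  applies, and trigonometric polynomials are dense in \<open>L\<^sup>2\<close>.\<close>

section \<open>Hadamard powers of positive semidefinite kernels\<close>

text \<open>Two obstacles shape the proof. The noise acts on the momenta only, so at a fixed instant
  the dissipation rate can vanish although \<open>w\<close> does not; and with infinitely many sites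
  a strict inequality for each single \<open>w\<close> would give no uniform \<rho>. The cure is
  quantitative: the energy lost up to a small time \<tau> is at least of order
  \<open>\<tau>^3\<close> times the square norm of \<open>w\<close>, the exponent 3 being the price
  for positions that are felt only through the first derivative of the momenta. Moreover, the
  Gaussian hypothesis speaks of finite linear combinations, whereas the exact dual flow of a
  finitely supported \<open>w\<close> generally has infinite support. The flow is therefore replaced
  by partial sums of its exponential series, whose truncation errors vanish factorially. Correlation
  bounds are carried in the additive shape \<open>2 * cov \<le> \<rho> * (var + var)\<close>: it
  expresses positivity of a block kernel, it survives limits in L2, and normalising both variables
  turns it into a bound on the correlation.\<close>

definition psd_on :: "'i set \<Rightarrow> ('i \<Rightarrow> 'i \<Rightarrow> real) \<Rightarrow> bool" where
  "psd_on I R \<longleftrightarrow> (\<forall>i\<in>I. \<forall>j\<in>I. R i j = R j i) \<and> (\<forall>x. 0 \<le> (\<Sum>i\<in>I. \<Sum>j\<in>I. x i * x j * R i j))"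

text \<open>Cholesky factorisation by induction: the rank one kernel \<open>d i * d j\<close>
  reproduces the row of the new point \<open>z\<close>, and the Schur complement \<open>R'\<close>
  is again positive semidefinite on \<open>I\<close>.\<close>

lemma psd_on_gram:
  assumes "finite I" "psd_on I R"
  shows "\<exists>c :: 'i \<Rightarrow> 'i \<Rightarrow> real. \<forall>i\<in>I. \<forall>j\<in>I. R i j = (\<Sum>k\<in>I. c k i * c k j)"
  using assms
proof (induction I arbitrary: R rule: finite_induct)
  case empty
  then show ?case by simp
next
  case (insert z I)
  have sym: "R i j = R j i" if "i \<in> insert z I" "j \<in> insert z I" for i j
    using insert.prems that unfolding psd_on_def by blast
  have expand: "(\<Sum>i\<in>insert z I. \<Sum>j\<in>insert z I. x i * x j * R i j) =
      x z * x z * R z z + 2 * x z * (\<Sum>i\<in>I. x i * R i z) + (\<Sum>i\<in>I. \<Sum>j\<in>I. x i * x j * R i j)" for x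
  proof -
    have "(\<Sum>j\<in>I. x z * x j * R z j) = x z * (\<Sum>i\<in>I. x i * R i z)"
      unfolding sum_distrib_left by (intro sum.cong) (use sym in auto)
    moreover have "(\<Sum>i\<in>I. x i * x z * R i z) = x z * (\<Sum>i\<in>I. x i * R i z)"
      unfolding sum_distrib_left by (intro sum.cong) auto
    ultimately show ?thesis using insert(1,2) by (simp add: sum.distrib)
  qed
  have pos: "0 \<le> x z * x z * R z z + 2 * x z * (\<Sum>i\<in>I. x i * R i z) + (\<Sum>i\<in>I. \<Sum>j\<in>I. x i * x j * R i j)" for x
  proof -
    have "0 \<le> (\<Sum>i\<in>insert z I. \<Sum>j\<in>insert z I. x i * x j * R i j)"
      using insert.prems unfolding psd_on_def by blast
    then show ?thesis unfolding expand .
  qed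
  have Rzz: "0 \<le> R z z"
  proof -
    have ni: "i \<in> I \<Longrightarrow> i \<noteq> z" for i using insert(2) by auto
    have "(\<Sum>i\<in>I. (if i = z then 1 else 0) * R i z) = 0"
      "(\<Sum>i\<in>I. \<Sum>j\<in>I. (if i = z then 1 else 0) * (if j = z then 1 else 0) * R i j) = 0"
      using ni by (auto intro!: sum.neutral)
    then show ?thesis using pos[of "\<lambda>i. if i = z then 1 else 0"] by simp
  qed
  \<comment> \<open>With a vanishing pivot the form is affine in the coordinate at \<open>z\<close>,
    so its slope must vanish; otherwise \<open>s\<close> makes the form equal to -1 at the vector
    with entries 1 at \<open>i\<close> and \<open>s\<close> at \<open>z\<close>.\<close>
  have zero: "R i z = 0" if "R z z = 0" "i \<in> I" for i
  proof (rule ccontr)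
    assume ne: "R i z \<noteq> 0"
    define s where "s = - (R i i + 1) / (2 * R i z)"
    define x where "x = (\<lambda>j. if j = i then 1 else if j = z then s else 0 :: real)"
    have xz: "x z = s" and iz: "i \<noteq> z" using insert(2) that by (auto simp: x_def)
    have 1: "(\<Sum>j\<in>I. x j * R j z) = R i z"
    proof -
      have "(\<Sum>j\<in>I. x j * R j z) = (\<Sum>j\<in>I. if j = i then R i z else 0)"
        by (intro sum.cong) (use insert(2) in \<open>auto simp: x_def\<close>)
      then show ?thesis using insert(1) that by simp
    qed
    have "(\<Sum>k\<in>I. x j * x k * R j k) = (if j = i then R i i else 0)" if "j \<in> I" for j
    proof -
      have "(\<Sum>k\<in>I. x j * x k * R j k) = (\<Sum>k\<in>I. if k = i then (if j = i then R i i else 0) else 0)"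
        by (intro sum.cong) (use insert(2) that in \<open>auto simp: x_def\<close>)
      then show ?thesis using insert(1) \<open>i \<in> I\<close> by simp
    qed
    then have 2: "(\<Sum>j\<in>I. \<Sum>k\<in>I. x j * x k * R j k) = R i i"
      using insert(1) that by simp
    have "0 \<le> 2 * s * R i z + R i i"
      using pos[of x] unfolding 1 2 xz that(1) by simp
    also have "2 * s * R i z = - (R i i + 1)" unfolding s_def using ne by (simp add: field_simps)
    finally show False by simp
  qed
  define d where "d = (\<lambda>i. if R z z = 0 then 0 else R i z / sqrt (R z z))"
  have dd: "d i * d z = R i z" if "i \<in> insert z I" for i
    using zero that Rzz by (auto simp: d_def)
  define R' where "R' = (\<lambda>i j. R i j - d i * d j)"
  have "psd_on I R'"
    unfolding psd_on_def
  proof (intro conjI allI ballI)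
    fix i j assume "i \<in> I" "j \<in> I" then show "R' i j = R' j i" using sym[of i j] by (simp add: R'_def)
  next
    fix x :: "'i \<Rightarrow> real"
    define S where "S = (\<Sum>i\<in>I. x i * d i)"
    have eq: "(\<Sum>i\<in>I. \<Sum>j\<in>I. x i * x j * R' i j) = (\<Sum>i\<in>I. \<Sum>j\<in>I. x i * x j * R i j) - S * S"
      unfolding R'_def S_def sum_product right_diff_distrib sum_subtractf
      by (simp add: mult_ac)
    show "0 \<le> (\<Sum>i\<in>I. \<Sum>j\<in>I. x i * x j * R' i j)"
    proof (cases "R z z = 0")
      case True
      then have "S = 0" by (simp add: S_def d_def)
      moreover have "0 \<le> (\<Sum>i\<in>I. \<Sum>j\<in>I. x i * x j * R i j)"
      proof -
        define y where "y = (\<lambda>i. if i = z then 0 else x i)"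
        have yI: "y z = 0" "\<And>i. i \<in> I \<Longrightarrow> y i = x i" using insert(2) by (auto simp: y_def)
        have "(\<Sum>i\<in>I. \<Sum>j\<in>I. y i * y j * R i j) = (\<Sum>i\<in>I. \<Sum>j\<in>I. x i * x j * R i j)"
          by (intro sum.cong) (use yI in auto)
        then show ?thesis using pos[of y] yI(1) by simp
      qed
      ultimately show ?thesis unfolding eq by simp
    next
      case False
      \<comment> \<open>This value at \<open>z\<close> minimises the form over that coordinate, and
        the minimum is exactly the form of \<open>R'\<close> at \<open>x\<close>.\<close>
      define y where "y = (\<lambda>i. if i = z then - S / sqrt (R z z) else x i)"
      have yI: "y i = x i" if "i \<in> I" for i using that insert(2) by (auto simp: y_def)
      have "(\<Sum>i\<in>I. y i * R i z) = (\<Sum>i\<in>I. sqrt (R z z) * (x i * d i))"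
        by (intro sum.cong) (use False Rzz yI in \<open>auto simp: d_def\<close>)
      also have "\<dots> = sqrt (R z z) * S" by (simp add: S_def sum_distrib_left)
      finally have 1: "(\<Sum>i\<in>I. y i * R i z) = sqrt (R z z) * S" .
      have 2: "(\<Sum>i\<in>I. \<Sum>j\<in>I. y i * y j * R i j) = (\<Sum>i\<in>I. \<Sum>j\<in>I. x i * x j * R i j)"
        by (intro sum.cong) (use yI in auto)
      have "0 < R z z" using False Rzz by simp
      then have 3: "y z * y z * R z z = S * S" "2 * y z * (sqrt (R z z) * S) = - 2 * (S * S)"
        by (auto simp: y_def field_simps)
      show ?thesis using pos[of y] unfolding 1 2 3 eq by simp
    qed
  qed
  then obtain c where c: "\<And>i j. i \<in> I \<Longrightarrow> j \<in> I \<Longrightarrow> R' i j = (\<Sum>k\<in>I. c k i * c k j)"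
    using insert.IH by blast
  define c' where "c' = (\<lambda>k i. if k = z then d i else if i = z then 0 else c k i)"
  have "R i j = (\<Sum>k\<in>insert z I. c' k i * c' k j)" if "i \<in> insert z I" "j \<in> insert z I" for i j
  proof -
    have s: "(\<Sum>k\<in>I. c' k i * c' k j) = (\<Sum>k\<in>I. if i = z \<or> j = z then 0 else c k i * c k j)"
      by (intro sum.cong) (use insert(2) in \<open>auto simp: c'_def\<close>)
    show ?thesis
    proof (cases "i = z \<or> j = z")
      case True
      then show ?thesis
        using insert(1,2) that dd[of i] dd[of j] sym[of i j] s by (auto simp: c'_def mult.commute)
    next
      case False
      then show ?thesis using insert(1,2) that c[of i j] s by (auto simp: c'_def R'_def algebra_simps)
    qed
  qed
  then show ?case by blast
qed

text \<open>Schur product theorem: with a Gram representation of \<open>R\<close>, the form of the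
  product at \<open>x\<close> is the sum over \<open>k\<close> of the forms of \<open>P\<close> at
  the vectors \<open>x i * c k i\<close>.\<close>

lemma psd_on_times:
  assumes fin: "finite I" and P: "psd_on I P" and R: "psd_on I R"
  shows "psd_on I (\<lambda>i j. P i j * R i j)"
proof -
  obtain c where c: "\<And>i j. i \<in> I \<Longrightarrow> j \<in> I \<Longrightarrow> R i j = (\<Sum>k\<in>I. c k i * c k j)"
    using psd_on_gram[OF fin R] by metis
  have "0 \<le> (\<Sum>i\<in>I. \<Sum>j\<in>I. x i * x j * (P i j * R i j))" for x
  proof -
    have "(\<Sum>i\<in>I. \<Sum>j\<in>I. x i * x j * (P i j * R i j)) =
        (\<Sum>i\<in>I. \<Sum>j\<in>I. \<Sum>k\<in>I. (x i * c k i) * (x j * c k j) * P i j)"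
      by (intro sum.cong refl) (simp add: c sum_distrib_left mult_ac)
    also have "\<dots> = (\<Sum>i\<in>I. \<Sum>k\<in>I. \<Sum>j\<in>I. (x i * c k i) * (x j * c k j) * P i j)"
      by (intro sum.cong refl sum.swap)
    also have "\<dots> = (\<Sum>k\<in>I. \<Sum>i\<in>I. \<Sum>j\<in>I. (x i * c k i) * (x j * c k j) * P i j)"
      by (rule sum.swap)
    also have "\<dots> \<ge> 0"
    proof (rule sum_nonneg)
      fix k
      show "0 \<le> (\<Sum>i\<in>I. \<Sum>j\<in>I. (x i * c k i) * (x j * c k j) * P i j)"
        using P unfolding psd_on_def by (auto dest: spec[of _ "\<lambda>i. x i * c k i"])
    qed
    finally show ?thesis .
  qed
  then show ?thesis using P R unfolding psd_on_def by simp
qed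

lemma psd_on_power:
  assumes "finite I" "psd_on I R"
  shows "psd_on I (\<lambda>i j. R i j ^ n)"
proof (induction n)
  case 0
  have "(\<Sum>i\<in>I. \<Sum>j\<in>I. x i * x j * 1) = (\<Sum>i\<in>I. x i)\<^sup>2" for x :: "'a \<Rightarrow> real"
    by (simp add: power2_eq_square sum_product)
  then show ?case by (simp add: psd_on_def)
next
  case (Suc n)
  then show ?case using psd_on_times[OF assms(1) assms(2) Suc] by simp
qed

text \<open>The hypothesis \<open>lin\<close> says that the block kernel with diagonal blocks
  \<open>\<rho> * g\<close>, \<open>\<rho> * h\<close> and off-diagonal blocks \<open>- k\<close> is
  positive semidefinite. Its entrywise power is so too, which gives the bound with
  \<open>\<rho> ^ n\<close>; for \<open>n \<ge> 1\<close> this is at most \<rho>.\<close>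

lemma cross_power_bound:
  fixes g :: "'a \<Rightarrow> 'a \<Rightarrow> real" and h :: "'b \<Rightarrow> 'b \<Rightarrow> real" and k :: "'a \<Rightarrow> 'b \<Rightarrow> real"
  assumes fin: "finite I" "finite J" and g: "psd_on I g" and h: "psd_on J h"
    and rho: "0 \<le> \<rho>" "\<rho> \<le> 1" and n: "n \<ge> 1"
    and lin: "\<And>x y. 2 * (\<Sum>i\<in>I. \<Sum>j\<in>J. x i * y j * k i j) \<le>
      \<rho> * ((\<Sum>i\<in>I. \<Sum>j\<in>I. x i * x j * g i j) + (\<Sum>i\<in>J. \<Sum>j\<in>J. y i * y j * h i j))"
  shows "2 * (\<Sum>i\<in>I. \<Sum>j\<in>J. x i * y j * k i j ^ n) \<le>
      \<rho> * ((\<Sum>i\<in>I. \<Sum>j\<in>I. x i * x j * g i j ^ n) + (\<Sum>i\<in>J. \<Sum>j\<in>J. y i * y j * h i j ^ n))"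
proof -
  define R where "R = (\<lambda>a b. case a of
      Inl i \<Rightarrow> (case b of Inl j \<Rightarrow> \<rho> * g i j | Inr j \<Rightarrow> - k i j)
    | Inr i \<Rightarrow> (case b of Inl j \<Rightarrow> - k j i | Inr j \<Rightarrow> \<rho> * h i j))"
  have split: "(\<Sum>a\<in>I <+> J. \<Sum>b\<in>I <+> J. z a * z b * R a b ^ e) =
      \<rho> ^ e * (\<Sum>i\<in>I. \<Sum>j\<in>I. z (Inl i) * z (Inl j) * g i j ^ e)
      + \<rho> ^ e * (\<Sum>i\<in>J. \<Sum>j\<in>J. z (Inr i) * z (Inr j) * h i j ^ e)
      + 2 * (- 1) ^ e * (\<Sum>i\<in>I. \<Sum>j\<in>J. z (Inl i) * z (Inr j) * k i j ^ e)" for z e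
  proof -
    have "(\<Sum>i\<in>J. \<Sum>j\<in>I. z (Inr i) * z (Inl j) * (- k j i) ^ e) =
        (\<Sum>i\<in>I. \<Sum>j\<in>J. z (Inl i) * z (Inr j) * (- k i j) ^ e)"
      by (subst sum.swap) (simp add: mult_ac)
    moreover have "(- k i j) ^ e = (- 1) ^ e * k i j ^ e" for i j by (rule power_minus)
    ultimately show ?thesis
      using fin by (simp add: sum.Plus R_def sum.distrib power_mult_distrib sum_distrib_left mult_ac)
  qed
  have "psd_on (I <+> J) R"
    unfolding psd_on_def
  proof (intro conjI ballI allI)
    fix a b assume "a \<in> I <+> J" "b \<in> I <+> J"
    then show "R a b = R b a" using g h by (auto simp: R_def psd_on_def split: sum.splits)
  next
    fix z
    show "0 \<le> (\<Sum>a\<in>I <+> J. \<Sum>b\<in>I <+> J. z a * z b * R a b)"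
      using split[of z 1] lin[of "\<lambda>i. z (Inl i)" "\<lambda>j. z (Inr j)"] by (simp add: algebra_simps)
  qed
  then have "psd_on (I <+> J) (\<lambda>a b. R a b ^ n)" using fin by (intro psd_on_power) auto
  \<comment> \<open>The power turns \<open>- k\<close> into \<open>(-1) ^ n * k ^ n\<close>; the
    sign put on \<open>y\<close> makes the cross term negative again for either parity of
    \<open>n\<close>.\<close>
  then have "0 \<le> (\<Sum>a\<in>I <+> J. \<Sum>b\<in>I <+> J. case_sum x (\<lambda>j. (-1) ^ (n + 1) * y j) a
      * case_sum x (\<lambda>j. (-1) ^ (n + 1) * y j) b * R a b ^ n)"
    unfolding psd_on_def by blast
  also have "\<dots> = \<rho> ^ n * (\<Sum>i\<in>I. \<Sum>j\<in>I. x i * x j * g i j ^ n)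
      + \<rho> ^ n * (\<Sum>i\<in>J. \<Sum>j\<in>J. y i * y j * h i j ^ n)
      - 2 * (\<Sum>i\<in>I. \<Sum>j\<in>J. x i * y j * k i j ^ n)"
    unfolding split by (cases "even n") (simp_all add: sum_negf)
  finally have 1: "2 * (\<Sum>i\<in>I. \<Sum>j\<in>J. x i * y j * k i j ^ n) \<le>
    \<rho> ^ n * ((\<Sum>i\<in>I. \<Sum>j\<in>I. x i * x j * g i j ^ n) + (\<Sum>i\<in>J. \<Sum>j\<in>J. y i * y j * h i j ^ n))"
    by (simp add: algebra_simps)
  have "0 \<le> (\<Sum>i\<in>I. \<Sum>j\<in>I. x i * x j * g i j ^ n)" "0 \<le> (\<Sum>i\<in>J. \<Sum>j\<in>J. y i * y j * h i j ^ n)"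
    using psd_on_power[OF fin(1) g] psd_on_power[OF fin(2) h] unfolding psd_on_def by blast+
  moreover have "\<rho> ^ n \<le> \<rho>" using rho n power_decreasing[of 1 n \<rho>] by simp
  ultimately have "\<rho> ^ n * ((\<Sum>i\<in>I. \<Sum>j\<in>I. x i * x j * g i j ^ n) + (\<Sum>i\<in>J. \<Sum>j\<in>J. y i * y j * h i j ^ n))
    \<le> \<rho> * ((\<Sum>i\<in>I. \<Sum>j\<in>I. x i * x j * g i j ^ n) + (\<Sum>i\<in>J. \<Sum>j\<in>J. y i * y j * h i j ^ n))"
    by (intro mult_right_mono) auto
  with 1 show ?thesis by linarith
qed

text \<open>Sums the bounds for the powers with the nonnegative weights \<open>f n\<close>. The
  condition \<open>f 0 = 0\<close> matters because \<open>\<rho> ^ 0\<close> is not bounded by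
  \<rho>; in the application the constant term is what subtracting the means removes.\<close>

lemma cross_series_bound:
  fixes g :: "'a \<Rightarrow> 'a \<Rightarrow> real" and h :: "'b \<Rightarrow> 'b \<Rightarrow> real" and k :: "'a \<Rightarrow> 'b \<Rightarrow> real"
  assumes fin: "finite I" "finite J" and g: "psd_on I g" and h: "psd_on J h"
    and rho: "0 \<le> \<rho>" "\<rho> \<le> 1"
    and lin: "\<And>x y. 2 * (\<Sum>i\<in>I. \<Sum>j\<in>J. x i * y j * k i j) \<le>
      \<rho> * ((\<Sum>i\<in>I. \<Sum>j\<in>I. x i * x j * g i j) + (\<Sum>i\<in>J. \<Sum>j\<in>J. y i * y j * h i j))"
    and f: "\<And>n. 0 \<le> f n" "f 0 = 0" and F: "\<And>u. (\<lambda>n. f n * u ^ n) sums F u"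
  shows "2 * (\<Sum>i\<in>I. \<Sum>j\<in>J. x i * y j * F (k i j)) \<le>
      \<rho> * ((\<Sum>i\<in>I. \<Sum>j\<in>I. x i * x j * F (g i j)) + (\<Sum>i\<in>J. \<Sum>j\<in>J. y i * y j * F (h i j)))"
proof -
  have S: "(\<lambda>n. f n * (\<Sum>i\<in>A. \<Sum>j\<in>B. u i * v j * r i j ^ n)) sums (\<Sum>i\<in>A. \<Sum>j\<in>B. u i * v j * F (r i j))"
    for A :: "'c set" and B :: "'d set" and u v r
  proof -
    have "(\<lambda>n. \<Sum>i\<in>A. \<Sum>j\<in>B. u i * v j * (f n * r i j ^ n)) sums (\<Sum>i\<in>A. \<Sum>j\<in>B. u i * v j * F (r i j))"
      by (intro sums_sum sums_mult F)
    then show ?thesis by (simp add: sum_distrib_left mult_ac)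
  qed
  show ?thesis
  proof (rule sums_le)
    show "(\<lambda>n. 2 * (f n * (\<Sum>i\<in>I. \<Sum>j\<in>J. x i * y j * k i j ^ n))) sums (2 * (\<Sum>i\<in>I. \<Sum>j\<in>J. x i * y j * F (k i j)))"
      by (intro sums_mult S)
    show "(\<lambda>n. \<rho> * (f n * (\<Sum>i\<in>I. \<Sum>j\<in>I. x i * x j * g i j ^ n) + f n * (\<Sum>i\<in>J. \<Sum>j\<in>J. y i * y j * h i j ^ n)))
       sums (\<rho> * ((\<Sum>i\<in>I. \<Sum>j\<in>I. x i * x j * F (g i j)) + (\<Sum>i\<in>J. \<Sum>j\<in>J. y i * y j * F (h i j))))"
      by (intro sums_mult sums_add S)
    fix n
    show "2 * (f n * (\<Sum>i\<in>I. \<Sum>j\<in>J. x i * y j * k i j ^ n)) \<le>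
      \<rho> * (f n * (\<Sum>i\<in>I. \<Sum>j\<in>I. x i * x j * g i j ^ n) + f n * (\<Sum>i\<in>J. \<Sum>j\<in>J. y i * y j * h i j ^ n))"
    proof (cases "n = 0")
      case False
      have "f n * (2 * (\<Sum>i\<in>I. \<Sum>j\<in>J. x i * y j * k i j ^ n)) \<le> f n * (\<rho> * ((\<Sum>i\<in>I. \<Sum>j\<in>I. x i * x j * g i j ^ n)
         + (\<Sum>i\<in>J. \<Sum>j\<in>J. y i * y j * h i j ^ n)))"
        by (intro mult_left_mono f(1) cross_power_bound[OF fin g h rho _ lin]) (use False in auto)
      then show ?thesis by (simp add: algebra_simps)
    qed (simp add: f)
  qed
qed

section \<open>The Gibbs covariance\<close>

lemma matrix_op_gibbs:
  "matrix_op (gibbs_matrix m \<omega> c) x (i, Momentum) = x (i, Momentum) / m"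
  "matrix_op (gibbs_matrix m \<omega> c) x (i, Position) =
     m * (\<omega>\<^sup>2 + 2 * c\<^sup>2) * x (i, Position) - m * c\<^sup>2 * (x (i - 1, Position) + x (i + 1, Position))"
proof -
  have "matrix_op (gibbs_matrix m \<omega> c) x (i, Momentum) =
      (\<Sum>\<^sub>\<infinity>b\<in>{(i, Momentum)}. gibbs_matrix m \<omega> c (i, Momentum) b * x b)"
    unfolding matrix_op_def
  proof (intro infsum_cong_neutral)
    fix b assume "b \<in> UNIV - {(i, Momentum)}"
    then show "gibbs_matrix m \<omega> c (i, Momentum) b * x b = 0" by (cases b; cases "snd b") auto
  qed auto
  then show "matrix_op (gibbs_matrix m \<omega> c) x (i, Momentum) = x (i, Momentum) / m"
    by (simp add: field_simps)
  have "matrix_op (gibbs_matrix m \<omega> c) x (i, Position) =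
      (\<Sum>\<^sub>\<infinity>b\<in>{(i, Position), (i - 1, Position), (i + 1, Position)}. gibbs_matrix m \<omega> c (i, Position) b * x b)"
    unfolding matrix_op_def
  proof (intro infsum_cong_neutral)
    fix b assume "b \<in> UNIV - {(i, Position), (i - 1, Position), (i + 1, Position)}"
    then show "gibbs_matrix m \<omega> c (i, Position) b * x b = 0" by (cases b; cases "snd b") auto
  qed auto
  then show "matrix_op (gibbs_matrix m \<omega> c) x (i, Position) =
     m * (\<omega>\<^sup>2 + 2 * c\<^sup>2) * x (i, Position) - m * c\<^sup>2 * (x (i - 1, Position) + x (i + 1, Position))"
    by (simp add: algebra_simps)
qed

text \<open>On each side of \<open>i\<close> the distance to \<open>i\<close> is injective, so each
  half is dominated by one geometric series.\<close>

lemma power_dist_sum_le: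
  fixes r :: real
  assumes "0 < r" "r < 1" "finite J"
  shows "(\<Sum>j\<in>J. r ^ nat \<bar>i - j\<bar>) \<le> 2 / (1 - r)"
proof -
  have half: "(\<Sum>j\<in>K. r ^ nat \<bar>i - j\<bar>) \<le> 1 / (1 - r)"
    if "finite K" "inj_on (\<lambda>j. nat \<bar>i - j\<bar>) K" for K
  proof -
    have "(\<Sum>j\<in>K. r ^ nat \<bar>i - j\<bar>) = (\<Sum>n\<in>(\<lambda>j. nat \<bar>i - j\<bar>) ` K. r ^ n)"
      by (simp add: sum.reindex[OF that(2)])
    also have "\<dots> \<le> (\<Sum>n. r ^ n)"
      using assms that by (intro sum_le_suminf summable_geometric) auto
    also have "\<dots> = 1 / (1 - r)" using assms by (intro suminf_geometric) auto
    finally show ?thesis .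
  qed
  have "(\<Sum>j\<in>J. r ^ nat \<bar>i - j\<bar>) = (\<Sum>j\<in>J \<inter> {..i}. r ^ nat \<bar>i - j\<bar>) + (\<Sum>j\<in>J - {..i}. r ^ nat \<bar>i - j\<bar>)"
    using assms(3) by (rule sum.Int_Diff)
  also have "\<dots> \<le> 1 / (1 - r) + 1 / (1 - r)"
    using assms(3) by (intro add_mono half) (auto simp: inj_on_def)
  finally show ?thesis by simp
qed

lemma ell2_diff:
  assumes "x \<in> ell2" "y \<in> ell2"
  shows "(\<lambda>a. x a - y a) \<in> ell2"
proof -
  have "(\<lambda>a. 2 * (x a)\<^sup>2 + 2 * (y a)\<^sup>2) summable_on UNIV"
    using assms unfolding ell2_def by (intro summable_on_add summable_on_cmult_right) auto
  then have "(\<lambda>a. (x a - y a)\<^sup>2) summable_on UNIV"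
  proof (rule summable_on_comparison_test)
    fix a show "(x a - y a)\<^sup>2 \<le> 2 * (x a)\<^sup>2 + 2 * (y a)\<^sup>2"
      using sum_squares_ge_zero[of "x a + y a" 0] by (simp add: power2_eq_square algebra_simps)
  qed auto
  then show ?thesis by (simp add: ell2_def)
qed

text \<open>The positions of a kernel element satisfy
  \<open>\<kappa> * d i = d (i + 1) + d (i - 1)\<close> with \<open>\<kappa> > 2\<close>. Squaring
  and summing over all sites gives \<open>\<kappa>^2 * S \<le> 4 * S\<close> for the finite sum of
  squares \<open>S\<close>, which must then be 0.\<close>

lemma gibbs_kernel_trivial:
  assumes pos: "m > 0" "\<omega> > 0" "c > 0"
    and d: "d \<in> ell2" and 0: "matrix_op (gibbs_matrix m \<omega> c) d = (\<lambda>_. 0)"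
  shows "d = (\<lambda>_. 0)"
proof -
  have M: "d (i, Momentum) = 0" for i
    using fun_cong[OF 0, of "(i, Momentum)"] pos by (simp add: matrix_op_gibbs)
  define y where "y = (\<lambda>i. (d (i, Position))\<^sup>2)"
  have y: "y summable_on UNIV"
  proof -
    have "(\<lambda>a. (d a)\<^sup>2) summable_on (\<lambda>i. (i, Position)) ` UNIV"
      using d unfolding ell2_def by (auto intro: summable_on_subset_banach)
    then show ?thesis by (subst (asm) summable_on_reindex) (auto simp: inj_on_def y_def o_def)
  qed
  have shift: "(\<lambda>i. y (i + k)) summable_on UNIV" "(\<Sum>\<^sub>\<infinity>i. y (i + k)) = infsum y UNIV" for k
  proof -
    have bij: "bij_betw (\<lambda>i. i + k) UNIV UNIV"
      by (rule bij_betw_byWitness[where f' = "\<lambda>i. i - k"]) auto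
    show "(\<lambda>i. y (i + k)) summable_on UNIV"
      using y summable_on_reindex_bij_betw[OF bij, of y] by simp
    show "(\<Sum>\<^sub>\<infinity>i. y (i + k)) = infsum y UNIV"
      by (rule infsum_reindex_bij_betw[OF bij])
  qed
  define \<kappa> where "\<kappa> = 2 + \<omega>\<^sup>2 / c\<^sup>2"
  have \<kappa>: "\<kappa> > 2" using pos by (simp add: \<kappa>_def)
  have rec: "\<kappa>\<^sup>2 * y i \<le> 2 * (y (i + 1) + y (i + (- 1)))" for i
  proof -
    have "\<omega>\<^sup>2 + 2 * c\<^sup>2 = c\<^sup>2 * \<kappa>" using pos by (simp add: \<kappa>_def field_simps)
    then have "m * (c\<^sup>2 * (\<kappa> * d (i, Position))) = m * (c\<^sup>2 * (d (i - 1, Position) + d (i + 1, Position)))"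
      using fun_cong[OF 0, of "(i, Position)"] pos by (simp add: matrix_op_gibbs mult.assoc)
    then have "\<kappa> * d (i, Position) = d (i + 1, Position) + d (i - 1, Position)" using pos by simp
    then have "\<kappa>\<^sup>2 * y i = (d (i + 1, Position) + d (i - 1, Position))\<^sup>2"
      by (simp add: y_def power_mult_distrib[symmetric])
    also have "\<dots> \<le> 2 * (y (i + 1) + y (i + (- 1)))"
      using sum_squares_ge_zero[of "d (i + 1, Position) - d (i - 1, Position)" 0]
      by (simp add: y_def power2_eq_square algebra_simps)
    finally show ?thesis .
  qed
  have "\<kappa>\<^sup>2 * infsum y UNIV = (\<Sum>\<^sub>\<infinity>i. \<kappa>\<^sup>2 * y i)"
    by (rule infsum_cmult_right[symmetric]) (use y in auto)
  also have "\<dots> \<le> (\<Sum>\<^sub>\<infinity>i. 2 * (y (i + 1) + y (i + (- 1))))"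
    by (intro infsum_mono summable_on_cmult_right summable_on_add shift rec y)
  also have "\<dots> = 2 * (\<Sum>\<^sub>\<infinity>i. y (i + 1) + y (i + (- 1)))"
    by (intro infsum_cmult_right summable_on_add shift)
  also have "(\<Sum>\<^sub>\<infinity>i. y (i + 1) + y (i + (- 1))) = infsum y UNIV + infsum y UNIV"
    using infsum_add[OF shift(1)[of 1] shift(1)[of "-1"]] shift(2)[of 1] shift(2)[of "-1"] by simp
  finally have "(\<kappa>\<^sup>2 - 4) * infsum y UNIV \<le> 0" by (simp add: algebra_simps)
  moreover have "\<kappa>\<^sup>2 > 4" using power_strict_mono[of 2 \<kappa> 2] \<kappa> by simp
  ultimately have "infsum y UNIV \<le> 0" by (simp add: mult_le_0_iff)
  then have "y i = 0" for i
    using nonneg_infsum_le_0D[of y UNIV i] y by (auto simp: y_def)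
  then have P: "d (i, Position) = 0" for i by (auto simp: y_def)
  show ?thesis
  proof
    fix a show "d a = 0" using M P by (cases a; cases "snd a") auto
  qed
qed

text \<open>\<open>inverse_entry\<close> is defined by a choice of preimage; triviality of the
  kernel identifies the chosen one with any explicit square-summable solution.\<close>

lemma gibbs_inverse_entry:
  assumes pos: "m > 0" "\<omega> > 0" "c > 0"
    and x: "x \<in> ell2" and eq: "matrix_op (gibbs_matrix m \<omega> c) x = indicator {b}"
  shows "inverse_entry (gibbs_matrix m \<omega> c) a b = x a"
proof -
  let ?A = "matrix_op (gibbs_matrix m \<omega> c)"
  define z where "z = inv_into ell2 ?A (indicator {b})"
  have im: "indicator {b} \<in> ?A ` ell2" using x eq[symmetric] by blast
  have z: "z \<in> ell2" "?A z = indicator {b}"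
    unfolding z_def using inv_into_into[OF im] f_inv_into_f[OF im] by auto
  have "?A (\<lambda>a. z a - x a) = (\<lambda>_. 0)"
  proof
    fix a
    have "?A (\<lambda>a. z a - x a) a = ?A z a - ?A x a"
      by (cases a; cases "snd a") (auto simp: matrix_op_gibbs diff_divide_distrib algebra_simps)
    then show "?A (\<lambda>a. z a - x a) a = 0" unfolding z(2) eq by simp
  qed
  then have "(\<lambda>a. z a - x a) = (\<lambda>_. 0)"
    using gibbs_kernel_trivial[OF pos ell2_diff[OF z(1) x]] by blast
  then have "z a - x a = 0" by metis
  then show ?thesis by (simp add: inverse_entry_def z_def)
qed

text \<open>The position block of \<open>Q\<close> is inverted by the Green function \<open>g r\<^bsup>|i - j|\<^esup>\<close> of the discrete
  Laplacian, where \<open>r\<close> is the root of \<open>r + 1/r = 2 + \<omega>\<^sup>2/c\<^sup>2\<close> in \<open>(0, 1)\<close>.\<close>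

lemma gibbs_covariance_explicit:
  assumes pos: "m > 0" "\<omega> > 0" "c > 0"
  obtains r g :: real where "0 < r" "r < 1" "0 < g"
    "\<And>T i k j l. gibbs_covariance m \<omega> c T (i, k) (j, l) =
       (if k \<noteq> l then 0 else if k = Momentum then (if i = j then T * m else 0) else T * g * r ^ nat \<bar>i - j\<bar>)"
    "\<And>T a b. matrix_op (gibbs_matrix m \<omega> c) (\<lambda>a. gibbs_covariance m \<omega> c T a b) a = T * indicator {b} a"
proof -
  define \<kappa> where "\<kappa> = 2 + \<omega>\<^sup>2 / c\<^sup>2"
  have \<kappa>: "\<kappa> > 2" using pos by (simp add: \<kappa>_def)
  have \<kappa>2: "\<kappa>\<^sup>2 > 4" using power_strict_mono[of 2 \<kappa> 2] \<kappa> by simp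
  define s where "s = sqrt (\<kappa>\<^sup>2 - 4)"
  have s2: "s\<^sup>2 = \<kappa>\<^sup>2 - 4" and s0: "s > 0" using \<kappa>2 by (auto simp: s_def)
  have s\<kappa>: "s < \<kappa>" using s2 \<kappa> s0 by (intro power2_less_imp_less[of s \<kappa>]) auto
  have "\<kappa> - 2 < s"
  proof (rule power2_less_imp_less)
    show "(\<kappa> - 2)\<^sup>2 < s\<^sup>2" using s2 \<kappa> by (simp add: power2_eq_square algebra_simps)
  qed (use s0 in auto)
  define r where "r = (\<kappa> - s) / 2"
  have r: "0 < r" "r < 1" using s\<kappa> \<open>\<kappa> - 2 < s\<close> by (auto simp: r_def)
  have rr: "r * r + 1 = \<kappa> * r" using s2 by (simp add: r_def power2_eq_square field_simps)
  have r\<kappa>: "\<kappa> - 2 * r = s" by (simp add: r_def diff_divide_distrib)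
  \<comment> \<open>\<open>s = \<kappa> - 2 * r\<close> is what the discrete operator produces on
    the diagonal, where \<open>r ^ |i - j|\<close> has its kink; \<open>g\<close> normalises the
    result to 1.\<close>
  define g where "g = 1 / (m * c\<^sup>2 * s)"
  have g: "g > 0" using pos s0 by (simp add: g_def)
  have preimage: "\<exists>x\<in>ell2. matrix_op (gibbs_matrix m \<omega> c) x = indicator {(j, l)} \<and> (\<forall>i k. x (i, k) =
      (if k \<noteq> l then 0 else if k = Momentum then (if i = j then m else 0) else g * r ^ nat \<bar>i - j\<bar>))" for j l
  proof (cases l)
    case Momentum
    define x :: "site \<Rightarrow> real" where "x = (\<lambda>a. if a = (j, Momentum) then m else 0)"
    have "x \<in> ell2"
    proof -
      have "(\<lambda>a. (x a)\<^sup>2) summable_on UNIV \<longleftrightarrow> (\<lambda>a. (x a)\<^sup>2) summable_on {(j, Momentum)}"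
        by (intro summable_on_cong_neutral) (auto simp: x_def)
      then show ?thesis by (simp add: ell2_def)
    qed
    moreover have "matrix_op (gibbs_matrix m \<omega> c) x = indicator {(j, l)}"
    proof
      fix a show "matrix_op (gibbs_matrix m \<omega> c) x a = indicator {(j, l)} a"
        using pos Momentum by (cases a; cases "snd a") (auto simp: matrix_op_gibbs x_def)
    qed
    ultimately show ?thesis using Momentum by (intro bexI[of _ x]) (auto simp: x_def)
  next
    case Position
    define x :: "site \<Rightarrow> real" where
      "x = (\<lambda>(i, k). if k = Position then g * r ^ nat \<bar>i - j\<bar> else 0)"
    have "(\<lambda>i. (g * r ^ nat \<bar>i - j\<bar>)\<^sup>2) summable_on UNIV"
    proof (rule nonneg_bounded_partial_sums_imp_summable_on)
      show "\<forall>\<^sub>F F in finite_subsets_at_top UNIV. (\<Sum>i\<in>F. (g * r ^ nat \<bar>i - j\<bar>)\<^sup>2) \<le> g\<^sup>2 * (2 / (1 - r))"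
      proof (rule eventually_finite_subsets_at_top_weakI)
        fix F :: "int set" assume F: "finite F"
        have "(\<Sum>i\<in>F. (g * r ^ nat \<bar>i - j\<bar>)\<^sup>2) \<le> (\<Sum>i\<in>F. g\<^sup>2 * r ^ nat \<bar>j - i\<bar>)"
        proof (rule sum_mono)
          fix i
          have "(r ^ nat \<bar>i - j\<bar>)\<^sup>2 \<le> (r ^ nat \<bar>i - j\<bar>) ^ 1"
            by (rule power_decreasing) (use r in \<open>auto intro: power_le_one\<close>)
          then show "(g * r ^ nat \<bar>i - j\<bar>)\<^sup>2 \<le> g\<^sup>2 * r ^ nat \<bar>j - i\<bar>"
            by (simp add: power_mult_distrib abs_minus_commute mult_left_mono)
        qed
        also have "\<dots> \<le> g\<^sup>2 * (2 / (1 - r))"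
          unfolding sum_distrib_left[symmetric] by (intro mult_left_mono power_dist_sum_le r F) auto
        finally show "(\<Sum>i\<in>F. (g * r ^ nat \<bar>i - j\<bar>)\<^sup>2) \<le> g\<^sup>2 * (2 / (1 - r))" .
      qed
    qed auto
    then have "(\<lambda>a. (x a)\<^sup>2) summable_on (\<lambda>i. (i, Position)) ` UNIV"
      by (subst summable_on_reindex) (auto simp: inj_on_def x_def o_def)
    moreover have "(\<lambda>a. (x a)\<^sup>2) summable_on (\<lambda>i. (i, Position)) ` UNIV \<longleftrightarrow> (\<lambda>a. (x a)\<^sup>2) summable_on UNIV"
      by (intro summable_on_cong_neutral) (auto simp: x_def)
    ultimately have "x \<in> ell2" by (simp add: ell2_def)
    moreover have "matrix_op (gibbs_matrix m \<omega> c) x = indicator {(j, l)}"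
    proof
      fix a :: site
      obtain i k where a: "a = (i, k)" by (cases a)
      show "matrix_op (gibbs_matrix m \<omega> c) x a = indicator {(j, l)} a"
      proof (cases k)
        case Momentum
        then show ?thesis using Position a by (auto simp: matrix_op_gibbs x_def)
      next
        case k: Position
        have "m * (\<omega>\<^sup>2 + 2 * c\<^sup>2) = m * c\<^sup>2 * \<kappa>" using pos by (simp add: \<kappa>_def field_simps)
        then have *: "matrix_op (gibbs_matrix m \<omega> c) x a =
            m * c\<^sup>2 * g * (\<kappa> * r ^ nat \<bar>i - j\<bar> - r ^ nat \<bar>i - 1 - j\<bar> - r ^ nat \<bar>i + 1 - j\<bar>)"
          using a k by (simp add: matrix_op_gibbs x_def algebra_simps)
        \<comment> \<open>Off the diagonal the three powers lie on one geometric branch, where the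
          root equation \<open>r * r + 1 = \<kappa> * r\<close> annihilates them.\<close>
        consider "i = j" | n where "i = j + 1 + int n" | n where "i = j - 1 - int n"
          by (metis add.commute add_diff_cancel_left' diff_add_cancel diff_diff_eq2 int_cases3 nonneg_int_cases
              zle_iff_zadd linorder_cases zless_iff_Suc_zadd zless_imp_add1_zle)
        then show ?thesis
        proof cases
          case 1
          then have "matrix_op (gibbs_matrix m \<omega> c) x a = m * c\<^sup>2 * g * s" unfolding * r\<kappa>[symmetric] by simp
          also have "\<dots> = 1" using pos s0 by (simp add: g_def)
          finally show ?thesis using a k Position 1 by simp
        next
          case (2 n)
          have e: "nat \<bar>i - j\<bar> = Suc n" "nat \<bar>i - 1 - j\<bar> = n" "nat \<bar>i + 1 - j\<bar> = Suc (Suc n)"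
            using 2 by auto
          have "\<kappa> * r ^ Suc n - r ^ n - r ^ Suc (Suc n) = r ^ n * (\<kappa> * r - (r * r + 1))" by (simp add: algebra_simps)
          then have "matrix_op (gibbs_matrix m \<omega> c) x a = 0" unfolding * e rr by simp
          then show ?thesis using a k Position 2 by simp
        next
          case (3 n)
          have e: "nat \<bar>i - j\<bar> = Suc n" "nat \<bar>i - 1 - j\<bar> = Suc (Suc n)" "nat \<bar>i + 1 - j\<bar> = n"
            using 3 by auto
          have "\<kappa> * r ^ Suc n - r ^ Suc (Suc n) - r ^ n = r ^ n * (\<kappa> * r - (r * r + 1))" by (simp add: algebra_simps)
          then have "matrix_op (gibbs_matrix m \<omega> c) x a = 0" unfolding * e rr by simp
          then show ?thesis using a k Position 3 by simp
        qed
      qed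
    qed
    ultimately show ?thesis using Position by (intro bexI[of _ x]) (auto simp: x_def)
  qed
  show ?thesis
  proof (rule that[OF r g])
    fix T a b
    obtain x where x: "x \<in> ell2" "matrix_op (gibbs_matrix m \<omega> c) x = indicator {b}"
      using preimage[of "fst b" "snd b"] by auto
    have "(\<lambda>a. gibbs_covariance m \<omega> c T a b) = (\<lambda>a. T * x a)"
      unfolding gibbs_covariance_def gibbs_inverse_entry[OF pos x] ..
    moreover have "matrix_op (gibbs_matrix m \<omega> c) (\<lambda>a. T * x a) a = T * matrix_op (gibbs_matrix m \<omega> c) x a"
      by (cases a; cases "snd a") (auto simp: matrix_op_gibbs algebra_simps)
    ultimately show "matrix_op (gibbs_matrix m \<omega> c) (\<lambda>a. gibbs_covariance m \<omega> c T a b) a = T * indicator {b} a"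
      using x(2) by simp
  next
    fix T i k j l
    obtain x where x: "x \<in> ell2" "matrix_op (gibbs_matrix m \<omega> c) x = indicator {(j, l)}"
      "x (i, k) = (if k \<noteq> l then 0 else if k = Momentum then (if i = j then m else 0) else g * r ^ nat \<bar>i - j\<bar>)"
      using preimage[of j l] by blast
    show "gibbs_covariance m \<omega> c T (i, k) (j, l) =
       (if k \<noteq> l then 0 else if k = Momentum then (if i = j then T * m else 0) else T * g * r ^ nat \<bar>i - j\<bar>)"
      unfolding gibbs_covariance_def gibbs_inverse_entry[OF pos x(1,2)] x(3) by simp
  qed
qed

section \<open>Drift, dual drift and energy form\<close>

abbreviation fin_supp :: "('i \<Rightarrow> real) \<Rightarrow> bool" where
  "fin_supp w \<equiv> finite {a. w a \<noteq> 0}"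

text \<open>Asymmetric on purpose: only the left vector is meant to have finite support, the right
  one may be any configuration, in particular the random state of the chain.\<close>

definition pairing :: "('i \<Rightarrow> real) \<Rightarrow> ('i \<Rightarrow> real) \<Rightarrow> real" where
  "pairing w x = (\<Sum>a | w a \<noteq> 0. w a * x a)"

lemma pairing_on:
  assumes "finite F" "{a. w a \<noteq> 0} \<subseteq> F"
  shows "pairing w x = (\<Sum>a\<in>F. w a * x a)"
  unfolding pairing_def using assms by (intro sum.mono_neutral_left) auto

lemma fin_supp_lincomb:
  assumes "finite A" "\<And>k. k \<in> A \<Longrightarrow> fin_supp (u k)"
  shows "fin_supp (\<lambda>a. \<Sum>k\<in>A. r k * u k a)"
proof (rule finite_subset)
  show "{a. (\<Sum>k\<in>A. r k * u k a) \<noteq> 0} \<subseteq> (\<Union>k\<in>A. {a. u k a \<noteq> 0})"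
    by (auto intro!: sum.neutral)
qed (use assms in auto)

lemma fin_supp_add: "fin_supp v \<Longrightarrow> fin_supp w \<Longrightarrow> fin_supp (\<lambda>a. v a + w a)"
  by (rule finite_subset[of _ "{a. v a \<noteq> 0} \<union> {a. w a \<noteq> 0}"]) auto

lemma fin_supp_diff: "fin_supp v \<Longrightarrow> fin_supp w \<Longrightarrow> fin_supp (\<lambda>a. v a - w a)"
  by (rule finite_subset[of _ "{a. v a \<noteq> 0} \<union> {a. w a \<noteq> 0}"]) auto

lemma fin_supp_scale: "fin_supp v \<Longrightarrow> fin_supp (\<lambda>a. r * v a)"
  by (rule finite_subset[of _ "{a. v a \<noteq> 0}"]) auto

lemma pairing_add_left:
  assumes "fin_supp v" "fin_supp w"
  shows "pairing (\<lambda>a. v a + w a) x = pairing v x + pairing w x"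
proof -
  let ?F = "{a. v a \<noteq> 0} \<union> {a. w a \<noteq> 0}"
  have P: "pairing u x = (\<Sum>a\<in>?F. u a * x a)" if "{a. u a \<noteq> 0} \<subseteq> ?F" for u
    using assms that by (intro pairing_on) auto
  have "pairing v x = (\<Sum>a\<in>?F. v a * x a)" "pairing w x = (\<Sum>a\<in>?F. w a * x a)"
    "pairing (\<lambda>a. v a + w a) x = (\<Sum>a\<in>?F. (v a + w a) * x a)" by (rule P; auto)+
  then show ?thesis by (simp add: sum.distrib distrib_right)
qed

lemma pairing_scale_left: "pairing (\<lambda>a. r * v a) x = r * pairing v x"
  by (cases "r = 0") (simp_all add: pairing_def sum_distrib_left mult_ac)

lemma pairing_diff_left:
  assumes "fin_supp v" "fin_supp w"
  shows "pairing (\<lambda>a. v a - w a) x = pairing v x - pairing w x"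
  using pairing_add_left[OF assms(1) fin_supp_scale[OF assms(2), of "-1"], of x] pairing_scale_left[of "-1" w x]
  by simp

lemma pairing_lincomb_left:
  assumes "finite A" "\<And>k. k \<in> A \<Longrightarrow> fin_supp (u k)"
  shows "pairing (\<lambda>a. \<Sum>k\<in>A. r k * u k a) x = (\<Sum>k\<in>A. r k * pairing (u k) x)"
  using assms
proof (induction A rule: finite_induct)
  case empty
  then show ?case by (simp add: pairing_def)
next
  case (insert k A)
  then have "pairing (\<lambda>a. r k * u k a + (\<Sum>k\<in>A. r k * u k a)) x = r k * pairing (u k) x + (\<Sum>k\<in>A. r k * pairing (u k) x)"
    by (subst pairing_add_left) (auto intro: fin_supp_scale fin_supp_lincomb simp: pairing_scale_left)
  then show ?case using insert by simp
qed

lemma pairing_add_right: "pairing w (\<lambda>a. x a + y a) = pairing w x + pairing w y"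
  by (simp add: pairing_def sum.distrib distrib_left)

lemma pairing_scale_right: "pairing w (\<lambda>a. r * x a) = r * pairing w x"
  by (simp add: pairing_def sum_distrib_left mult_ac)

lemma pairing_lincomb_right: "pairing w (\<lambda>a. \<Sum>k\<in>A. r k * y k a) = (\<Sum>k\<in>A. r k * pairing w (y k))"
  by (induction A rule: infinite_finite_induct)
    (simp_all add: pairing_add_right pairing_scale_right, simp_all add: pairing_def)

definition sqnorm :: "('i \<Rightarrow> real) \<Rightarrow> real" where
  "sqnorm w = (\<Sum>a | w a \<noteq> 0. (w a)\<^sup>2)"

lemma sqnorm_on:
  assumes "finite F" "{a. w a \<noteq> 0} \<subseteq> F"
  shows "sqnorm w = (\<Sum>a\<in>F. (w a)\<^sup>2)"
  unfolding sqnorm_def using assms by (intro sum.mono_neutral_left) auto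

lemma sqnorm_nonneg: "0 \<le> sqnorm w"
  by (auto simp: sqnorm_def intro: sum_nonneg)

lemma sum_sq_reindex_le:
  assumes "fin_supp w" "finite F" "inj \<sigma>"
  shows "(\<Sum>a\<in>F. (w (\<sigma> a))\<^sup>2) \<le> sqnorm w"
proof -
  have "(\<Sum>a\<in>F. (w (\<sigma> a))\<^sup>2) = (\<Sum>b\<in>\<sigma> ` F. (w b)\<^sup>2)"
    using assms(3) by (subst sum.reindex) (auto intro: inj_on_subset)
  also have "\<dots> \<le> (\<Sum>b\<in>\<sigma> ` F \<union> {a. w a \<noteq> 0}. (w b)\<^sup>2)"
    using assms by (intro sum_mono2) auto
  also have "\<dots> = sqnorm w" using assms by (intro sqnorm_on[symmetric]) auto
  finally show ?thesis .
qed

text \<open>Minkowski's inequality, written with squared norms; a common finite set \<open>F\<close>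
  containing all supports makes \<open>L2_set\<close> applicable.\<close>

lemma sqnorm_lincomb_le:
  assumes "finite A" "\<And>k. k \<in> A \<Longrightarrow> fin_supp (u k)" "\<And>k. k \<in> A \<Longrightarrow> 0 \<le> r k"
    and b: "\<And>k. k \<in> A \<Longrightarrow> sqnorm (u k) \<le> (b k)\<^sup>2 * s" "\<And>k. k \<in> A \<Longrightarrow> 0 \<le> b k"
    and s: "0 \<le> s"
  shows "sqnorm (\<lambda>a. \<Sum>k\<in>A. r k * u k a) \<le> (\<Sum>k\<in>A. r k * b k)\<^sup>2 * s"
proof -
  define F where "F = (\<Union>k\<in>A. {a. u k a \<noteq> 0})"
  have F: "finite F" using assms by (auto simp: F_def)
  have N: "L2_set (u k) F \<le> b k * sqrt s" if "k \<in> A" for k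
  proof -
    have "sqnorm (u k) = (\<Sum>a\<in>F. (u k a)\<^sup>2)" by (rule sqnorm_on[OF F]) (use that in \<open>auto simp: F_def\<close>)
    then have "L2_set (u k) F = sqrt (sqnorm (u k))" by (simp add: L2_set_def)
    also have "\<dots> \<le> sqrt ((b k)\<^sup>2 * s)" using b(1)[OF that] by simp
    also have "\<dots> = b k * sqrt s" using b(2)[OF that] by (simp add: real_sqrt_mult)
    finally show ?thesis .
  qed
  have "L2_set (\<lambda>a. \<Sum>k\<in>B. r k * u k a) F \<le> (\<Sum>k\<in>B. r k * b k) * sqrt s" if "B \<subseteq> A" for B
    using finite_subset[OF that assms(1)] that
  proof (induction B rule: finite_induct)
    case (insert k B)
    have "L2_set (\<lambda>a. r k * u k a + (\<Sum>k\<in>B. r k * u k a)) F \<le>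
        L2_set (\<lambda>a. r k * u k a) F + L2_set (\<lambda>a. \<Sum>k\<in>B. r k * u k a) F"
      by (rule L2_set_triangle_ineq)
    also have "L2_set (\<lambda>a. r k * u k a) F = r k * L2_set (u k) F"
      using insert assms(3) by (simp add: L2_set_right_distrib)
    also have "\<dots> \<le> r k * (b k * sqrt s)" using insert assms(3) N by (intro mult_left_mono) auto
    finally show ?case using insert by (simp add: algebra_simps)
  qed (simp add: L2_set_def)
  from this[of A] have "L2_set (\<lambda>a. \<Sum>k\<in>A. r k * u k a) F \<le> (\<Sum>k\<in>A. r k * b k) * sqrt s" by simp
  then have "(L2_set (\<lambda>a. \<Sum>k\<in>A. r k * u k a) F)\<^sup>2 \<le> ((\<Sum>k\<in>A. r k * b k) * sqrt s)\<^sup>2"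
    by (intro power_mono) auto
  moreover have "(L2_set (\<lambda>a. \<Sum>k\<in>A. r k * u k a) F)\<^sup>2 = sqnorm (\<lambda>a. \<Sum>k\<in>A. r k * u k a)"
  proof -
    have "{a. (\<Sum>k\<in>A. r k * u k a) \<noteq> 0} \<subseteq> F"
      by (auto simp: F_def intro!: sum.neutral)
    then show ?thesis using sqnorm_on[OF F, of "\<lambda>a. \<Sum>k\<in>A. r k * u k a"] by (simp add: L2_set_def sum_nonneg)
  qed
  ultimately show ?thesis using s by (simp add: power_mult_distrib)
qed

text \<open>Besides the coordinate itself, the dual drift couples a momentum to the position at its
  site, and a position to the momenta at its site and at the two neighbours. These injections cover
  that pattern for shifts 0, 1 and -1, so support and norm bounds reduce to reindexing.\<close>

fun swap_shift :: "int \<Rightarrow> site \<Rightarrow> site" where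
  "swap_shift d (i, Momentum) = (i + d, Position)"
| "swap_shift d (i, Position) = (i + d, Momentum)"

lemma inj_swap_shift: "inj (swap_shift d)"
proof (rule injI)
  fix x y show "swap_shift d x = swap_shift d y \<Longrightarrow> x = y"
    by (cases x; cases "snd x"; cases y; cases "snd y") auto
qed

fun drift :: "real \<Rightarrow> real \<Rightarrow> real \<Rightarrow> real \<Rightarrow> (site \<Rightarrow> real) \<Rightarrow> site \<Rightarrow> real" where
  "drift m \<omega> c lam x (i, Momentum) = - m * \<omega>\<^sup>2 * x (i, Position) +
     m * c\<^sup>2 * (x (i - 1, Position) + x (i + 1, Position) - 2 * x (i, Position)) - lam * x (i, Momentum)"
| "drift m \<omega> c lam x (i, Position) = inverse m * x (i, Momentum)"

fun drift_adjoint :: "real \<Rightarrow> real \<Rightarrow> real \<Rightarrow> real \<Rightarrow> (site \<Rightarrow> real) \<Rightarrow> site \<Rightarrow> real" where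
  "drift_adjoint m \<omega> c lam w (i, Momentum) = - lam * w (i, Momentum) + inverse m * w (i, Position)"
| "drift_adjoint m \<omega> c lam w (i, Position) = - m * (\<omega>\<^sup>2 + 2 * c\<^sup>2) * w (i, Momentum) +
     m * c\<^sup>2 * (w (i - 1, Momentum) + w (i + 1, Momentum))"

text \<open>Positivity of the covariance is assumed here and comes for free later: the Gibbs
  covariance is the covariance of the actual state of the chain, so its quadratic form is an
  expected square.\<close>

locale gibbs_chain =
  fixes m \<omega> c T lam :: real
  assumes pos: "m > 0" "\<omega> > 0" "c > 0" "T > 0" "lam > 0"
    and covariance_psd: "\<And>F w. finite F \<Longrightarrow> 0 \<le> (\<Sum>a\<in>F. \<Sum>b\<in>F. w a * w b * gibbs_covariance m \<omega> c T a b)"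
begin

abbreviation C :: "site \<Rightarrow> site \<Rightarrow> real" where "C \<equiv> gibbs_covariance m \<omega> c T"
abbreviation B :: "(site \<Rightarrow> real) \<Rightarrow> site \<Rightarrow> real" where "B \<equiv> drift m \<omega> c lam"
abbreviation D :: "(site \<Rightarrow> real) \<Rightarrow> site \<Rightarrow> real" where "D \<equiv> drift_adjoint m \<omega> c lam"

section \<open>The energy form and its boundedness\<close>

definition form :: "(site \<Rightarrow> real) \<Rightarrow> (site \<Rightarrow> real) \<Rightarrow> real" where
  "form v w = pairing v (\<lambda>a. pairing w (C a))"

lemma form_on:
  assumes "finite F" "{a. v a \<noteq> 0} \<subseteq> F" "{a. w a \<noteq> 0} \<subseteq> F"
  shows "form v w = (\<Sum>a\<in>F. \<Sum>b\<in>F. v a * w b * C a b)"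
  unfolding form_def pairing_on[OF assms(1,2)] pairing_on[OF assms(1,3)] by (simp add: sum_distrib_left mult_ac)

lemma C_sym: "C a b = C b a"
proof -
  obtain r g where "\<And>i k j l. C (i, k) (j, l) =
       (if k \<noteq> l then 0 else if k = Momentum then (if i = j then T * m else 0) else T * g * r ^ nat \<bar>i - j\<bar>)"
    using gibbs_covariance_explicit[OF pos(1-3)] by metis
  then show ?thesis by (cases a; cases b) (auto simp: abs_minus_commute)
qed

text \<open>Geometric decay of the Green function gives uniformly bounded row sums, the input of the
  Schur test in \<open>form_le_sqnorm\<close>.\<close>

lemma C_row_bounded: "\<exists>K>0. \<forall>a F. finite F \<longrightarrow> (\<Sum>b\<in>F. \<bar>C a b\<bar>) \<le> K"
proof -
  obtain r g where r: "0 < r" "r < 1" "0 < g" and C: "\<And>i k j l. C (i, k) (j, l) =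
       (if k \<noteq> l then 0 else if k = Momentum then (if i = j then T * m else 0) else T * g * r ^ nat \<bar>i - j\<bar>)"
    using gibbs_covariance_explicit[OF pos(1-3)] by metis
  have row: "(\<Sum>b\<in>F. \<bar>C (i, k) b\<bar>) \<le> T * m + T * g * (2 / (1 - r))" if F: "finite F" for i k F
  proof -
    let ?P = "F \<inter> {b. snd b = Position}"
    have "(\<Sum>b\<in>F. \<bar>C (i, k) b\<bar>) \<le>
        (\<Sum>b\<in>F. (if b = (i, k) then T * m else 0) + (if b \<in> {b. snd b = Position} then T * g * r ^ nat \<bar>i - fst b\<bar> else 0))"
    proof (rule sum_mono)
      fix b
      have "0 \<le> T * g * r ^ n" for n using pos r by simp
      then show "\<bar>C (i, k) b\<bar> \<le> (if b = (i, k) then T * m else 0) +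
          (if b \<in> {b. snd b = Position} then T * g * r ^ nat \<bar>i - fst b\<bar> else 0)"
        using pos by (cases b; cases "snd b"; cases k) (auto simp: C)
    qed
    also have "\<dots> = (\<Sum>b\<in>F. if b = (i, k) then T * m else 0) + (\<Sum>b\<in>?P. T * g * r ^ nat \<bar>i - fst b\<bar>)"
      using F by (simp add: sum.distrib sum.inter_restrict)
    also have "(\<Sum>b\<in>F. if b = (i, k) then T * m else 0) \<le> T * m" using F pos by simp
    also have "(\<Sum>b\<in>?P. T * g * r ^ nat \<bar>i - fst b\<bar>) = T * g * (\<Sum>j\<in>fst ` ?P. r ^ nat \<bar>i - j\<bar>)"
      by (subst sum.reindex) (auto simp: inj_on_def sum_distrib_left)
    also have "\<dots> \<le> T * g * (2 / (1 - r))"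
      using F pos r by (intro mult_left_mono power_dist_sum_le) auto
    finally show ?thesis by simp
  qed
  show ?thesis
  proof (intro exI conjI allI impI)
    show "0 < T * m + T * g * (2 / (1 - r))" using pos r by (intro add_pos_pos mult_pos_pos divide_pos_pos) auto
    fix a F assume "finite (F :: site set)"
    then show "(\<Sum>b\<in>F. \<bar>C a b\<bar>) \<le> T * m + T * g * (2 / (1 - r))" using row[of F "fst a" "snd a"] by simp
  qed
qed

definition K :: real where
  "K = (SOME K. K > 0 \<and> (\<forall>a F. finite F \<longrightarrow> (\<Sum>b\<in>F. \<bar>C a b\<bar>) \<le> K))"

lemma K: "K > 0" "finite F \<Longrightarrow> (\<Sum>b\<in>F. \<bar>C a b\<bar>) \<le> K"
  unfolding K_def by (rule someI2_ex[OF C_row_bounded]; blast)+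

lemma form_sym: "fin_supp v \<Longrightarrow> fin_supp w \<Longrightarrow> form v w = form w v"
proof -
  let ?F = "{a. v a \<noteq> 0} \<union> {a. w a \<noteq> 0}"
  assume "fin_supp v" "fin_supp w"
  then have F: "finite ?F" by simp
  have "form v w = (\<Sum>a\<in>?F. \<Sum>b\<in>?F. v a * w b * C a b)" by (rule form_on[OF F]) auto
  also have "\<dots> = (\<Sum>a\<in>?F. \<Sum>b\<in>?F. w a * v b * C a b)"
    unfolding sum.swap[of "\<lambda>a b. v a * w b * C a b"]
  proof (intro sum.cong refl)
    fix a b show "v b * w a * C b a = w a * v b * C a b" using C_sym[of a b] by simp
  qed
  also have "\<dots> = form w v" by (rule form_on[OF F, symmetric]) auto
  finally show ?thesis .
qed

lemma form_add_left: "fin_supp v \<Longrightarrow> fin_supp v' \<Longrightarrow> form (\<lambda>a. v a + v' a) w = form v w + form v' w"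
  unfolding form_def by (rule pairing_add_left)

lemma form_scale_left: "form (\<lambda>a. r * v a) w = r * form v w"
  unfolding form_def by (rule pairing_scale_left)

lemma form_lincomb_left:
  "finite A \<Longrightarrow> (\<And>k. k \<in> A \<Longrightarrow> fin_supp (u k)) \<Longrightarrow> form (\<lambda>a. \<Sum>k\<in>A. r k * u k a) w = (\<Sum>k\<in>A. r k * form (u k) w)"
  unfolding form_def by (rule pairing_lincomb_left)

lemma form_lincomb_right:
  "finite A \<Longrightarrow> (\<And>k. k \<in> A \<Longrightarrow> fin_supp (u k)) \<Longrightarrow> form w (\<lambda>a. \<Sum>k\<in>A. r k * u k a) = (\<Sum>k\<in>A. r k * form w (u k))"
  unfolding form_def by (simp add: pairing_lincomb_left pairing_lincomb_right)

lemma form_add_right: "fin_supp v \<Longrightarrow> fin_supp v' \<Longrightarrow> form w (\<lambda>a. v a + v' a) = form w v + form w v'"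
  unfolding form_def by (simp add: pairing_add_left pairing_add_right)

lemma form_scale_right: "form w (\<lambda>a. r * v a) = r * form w v"
  unfolding form_def by (simp add: pairing_scale_left pairing_scale_right)

lemma form_diff_right: "fin_supp v \<Longrightarrow> fin_supp v' \<Longrightarrow> form w (\<lambda>a. v a - v' a) = form w v - form w v'"
  using form_add_right[of v "\<lambda>a. -1 * v' a" w] fin_supp_scale[of v' "-1"] form_scale_right[of w "-1" v'] by simp

lemma form_nonneg: "fin_supp w \<Longrightarrow> 0 \<le> form w w"
  using form_on[of "{a. w a \<noteq> 0}" w w] covariance_psd[of "{a. w a \<noteq> 0}" w] by simp

lemma form_add_self:
  assumes "fin_supp v" "fin_supp w"
  shows "form (\<lambda>a. v a + w a) (\<lambda>a. v a + w a) = form v v + 2 * form v w + form w w"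
  using assms by (simp add: form_add_left form_add_right fin_supp_add form_sym[of w v])

lemma form_abs_le:
  assumes "fin_supp v" "fin_supp w"
  shows "2 * \<bar>form v w\<bar> \<le> form v v + form w w"
proof -
  have "0 \<le> form v v + 2 * form v w + form w w"
    using form_nonneg[OF fin_supp_add[OF assms]] form_add_self[OF assms] by linarith
  moreover have "0 \<le> form v v - 2 * form v w + form w w"
    using form_nonneg[OF fin_supp_add[OF assms(1) fin_supp_scale[OF assms(2)], of "-1"]]
      form_add_self[OF assms(1) fin_supp_scale[OF assms(2)], of "-1"]
    by (simp only: form_scale_left form_scale_right)
  ultimately show ?thesis by linarith
qed

text \<open>Schur test: \<open>|w a * w b|\<close> is at most half the sum of the two squares, and
  by symmetry of \<open>C\<close> both halves are controlled by the row sums.\<close>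

lemma form_le_sqnorm:
  assumes "fin_supp w"
  shows "form w w \<le> K * sqnorm w"
proof -
  let ?F = "{a. w a \<noteq> 0}"
  have "form w w = (\<Sum>a\<in>?F. \<Sum>b\<in>?F. w a * w b * C a b)" using assms by (intro form_on) auto
  also have "\<dots> \<le> (\<Sum>a\<in>?F. \<Sum>b\<in>?F. ((w a)\<^sup>2 / 2 * \<bar>C a b\<bar> + (w b)\<^sup>2 / 2 * \<bar>C a b\<bar>))"
  proof (intro sum_mono)
    fix a b
    have "w a * w b * C a b \<le> \<bar>w a * w b\<bar> * \<bar>C a b\<bar>" by (simp add: abs_mult[symmetric])
    also have "\<bar>w a * w b\<bar> \<le> (w a)\<^sup>2 / 2 + (w b)\<^sup>2 / 2"
      using sum_squares_bound[of "\<bar>w a\<bar>" "\<bar>w b\<bar>"] by (simp add: abs_mult)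
    finally show "w a * w b * C a b \<le> (w a)\<^sup>2 / 2 * \<bar>C a b\<bar> + (w b)\<^sup>2 / 2 * \<bar>C a b\<bar>"
      by (simp add: algebra_simps mult_right_mono)
  qed
  also have "\<dots> = (\<Sum>a\<in>?F. \<Sum>b\<in>?F. (w a)\<^sup>2 / 2 * \<bar>C a b\<bar>) + (\<Sum>a\<in>?F. \<Sum>b\<in>?F. (w b)\<^sup>2 / 2 * \<bar>C a b\<bar>)"
    by (simp add: sum.distrib)
  also have "(\<Sum>a\<in>?F. \<Sum>b\<in>?F. (w b)\<^sup>2 / 2 * \<bar>C a b\<bar>) = (\<Sum>a\<in>?F. \<Sum>b\<in>?F. (w a)\<^sup>2 / 2 * \<bar>C a b\<bar>)"
    unfolding sum.swap[of "\<lambda>a b. (w b)\<^sup>2 / 2 * \<bar>C a b\<bar>"]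
  proof (intro sum.cong refl)
    fix a b show "(w a)\<^sup>2 / 2 * \<bar>C b a\<bar> = (w a)\<^sup>2 / 2 * \<bar>C a b\<bar>" using C_sym[of a b] by simp
  qed
  also have "(\<Sum>a\<in>?F. \<Sum>b\<in>?F. (w a)\<^sup>2 / 2 * \<bar>C a b\<bar>) + (\<Sum>a\<in>?F. \<Sum>b\<in>?F. (w a)\<^sup>2 / 2 * \<bar>C a b\<bar>)
     = (\<Sum>a\<in>?F. (w a)\<^sup>2 * (\<Sum>b\<in>?F. \<bar>C a b\<bar>))"
    by (simp add: sum_distrib_left sum.distrib[symmetric])
  also have "\<dots> \<le> (\<Sum>a\<in>?F. (w a)\<^sup>2 * K)"
    using assms by (intro sum_mono mult_left_mono K) auto
  also have "\<dots> = K * sqnorm w" by (simp add: sqnorm_def sum_distrib_left mult.commute)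
  finally show ?thesis .
qed

lemma form_abs_le_sqnorm:
  assumes "fin_supp v" "fin_supp w"
  shows "2 * \<bar>form v w\<bar> \<le> K * (sqnorm v + sqnorm w)"
  using form_abs_le[OF assms] form_le_sqnorm[OF assms(1)] form_le_sqnorm[OF assms(2)]
  by (simp add: algebra_simps)

section \<open>The dual drift: finite range, duality and operator bound\<close>

lemma D_support:
  "{a. D w a \<noteq> 0} \<subseteq> {a. w a \<noteq> 0} \<union> (\<Union>d\<in>{0, 1, -1}. swap_shift d -` {a. w a \<noteq> 0})"
proof
  fix a assume "a \<in> {a. D w a \<noteq> 0}"
  then show "a \<in> {a. w a \<noteq> 0} \<union> (\<Union>d\<in>{0, 1, -1}. swap_shift d -` {a. w a \<noteq> 0})"
    by (cases a; cases "snd a") (auto; fail)+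
qed

lemma fin_supp_D: "fin_supp w \<Longrightarrow> fin_supp (D w)"
  by (rule finite_subset[OF D_support]) (intro finite_UnI finite_UN_I finite_vimageI inj_swap_shift, auto)

lemma fin_supp_D_pow: "fin_supp w \<Longrightarrow> fin_supp ((D ^^ k) w)"
  by (induction k) (auto intro: fin_supp_D)

lemma D_lincomb: "D (\<lambda>a. \<Sum>k\<in>A. r k * u k a) = (\<lambda>a. \<Sum>k\<in>A. r k * D (u k) a)"
proof
  fix a show "D (\<lambda>a. \<Sum>k\<in>A. r k * u k a) a = (\<Sum>k\<in>A. r k * D (u k) a)"
    by (cases a; cases "snd a")
      (auto simp: sum_distrib_left sum.distrib sum_negf sum_subtractf algebra_simps)
qed

text \<open>Identifies \<open>drift_adjoint\<close> as the transpose of \<open>drift\<close>. By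
  linearity it suffices to take a unit vector \<open>e b\<close>, for which the pairing has at most
  four terms.\<close>

lemma pairing_drift:
  assumes "fin_supp w"
  shows "pairing w (B x) = pairing (D w) x"
proof -
  define e where "e = (\<lambda>b a :: site. if a = b then 1 else 0 :: real)"
  have fe: "fin_supp (e b)" for b by (auto simp: e_def)
  have De: "pairing (D (e b)) x = B x b" for b
  proof -
    obtain i k where b: "b = (i, k)" by (cases b)
    have sub: "{a. D (e b) a \<noteq> 0} \<subseteq> {(i, Momentum), (i, Position), (i - 1, Position), (i + 1, Position)}"
    proof
      fix a assume "a \<in> {a. D (e b) a \<noteq> 0}"
      then show "a \<in> {(i, Momentum), (i, Position), (i - 1, Position), (i + 1, Position)}"
        using b by (cases a; cases "snd a") (auto simp: e_def split: if_splits)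
    qed
    have "pairing (D (e b)) x = (\<Sum>a\<in>{(i, Momentum), (i, Position), (i - 1, Position), (i + 1, Position)}. D (e b) a * x a)"
      by (rule pairing_on[OF _ sub]) auto
    also have "\<dots> = B x b" using b by (cases k) (auto simp: e_def algebra_simps)
    finally show ?thesis .
  qed
  let ?F = "{a. w a \<noteq> 0}"
  have w: "w = (\<lambda>a. \<Sum>b\<in>?F. w b * e b a)"
  proof
    fix a
    have "(\<Sum>b\<in>?F. w b * e b a) = (\<Sum>b\<in>?F. if b = a then w a else 0)"
      by (intro sum.cong) (auto simp: e_def)
    then show "w a = (\<Sum>b\<in>?F. w b * e b a)" using assms by simp
  qed
  have "pairing (D w) x = (\<Sum>b\<in>?F. w b * pairing (D (e b)) x)"
    by (subst w, subst D_lincomb, subst pairing_lincomb_left) (use assms fe in \<open>auto intro: fin_supp_D\<close>)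
  then show ?thesis unfolding De by (simp add: pairing_def[of w])
qed

text \<open>Every coefficient of \<open>D\<close> is bounded by the bracket. The factor 4 counts the
  identity and the three shifts that can contribute to one coordinate of \<open>D w\<close>, which
  makes \<beta> a bound for the operator norm of \<open>D\<close>.\<close>

definition \<beta> :: real where "\<beta> = 4 * (lam + inverse m + m * (\<omega>\<^sup>2 + 2 * c\<^sup>2) + m * c\<^sup>2)"

lemma \<beta>_pos: "\<beta> > 0"
proof -
  have "0 \<le> m * (\<omega>\<^sup>2 + 2 * c\<^sup>2)" "0 \<le> m * c\<^sup>2" "0 < inverse m" using pos by auto
  then have "0 < lam + inverse m + m * (\<omega>\<^sup>2 + 2 * c\<^sup>2) + m * c\<^sup>2"
    using pos by (intro add_pos_nonneg add_pos_pos)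
  then show ?thesis unfolding \<beta>_def by simp
qed

lemma sqnorm_D_le:
  assumes "fin_supp w"
  shows "sqnorm (D w) \<le> \<beta>\<^sup>2 * sqnorm w"
proof -
  let ?F = "{a. D w a \<noteq> 0}"
  define \<gamma> where "\<gamma> = \<beta> / 4"
  have p: "0 \<le> m * (\<omega>\<^sup>2 + 2 * c\<^sup>2)" "0 \<le> m * c\<^sup>2" "0 < inverse m" using pos by auto
  have g: "lam \<le> \<gamma>" "inverse m \<le> \<gamma>" "m * (\<omega>\<^sup>2 + 2 * c\<^sup>2) \<le> \<gamma>" "m * c\<^sup>2 \<le> \<gamma>" "0 \<le> \<gamma>"
    using pos p by (auto simp: \<gamma>_def \<beta>_def)
  have le: "(D w a)\<^sup>2 \<le> 4 * \<gamma>\<^sup>2 * ((w a)\<^sup>2 + (w (swap_shift 0 a))\<^sup>2 + (w (swap_shift 1 a))\<^sup>2 + (w (swap_shift (-1) a))\<^sup>2)" for a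
  proof -
    have bd: "\<bar>r * x\<bar> \<le> \<gamma> * \<bar>x\<bar>" if "0 \<le> r" "r \<le> \<gamma>" for r x :: real
      using that by (simp add: abs_mult mult_right_mono)
    have "\<bar>D w a\<bar> \<le> \<gamma> * \<bar>w a\<bar> + \<gamma> * \<bar>w (swap_shift 0 a)\<bar> + \<gamma> * \<bar>w (swap_shift 1 a)\<bar> + \<gamma> * \<bar>w (swap_shift (-1) a)\<bar>"
    proof (cases a)
      case (Pair i k)
      show ?thesis
      proof (cases k)
        case Momentum
        have "\<bar>D w a\<bar> \<le> \<bar>lam * w (i, Momentum)\<bar> + \<bar>inverse m * w (i, Position)\<bar>"
          unfolding Pair Momentum by simp
        also have "\<dots> \<le> \<gamma> * \<bar>w (i, Momentum)\<bar> + \<gamma> * \<bar>w (i, Position)\<bar>"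
          using pos p by (intro add_mono bd g) auto
        also have "\<dots> \<le> \<gamma> * \<bar>w (i, Momentum)\<bar> + \<gamma> * \<bar>w (i, Position)\<bar> + \<gamma> * \<bar>w (i + 1, Position)\<bar> + \<gamma> * \<bar>w (i - 1, Position)\<bar>"
          using g(5) by simp
        finally show ?thesis unfolding Pair Momentum by simp
      next
        case Position
        have "D w a = - (m * (\<omega>\<^sup>2 + 2 * c\<^sup>2) * w (i, Momentum)) + m * c\<^sup>2 * w (i - 1, Momentum) + m * c\<^sup>2 * w (i + 1, Momentum)"
          unfolding Pair Position by (simp add: algebra_simps)
        also have "\<bar>\<dots>\<bar> \<le> \<bar>m * (\<omega>\<^sup>2 + 2 * c\<^sup>2) * w (i, Momentum)\<bar> + \<bar>m * c\<^sup>2 * w (i - 1, Momentum)\<bar> + \<bar>m * c\<^sup>2 * w (i + 1, Momentum)\<bar>"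
          by (rule abs_triangle_ineq[THEN order_trans], intro add_mono abs_triangle_ineq[THEN order_trans]) auto
        also have "\<dots> \<le> \<gamma> * \<bar>w (i, Momentum)\<bar> + \<gamma> * \<bar>w (i - 1, Momentum)\<bar> + \<gamma> * \<bar>w (i + 1, Momentum)\<bar>"
          by (intro add_mono bd g p)
        also have "\<dots> \<le> \<gamma> * \<bar>w (i, Position)\<bar> + \<gamma> * \<bar>w (i, Momentum)\<bar> + \<gamma> * \<bar>w (i + 1, Momentum)\<bar> + \<gamma> * \<bar>w (i - 1, Momentum)\<bar>"
          using g(5) by simp
        finally show ?thesis unfolding Pair Position by simp
      qed
    qed
    then have "\<bar>D w a\<bar> \<le> \<gamma> * (\<bar>w a\<bar> + \<bar>w (swap_shift 0 a)\<bar> + \<bar>w (swap_shift 1 a)\<bar> + \<bar>w (swap_shift (-1) a)\<bar>)"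
      by (simp add: algebra_simps)
    then have "\<bar>D w a\<bar>\<^sup>2 \<le> (\<gamma> * (\<bar>w a\<bar> + \<bar>w (swap_shift 0 a)\<bar> + \<bar>w (swap_shift 1 a)\<bar> + \<bar>w (swap_shift (-1) a)\<bar>))\<^sup>2"
      by (intro power_mono) auto
    also have "\<dots> = \<gamma>\<^sup>2 * (\<bar>w a\<bar> + \<bar>w (swap_shift 0 a)\<bar> + \<bar>w (swap_shift 1 a)\<bar> + \<bar>w (swap_shift (-1) a)\<bar>)\<^sup>2"
      by (simp add: power_mult_distrib)
    also have "\<dots> \<le> \<gamma>\<^sup>2 * (4 * (\<bar>w a\<bar>\<^sup>2 + \<bar>w (swap_shift 0 a)\<bar>\<^sup>2 + \<bar>w (swap_shift 1 a)\<bar>\<^sup>2 + \<bar>w (swap_shift (-1) a)\<bar>\<^sup>2))"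
    proof -
      have S: "(x + y + z + u)\<^sup>2 \<le> 4 * (x\<^sup>2 + y\<^sup>2 + z\<^sup>2 + u\<^sup>2)" for x y z u :: real
      proof -
        have "0 \<le> (x - y)\<^sup>2 + (x - z)\<^sup>2 + (x - u)\<^sup>2 + (y - z)\<^sup>2 + (y - u)\<^sup>2 + (z - u)\<^sup>2" by simp
        then show ?thesis by (simp add: power2_eq_square algebra_simps)
      qed
      show ?thesis by (rule mult_left_mono[OF S]) simp
    qed
    finally show ?thesis by (simp add: algebra_simps)
  qed
  have "sqnorm (D w) \<le> (\<Sum>a\<in>?F. 4 * \<gamma>\<^sup>2 * ((w a)\<^sup>2 + (w (swap_shift 0 a))\<^sup>2 + (w (swap_shift 1 a))\<^sup>2 + (w (swap_shift (-1) a))\<^sup>2))"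
    unfolding sqnorm_def by (intro sum_mono le)
  also have "\<dots> = 4 * \<gamma>\<^sup>2 * ((\<Sum>a\<in>?F. (w (id a))\<^sup>2) + (\<Sum>a\<in>?F. (w (swap_shift 0 a))\<^sup>2)
      + (\<Sum>a\<in>?F. (w (swap_shift 1 a))\<^sup>2) + (\<Sum>a\<in>?F. (w (swap_shift (-1) a))\<^sup>2))"
    by (simp add: sum_distrib_left sum.distrib distrib_left)
  also have "\<dots> \<le> 4 * \<gamma>\<^sup>2 * (sqnorm w + sqnorm w + sqnorm w + sqnorm w)"
    using assms fin_supp_D[OF assms]
    by (intro mult_left_mono add_mono sum_sq_reindex_le inj_swap_shift inj_on_id) auto
  also have "\<dots> = \<beta>\<^sup>2 * sqnorm w" by (simp add: \<gamma>_def power2_eq_square)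
  finally show ?thesis .
qed

lemma sqnorm_D_pow_le:
  assumes "fin_supp w"
  shows "sqnorm ((D ^^ k) w) \<le> (\<beta> ^ k)\<^sup>2 * sqnorm w"
proof (induction k)
  case (Suc k)
  have "sqnorm ((D ^^ Suc k) w) \<le> \<beta>\<^sup>2 * sqnorm ((D ^^ k) w)"
    using sqnorm_D_le[OF fin_supp_D_pow[OF assms]] by simp
  also have "\<dots> \<le> \<beta>\<^sup>2 * ((\<beta> ^ k)\<^sup>2 * sqnorm w)" by (intro mult_left_mono Suc) auto
  finally show ?case by (simp add: power_mult_distrib mult_ac)
qed simp

definition momentum_sq :: "(site \<Rightarrow> real) \<Rightarrow> real" where
  "momentum_sq w = (\<Sum>a | w a \<noteq> 0 \<and> snd a = Momentum. (w a)\<^sup>2)"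

lemma momentum_sq_on:
  assumes "finite F" "{a. w a \<noteq> 0} \<subseteq> F"
  shows "momentum_sq w = (\<Sum>a\<in>{a\<in>F. snd a = Momentum}. (w a)\<^sup>2)"
  unfolding momentum_sq_def using assms by (intro sum.mono_neutral_left) auto

text \<open>The entries of \<open>B C + C B\<^sup>T\<close>: fluctuation-dissipation.\<close>

lemma drift_C_entries:
  "B (C a) (j, Momentum) = (if a = (j, Position) then - T else 0) + (if a = (j, Momentum) then - lam * m * T else 0)"
  "B (C a) (j, Position) = (if a = (j, Momentum) then T else 0)"
proof -
  have inv: "matrix_op (gibbs_matrix m \<omega> c) (\<lambda>b. C a b) b = T * indicator {a} b" for b
  proof -
    have e: "C a = (\<lambda>b. C b a)" using C_sym by blast
    show ?thesis unfolding e
    proof (rule gibbs_covariance_explicit[OF pos(1-3)])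
      assume "\<And>T a b. matrix_op (gibbs_matrix m \<omega> c) (\<lambda>a. gibbs_covariance m \<omega> c T a b) a = T * indicator {b} a"
      then show "matrix_op (gibbs_matrix m \<omega> c) (\<lambda>b. C b a) b = T * indicator {a} b" .
    qed
  qed
  have M: "C a (j, Momentum) = (if a = (j, Momentum) then m * T else 0)"
    using inv[of "(j, Momentum)"] pos by (auto simp: matrix_op_gibbs field_simps split: if_splits)
  \<comment> \<open>On positions the force is minus the position block of \<open>Q\<close>; applied
    to a row of \<open>C\<close>, which is \<open>T\<close> times the inverse of \<open>Q\<close>,
    it returns \<open>- T\<close> times a unit vector.\<close>
  have "B (C a) (j, Momentum) = - (T * indicator {a} (j, Position)) - lam * C a (j, Momentum)"
    unfolding inv[symmetric] by (simp add: matrix_op_gibbs algebra_simps)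
  then show "B (C a) (j, Momentum) = (if a = (j, Position) then - T else 0) + (if a = (j, Momentum) then - lam * m * T else 0)"
    unfolding M by auto
  show "B (C a) (j, Position) = (if a = (j, Momentum) then T else 0)"
    using pos by (simp add: M)
qed

lemma drift_C: "B (C a) b + B (C b) a = (if a = b \<and> snd a = Momentum then - 2 * T * lam * m else 0)"
  by (cases a; cases "snd a"; cases b; cases "snd b") (simp_all del: drift.simps add: drift_C_entries)

text \<open>Half the rate of change of the energy under the dual flow. Symmetrising the double sum
  brings in \<open>drift_C\<close>, where the Hamiltonian contributions cancel and only friction on
  the momenta is left.\<close>

lemma form_D_self:
  assumes "fin_supp w"
  shows "form w (D w) = - T * lam * m * momentum_sq w"
proof -
  let ?F = "{a. w a \<noteq> 0}"
  have "form w (D w) = (\<Sum>a\<in>?F. w a * pairing w (B (C a)))"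
    using assms by (simp add: form_def pairing_def[of w "\<lambda>a. pairing (D w) (C a)"] pairing_drift)
  also have "\<dots> = (\<Sum>a\<in>?F. \<Sum>b\<in>?F. w a * w b * B (C a) b)"
    by (simp add: pairing_def sum_distrib_left mult_ac)
  finally have 1: "form w (D w) = (\<Sum>a\<in>?F. \<Sum>b\<in>?F. w a * w b * B (C a) b)" .
  have 2: "form w (D w) = (\<Sum>a\<in>?F. \<Sum>b\<in>?F. w a * w b * B (C b) a)"
    unfolding 1 by (subst sum.swap) (simp add: mult_ac)
  have "2 * form w (D w) = (\<Sum>a\<in>?F. \<Sum>b\<in>?F. w a * w b * B (C a) b) + (\<Sum>a\<in>?F. \<Sum>b\<in>?F. w a * w b * B (C b) a)"
    using 1 2 by simp
  also have "\<dots> = (\<Sum>a\<in>?F. \<Sum>b\<in>?F. w a * w b * (B (C a) b + B (C b) a))"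
    by (simp add: sum.distrib distrib_left)
  also have "\<dots> = (\<Sum>a\<in>?F. \<Sum>b\<in>?F. if b = a then (if snd a = Momentum then - 2 * T * lam * m * (w a)\<^sup>2 else 0) else 0)"
    unfolding drift_C by (intro sum.cong) (auto simp: power2_eq_square)
  also have "\<dots> = (\<Sum>a\<in>?F. if snd a = Momentum then - 2 * T * lam * m * (w a)\<^sup>2 else 0)"
    using assms by simp
  also have "\<dots> = - 2 * T * lam * m * momentum_sq w"
    using assms by (simp add: momentum_sq_def sum_distrib_left sum.inter_filter[symmetric])
  finally show ?thesis by simp
qed

end

section \<open>Dissipation of the dual flow\<close>

lemma exp_partial_sum_le:
  fixes x :: real
  assumes "0 \<le> x" "finite A"
  shows "(\<Sum>k\<in>A. x ^ k / fact k) \<le> exp x"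
proof -
  have s: "(\<lambda>k. x ^ k / fact k) sums exp x"
    using exp_converges[of x] by (simp add: divide_inverse_commute)
  have "(\<Sum>k\<in>A. x ^ k / fact k) \<le> (\<Sum>k. x ^ k / fact k)"
    using assms s by (intro sum_le_suminf) (auto simp: sums_iff)
  then show ?thesis using s by (simp add: sums_iff)
qed

lemma power_over_fact_tendsto_0: "(\<lambda>n. x ^ n / fact n :: real) \<longlonglongrightarrow> 0"
  using exp_converges[of x] by (auto simp: divide_inverse_commute sums_iff intro: summable_LIMSEQ_zero)

context gibbs_chain
begin

text \<open>Partial sum of the series for \<open>exp (s D) w\<close>. Truncation keeps the support
  finite, as \<open>pairing\<close> and the Gaussian hypothesis require.\<close>

definition flow :: "nat \<Rightarrow> real \<Rightarrow> (site \<Rightarrow> real) \<Rightarrow> site \<Rightarrow> real" where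
  "flow N s w = (\<lambda>a. \<Sum>k\<le>N. s ^ k / fact k * (D ^^ k) w a)"

lemma fin_supp_flow: "fin_supp w \<Longrightarrow> fin_supp (flow N s w)"
  unfolding flow_def by (intro fin_supp_lincomb fin_supp_D_pow) auto

lemma flow_0: "flow N 0 w = w"
proof
  fix a
  have "flow N 0 w a = (\<Sum>k\<le>N. if k = 0 then w a else 0)"
    unfolding flow_def by (intro sum.cong) auto
  then show "flow N 0 w a = w a" by simp
qed

lemma flow_Suc: "flow (Suc N) s w a = flow N s w a + s ^ Suc N / fact (Suc N) * (D ^^ Suc N) w a"
  by (simp add: flow_def)

lemma D_flow: "D (flow N s w) = flow N s (D w)"
  unfolding flow_def D_lincomb funpow_swap1 ..

lemma D_pow_lincomb: "(D ^^ n) (\<lambda>a. \<Sum>k\<in>A. r k * u k a) = (\<lambda>a. \<Sum>k\<in>A. r k * (D ^^ n) (u k) a)"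
  by (induction n) (simp_all add: D_lincomb del: drift_adjoint.simps)

lemma flow_lincomb: "flow N s (\<lambda>a. \<Sum>j\<in>J. r j * u j a) = (\<lambda>a. \<Sum>j\<in>J. r j * flow N s (u j) a)"
  unfolding flow_def D_pow_lincomb by (rule ext, simp only: sum_distrib_left, subst sum.swap) (simp add: mult_ac)

text \<open>Differentiation costs one order of truncation. This mismatch between
  \<open>flow (Suc N)\<close> and \<open>flow N\<close> is the source of the truncation errors in
  the energy estimate and in Duhamel's formula.\<close>

lemma flow_deriv:
  "((\<lambda>s. flow (Suc N) s w a) has_real_derivative D (flow N s w) a) (at s)"
proof (induction N)
  case 0
  show ?case unfolding flow_def by (auto intro!: derivative_eq_intros)
next
  case (Suc N)
  have "((\<lambda>s. flow (Suc N) s w a + s ^ Suc (Suc N) / fact (Suc (Suc N)) * (D ^^ Suc (Suc N)) w a) has_real_derivative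
      D (flow N s w) a + s ^ Suc N / fact (Suc N) * (D ^^ Suc (Suc N)) w a) (at s)"
  proof (rule DERIV_add[OF Suc])
    have *: "real (Suc (Suc N)) * x / fact (Suc (Suc N)) = x / fact (Suc N)" for x
      by (simp add: fact_Suc[of "Suc N"] del: of_nat_Suc fact_Suc)
    have "((\<lambda>s. s ^ Suc (Suc N) / fact (Suc (Suc N)) * (D ^^ Suc (Suc N)) w a) has_real_derivative
       (real (Suc (Suc N)) * s ^ Suc N) / fact (Suc (Suc N)) * (D ^^ Suc (Suc N)) w a) (at s)"
      by (intro DERIV_cmult_right DERIV_cdivide) (use DERIV_pow[of "Suc (Suc N)" s] in simp)
    then show "((\<lambda>s. s ^ Suc (Suc N) / fact (Suc (Suc N)) * (D ^^ Suc (Suc N)) w a) has_real_derivative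
       s ^ Suc N / fact (Suc N) * (D ^^ Suc (Suc N)) w a) (at s)" unfolding * .
  qed
  moreover have "D (flow (Suc N) s w) a = D (flow N s w) a + s ^ Suc N / fact (Suc N) * (D ^^ Suc (Suc N)) w a"
    unfolding D_flow flow_Suc funpow_Suc_right o_def ..
  ultimately show ?case unfolding flow_Suc[of "Suc N"] by simp
qed

lemma sqnorm_flow_le:
  assumes "fin_supp w" "0 \<le> s"
  shows "sqnorm (flow N s w) \<le> (exp (s * \<beta>))\<^sup>2 * sqnorm w"
proof -
  have "sqnorm (flow N s w) \<le> (\<Sum>k\<le>N. s ^ k / fact k * \<beta> ^ k)\<^sup>2 * sqnorm w"
    unfolding flow_def
    by (intro sqnorm_lincomb_le sqnorm_D_pow_le fin_supp_D_pow sqnorm_nonneg) (use assms \<beta>_pos in auto)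
  also have "(\<Sum>k\<le>N. s ^ k / fact k * \<beta> ^ k) = (\<Sum>k\<le>N. (s * \<beta>) ^ k / fact k)"
    by (simp add: power_mult_distrib)
  also have "(\<Sum>k\<le>N. (s * \<beta>) ^ k / fact k)\<^sup>2 * sqnorm w \<le> (exp (s * \<beta>))\<^sup>2 * sqnorm w"
    using assms \<beta>_pos by (intro mult_right_mono power_mono exp_partial_sum_le sqnorm_nonneg sum_nonneg) auto
  finally show ?thesis .
qed

definition remainder :: "nat \<Rightarrow> real \<Rightarrow> (site \<Rightarrow> real) \<Rightarrow> site \<Rightarrow> real" where
  "remainder N s w = (\<lambda>a. \<Sum>k\<in>{2..Suc N}. s ^ k / fact k * (D ^^ k) w a)"

lemma fin_supp_remainder: "fin_supp w \<Longrightarrow> fin_supp (remainder N s w)"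
  unfolding remainder_def by (intro fin_supp_lincomb fin_supp_D_pow) auto

lemma flow_taylor: "flow (Suc N) s w a = w a + s * D w a + remainder N s w a"
proof -
  have "{..Suc N} = insert 0 (insert 1 {2..Suc N})" by auto
  then show ?thesis by (simp add: flow_def remainder_def)
qed

text \<open>For \<open>s \<le> 1\<close> every term of order at least 2 carries a factor
  \<open>s^2\<close>, and the remaining coefficients sum to at most \<open>exp \<beta>\<close>,
  uniformly in \<open>N\<close>.\<close>

lemma sqnorm_remainder_le:
  assumes "fin_supp w" "0 \<le> s" "s \<le> 1"
  shows "sqnorm (remainder N s w) \<le> s ^ 4 * (exp \<beta>)\<^sup>2 * sqnorm w"
proof -
  have "sqnorm (remainder N s w) \<le> (\<Sum>k\<in>{2..Suc N}. s ^ k / fact k * \<beta> ^ k)\<^sup>2 * sqnorm w"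
    unfolding remainder_def
    by (intro sqnorm_lincomb_le sqnorm_D_pow_le fin_supp_D_pow sqnorm_nonneg) (use assms \<beta>_pos in auto)
  also have "\<dots> \<le> (s\<^sup>2 * exp \<beta>)\<^sup>2 * sqnorm w"
  proof (intro mult_right_mono power_mono sqnorm_nonneg sum_nonneg)
    have "(\<Sum>k\<in>{2..Suc N}. s ^ k / fact k * \<beta> ^ k) \<le> (\<Sum>k\<in>{2..Suc N}. s\<^sup>2 * (\<beta> ^ k / fact k))"
    proof (rule sum_mono)
      fix k assume "k \<in> {2..Suc N}"
      then have "s ^ k \<le> s\<^sup>2" using assms by (intro power_decreasing) auto
      then have "s ^ k * (\<beta> ^ k / fact k) \<le> s\<^sup>2 * (\<beta> ^ k / fact k)" using \<beta>_pos by (intro mult_right_mono) auto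
      then show "s ^ k / fact k * \<beta> ^ k \<le> s\<^sup>2 * (\<beta> ^ k / fact k)" by simp
    qed
    also have "\<dots> \<le> s\<^sup>2 * exp \<beta>"
      unfolding sum_distrib_left[symmetric] using \<beta>_pos by (intro mult_left_mono exp_partial_sum_le) auto
    finally show "(\<Sum>k\<in>{2..Suc N}. s ^ k / fact k * \<beta> ^ k) \<le> s\<^sup>2 * exp \<beta>" .
  qed (use assms \<beta>_pos in auto)
  also have "(s\<^sup>2 * exp \<beta>)\<^sup>2 = s ^ 4 * (exp \<beta>)\<^sup>2" by (simp add: power_mult_distrib)
  finally show ?thesis .
qed

text \<open>For \<open>x = flow (Suc N) s w\<close>, the derivative of the flow is
  \<open>D x\<close> minus \<open>s ^ Suc N / fact (Suc N)\<close> times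
  \<open>(D ^^ (N + 2)) w\<close>. The two squares bound the square norms of \<open>x\<close> and of
  the last vector relative to \<open>sqnorm w\<close>.\<close>

definition energy_error :: "nat \<Rightarrow> real \<Rightarrow> real" where
  "energy_error N t = t ^ Suc N / fact (Suc N) * K * ((exp (t * \<beta>))\<^sup>2 + (\<beta> ^ (N + 2))\<^sup>2)"

lemma energy_error_tendsto_0: "(\<lambda>N. energy_error N t) \<longlonglongrightarrow> 0"
proof -
  have "(\<lambda>n. K * (exp (t * \<beta>))\<^sup>2 * (t ^ n / fact n) + K * \<beta>\<^sup>2 * ((t * \<beta>\<^sup>2) ^ n / fact n)) \<longlonglongrightarrow>
      K * (exp (t * \<beta>))\<^sup>2 * 0 + K * \<beta>\<^sup>2 * 0"
    by (intro tendsto_intros power_over_fact_tendsto_0)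
  then have "(\<lambda>n. K * (exp (t * \<beta>))\<^sup>2 * (t ^ Suc n / fact (Suc n)) + K * \<beta>\<^sup>2 * ((t * \<beta>\<^sup>2) ^ Suc n / fact (Suc n))) \<longlonglongrightarrow> 0"
    by (subst (asm) filterlim_sequentially_Suc[symmetric]) simp
  moreover have "K * (exp (t * \<beta>))\<^sup>2 * (t ^ Suc n / fact (Suc n)) + K * \<beta>\<^sup>2 * ((t * \<beta>\<^sup>2) ^ Suc n / fact (Suc n)) = energy_error n t" for n
    unfolding energy_error_def by (simp add: power_mult_distrib power_add power2_eq_square power_mult[symmetric] distrib_left mult_ac del: fact_Suc)
  ultimately show ?thesis by simp
qed

section \<open>Decay of the energy along the truncated flow\<close>

definition energy :: "nat \<Rightarrow> (site \<Rightarrow> real) \<Rightarrow> real \<Rightarrow> real" where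
  "energy N w s = form (flow (Suc N) s w) (flow (Suc N) s w)"

lemma energy_deriv:
  assumes w: "fin_supp w"
  shows "(energy N w has_real_derivative 2 * form (flow (Suc N) s w) (D (flow N s w))) (at s)"
proof -
  \<comment> \<open>One finite support serves all times, so the energy is a fixed finite double sum
    that can be differentiated term by term.\<close>
  define F where "F = (\<Union>k\<le>Suc (Suc N). {a. (D ^^ k) w a \<noteq> 0})"
  have F: "finite F" unfolding F_def by (intro finite_UN_I fin_supp_D_pow w) auto
  have S: "{a. flow (Suc N) s w a \<noteq> 0} \<subseteq> F" for s
  proof
    fix a assume "a \<in> {a. flow (Suc N) s w a \<noteq> 0}"
    then have "(\<Sum>k\<le>Suc N. s ^ k / fact k * (D ^^ k) w a) \<noteq> 0" unfolding flow_def by blast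
    then obtain k where "k \<in> {..Suc N}" "s ^ k / fact k * (D ^^ k) w a \<noteq> 0"
      by (rule sum.not_neutral_contains_not_neutral)
    then show "a \<in> F" unfolding F_def by (intro UN_I[of k]) auto
  qed
  have SD: "{a. D (flow N s w) a \<noteq> 0} \<subseteq> F"
  proof
    fix a assume "a \<in> {a. D (flow N s w) a \<noteq> 0}"
    then have "(\<Sum>k\<le>N. s ^ k / fact k * (D ^^ k) (D w) a) \<noteq> 0" unfolding D_flow unfolding flow_def by blast
    then obtain k where "k \<in> {..N}" "s ^ k / fact k * (D ^^ k) (D w) a \<noteq> 0"
      by (rule sum.not_neutral_contains_not_neutral)
    then show "a \<in> F" unfolding F_def by (intro UN_I[of "Suc k"]) (auto simp: funpow_swap1)
  qed
  have "energy N w = (\<lambda>s. \<Sum>a\<in>F. \<Sum>b\<in>F. flow (Suc N) s w a * flow (Suc N) s w b * C a b)"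
    unfolding energy_def by (rule ext, rule form_on[OF F S S])
  moreover have "((\<lambda>s. \<Sum>a\<in>F. \<Sum>b\<in>F. flow (Suc N) s w a * flow (Suc N) s w b * C a b) has_real_derivative
      (\<Sum>a\<in>F. \<Sum>b\<in>F. (D (flow N s w) a * flow (Suc N) s w b + D (flow N s w) b * flow (Suc N) s w a) * C a b)) (at s)"
    by (intro DERIV_sum DERIV_cmult_right DERIV_mult flow_deriv)
  moreover have "(\<Sum>a\<in>F. \<Sum>b\<in>F. (D (flow N s w) a * flow (Suc N) s w b + D (flow N s w) b * flow (Suc N) s w a) * C a b)
      = form (D (flow N s w)) (flow (Suc N) s w) + form (flow (Suc N) s w) (D (flow N s w))"
    unfolding form_on[OF F SD S] form_on[OF F S SD] by (simp only: sum.distrib[symmetric]) (intro sum.cong refl, simp add: algebra_simps)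
  moreover have "form (D (flow N s w)) (flow (Suc N) s w) = form (flow (Suc N) s w) (D (flow N s w))"
    by (intro form_sym fin_supp_D fin_supp_flow w)
  ultimately show ?thesis by simp
qed

lemma energy_deriv_le:
  assumes w: "fin_supp w" and s: "0 \<le> s" "s \<le> t"
  shows "2 * form (flow (Suc N) s w) (D (flow N s w)) \<le>
    - 2 * T * lam * m * momentum_sq (flow (Suc N) s w) + energy_error N t * sqnorm w"
proof -
  define x where "x = flow (Suc N) s w"
  define u where "u = (D ^^ (N + 2)) w"
  define r where "r = s ^ Suc N / fact (Suc N)"
  have D: "D (flow N s w) = (\<lambda>a. D x a - r * u a)"
  proof
    fix a
    have "D x a = flow N s (D w) a + r * (D ^^ Suc N) (D w) a"
      unfolding x_def D_flow r_def flow_Suc ..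
    also have "(D ^^ Suc N) (D w) = u" by (simp add: u_def funpow_swap1)
    finally show "D (flow N s w) a = D x a - r * u a" by (simp add: D_flow)
  qed
  have fx: "fin_supp x" "fin_supp (D x)" "fin_supp u"
    unfolding x_def u_def by (intro fin_supp_flow fin_supp_D fin_supp_D_pow w)+
  have r: "0 \<le> r" "r \<le> t ^ Suc N / fact (Suc N)"
    unfolding r_def using s by (auto intro!: divide_right_mono power_mono simp del: fact_Suc power_Suc)
  have "2 * form (flow (Suc N) s w) (D (flow N s w)) = - 2 * T * lam * m * momentum_sq x - r * (2 * form x u)"
    unfolding D x_def[symmetric] using form_diff_right[OF fx(2) fin_supp_scale[OF fx(3)], of x r] form_scale_right[of x r u]
      form_D_self[OF fx(1)] by (simp add: algebra_simps del: fact_Suc)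
  also have "\<dots> \<le> - 2 * T * lam * m * momentum_sq x + r * (2 * \<bar>form x u\<bar>)"
  proof -
    have "r * (- (2 * form x u)) \<le> r * (2 * \<bar>form x u\<bar>)" using r(1) by (intro mult_left_mono) auto
    then have "- (r * (2 * form x u)) \<le> r * (2 * \<bar>form x u\<bar>)" by (simp only: mult_minus_right)
    then show ?thesis by linarith
  qed
  also have "r * (2 * \<bar>form x u\<bar>) \<le> t ^ Suc N / fact (Suc N) * (K * (sqnorm x + sqnorm u))"
    using form_abs_le_sqnorm[OF fx(1,3)] by (rule mult_mono[OF r(2)]) (use r in auto)
  also have "\<dots> \<le> t ^ Suc N / fact (Suc N) * (K * ((exp (t * \<beta>))\<^sup>2 * sqnorm w + (\<beta> ^ (N + 2))\<^sup>2 * sqnorm w))"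
    unfolding u_def
  proof (intro mult_left_mono add_mono sqnorm_D_pow_le w)
    have "sqnorm x \<le> (exp (s * \<beta>))\<^sup>2 * sqnorm w" unfolding x_def by (rule sqnorm_flow_le[OF w s(1)])
    also have "\<dots> \<le> (exp (t * \<beta>))\<^sup>2 * sqnorm w"
      using s \<beta>_pos by (intro mult_right_mono power_mono sqnorm_nonneg) auto
    finally show "sqnorm x \<le> (exp (t * \<beta>))\<^sup>2 * sqnorm w" .
  qed (use K s in auto)
  also have "\<dots> = energy_error N t * sqnorm w" by (simp add: energy_error_def algebra_simps del: fact_Suc)
  finally show ?thesis by (simp add: x_def)
qed

text \<open>On \<open>[0, \<tau>]\<close> the momentum part of the flow is
  \<open>w + s * D w\<close> up to order \<open>s^2\<close>, and the momenta of \<open>D w\<close>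
  contain the positions of \<open>w\<close>. Integrating the square of this expression controls all
  of \<open>w\<close>. From \<tau> to \<open>t\<close> the energy can grow only by the truncation
  error.\<close>

lemma energy_decay:
  assumes t: "t > 0"
  shows "\<exists>\<rho>>0. \<rho> < 1 \<and> (\<forall>w N. fin_supp w \<longrightarrow>
    energy N w t \<le> \<rho>\<^sup>2 * form w w + t * energy_error N t * sqnorm w)"
proof -
  \<comment> \<open>Solving \<open>D w (i, Momentum) = - lam * w (i, Momentum) + w (i, Position) /
    m\<close> for the position bounds the square norm of \<open>w\<close> by \<theta> times the sum
    of the momentum squares of \<open>w\<close> and \<open>D w\<close>; see
    \<open>nle\<close>.\<close>
  define \<theta> where "\<theta> = 1 + 2 * m\<^sup>2 + 2 * m\<^sup>2 * lam\<^sup>2"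
  have \<theta>: "\<theta> > 0" unfolding \<theta>_def by (intro add_pos_nonneg) auto
  define e where "e = (exp \<beta>)\<^sup>2"
  have e: "e > 0" by (simp add: e_def)
  have te: "0 < 1 / (1 + 64 * \<theta> * e)"
    using \<theta> e by (intro divide_pos_pos add_pos_pos mult_pos_pos) auto
  \<comment> \<open>Small enough for \<open>64 * \<theta> * e * \<tau>^2 \<le> 1\<close>, so that
    the loss of order \<open>\<tau>^5\<close> from the Taylor remainder is absorbed by the gain of
    order \<open>\<tau>^3\<close>.\<close>
  define \<tau> where "\<tau> = min (min 1 t) (1 / (1 + 64 * \<theta> * e))"
  have \<tau>: "0 < \<tau>" "\<tau> \<le> 1" "\<tau> \<le> t" "\<tau> \<le> 1 / (1 + 64 * \<theta> * e)"
    unfolding \<tau>_def using t te by linarith+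
  have \<tau>2: "64 * \<theta> * e * \<tau>\<^sup>2 \<le> 1"
  proof -
    have "\<tau>\<^sup>2 \<le> \<tau>" using \<tau> power_decreasing[of 1 2 \<tau>] by simp
    also have "\<dots> \<le> 1 / (1 + 64 * \<theta> * e)" by fact
    finally have "(64 * \<theta> * e) * \<tau>\<^sup>2 \<le> (64 * \<theta> * e) * (1 / (1 + 64 * \<theta> * e))"
      using \<theta> e by (intro mult_left_mono) auto
    also have "\<dots> \<le> 1"
    proof -
      have *: "x * (1 / (1 + x)) \<le> 1" if "x > 0" for x :: real using that by simp
      show ?thesis by (rule *) (use \<theta> e in simp)
    qed
    finally show ?thesis .
  qed
  define g where "g = 2 * T * lam * m"
  have g: "g > 0" using pos by (simp add: g_def)
  \<comment> \<open>The gain is a multiple of \<open>sqnorm w\<close>; dividing by \<open>K\<close>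
    turns it into a fraction of \<open>form w w\<close>, by \<open>form_le_sqnorm\<close>.\<close>
  define \<delta> where "\<delta> = g * (\<tau> ^ 3 / (64 * \<theta>)) / K"
  have \<delta>: "\<delta> > 0" using g \<tau> \<theta> K(1) by (simp add: \<delta>_def)
  \<comment> \<open>The maximum with 1/2 keeps \<rho> positive even if \<delta> is 1 or more. The
    root appears because the energy is a squared norm.\<close>
  define \<rho> where "\<rho> = sqrt (max (1/2) (1 - \<delta>))"
  have \<rho>: "0 < \<rho>" "\<rho> < 1" "1 - \<delta> \<le> \<rho>\<^sup>2"
    using \<delta> by (auto simp: \<rho>_def less_max_iff_disj)
  have "energy N w t \<le> \<rho>\<^sup>2 * form w w + t * energy_error N t * sqnorm w" if w: "fin_supp w" for w N
  proof -
    define F where "F = {a. w a \<noteq> 0} \<union> {a. D w a \<noteq> 0}"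
    define FM where "FM = {a \<in> F. snd a = Momentum}"
    have F: "finite F" using w fin_supp_D[OF w] by (auto simp: F_def)
    have FM: "finite FM" using F by (simp add: FM_def)
    define X where "X = (\<Sum>a\<in>FM. (w a)\<^sup>2)"
    define Y where "Y = (\<Sum>a\<in>FM. w a * D w a)"
    define Z where "Z = (\<Sum>a\<in>FM. (D w a)\<^sup>2)"
    define n where "n = sqnorm w"
    define \<epsilon> where "\<epsilon> = energy_error N t * n"
    have n: "n \<ge> 0" by (simp add: n_def sqnorm_nonneg)
    have \<epsilon>: "\<epsilon> \<ge> 0" using n t K(1) by (simp add: \<epsilon>_def energy_error_def)
    have XZ: "X \<ge> 0" "Z \<ge> 0" by (auto simp: X_def Z_def intro: sum_nonneg)
    let ?x = "\<lambda>s. flow (Suc N) s w"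
    \<comment> \<open>From \<open>a^2 / 2 \<le> (a + R)^2 + R^2\<close>, with
      \<open>a = w + s * D w\<close> on momenta and \<open>R\<close> the Taylor remainder.\<close>
    have mom: "momentum_sq (?x s) \<ge> (X + 2 * s * Y + s\<^sup>2 * Z) / 2 - s ^ 4 * e * n"
      if s: "0 \<le> s" "s \<le> 1" for s
    proof -
      define R where "R = remainder N s w"
      define G where "G = F \<union> {a. R a \<noteq> 0} \<union> {a. ?x s a \<noteq> 0}"
      define GM where "GM = {a \<in> G. snd a = Momentum}"
      have G: "finite G"
        unfolding G_def R_def using F fin_supp_remainder[OF w] fin_supp_flow[OF w] by (intro finite_UnI)
      then have GM: "finite GM" unfolding GM_def by simp
      have ext: "(\<Sum>a\<in>FM. f a) = (\<Sum>a\<in>GM. f a)" if "\<And>a. a \<notin> F \<Longrightarrow> f a = 0" for f :: "site \<Rightarrow> real"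
        by (rule sum.mono_neutral_left[OF GM]) (use that in \<open>auto simp: FM_def GM_def G_def\<close>)
      have out: "w a = 0" "D w a = 0" if "a \<notin> F" for a using that by (auto simp: F_def)
      have "(X + 2 * s * Y + s\<^sup>2 * Z) / 2 = (\<Sum>a\<in>GM. ((w a)\<^sup>2 + 2 * s * (w a * D w a) + s\<^sup>2 * (D w a)\<^sup>2) / 2)"
        unfolding X_def Y_def Z_def
        by (subst (1 2 3) ext) (use out in \<open>auto simp: sum.distrib sum_distrib_left sum_divide_distrib add_divide_distrib\<close>)
      also have "\<dots> = (\<Sum>a\<in>GM. (w a + s * D w a)\<^sup>2 / 2)"
        by (intro sum.cong) (auto simp: power2_eq_square algebra_simps)
      also have "\<dots> \<le> (\<Sum>a\<in>GM. (?x s a)\<^sup>2 + (R a)\<^sup>2)"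
      proof (rule sum_mono)
        fix a
        have "0 \<le> ((w a + s * D w a) + 2 * R a)\<^sup>2" by simp
        then show "(w a + s * D w a)\<^sup>2 / 2 \<le> (?x s a)\<^sup>2 + (R a)\<^sup>2"
          unfolding flow_taylor R_def[symmetric] by (simp add: power2_eq_square algebra_simps)
      qed
      also have "\<dots> = (\<Sum>a\<in>GM. (?x s a)\<^sup>2) + (\<Sum>a\<in>GM. (R a)\<^sup>2)" by (rule sum.distrib)
      also have "(\<Sum>a\<in>GM. (?x s a)\<^sup>2) = momentum_sq (?x s)"
        unfolding GM_def by (rule momentum_sq_on[OF G, symmetric]) (auto simp: G_def)
      also have "(\<Sum>a\<in>GM. (R a)\<^sup>2) \<le> (\<Sum>a\<in>G. (R a)\<^sup>2)"
        by (rule sum_mono2[OF G]) (auto simp: GM_def)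
      also have "\<dots> = sqnorm R" by (rule sqnorm_on[OF G, symmetric]) (auto simp: G_def)
      also have "\<dots> \<le> s ^ 4 * e * n" unfolding R_def e_def n_def by (rule sqnorm_remainder_le[OF w s])
      finally show ?thesis by linarith
    qed
    \<comment> \<open>A primitive of the upper bound for the derivative of the energy; monotonicity
      of \<open>energy - P\<close> takes the place of an integration.\<close>
    define P where "P = (\<lambda>s. - g * ((s * X + s\<^sup>2 * Y + s ^ 3 / 3 * Z) / 2 - s ^ 5 / 5 * e * n) + s * \<epsilon>)"
    have "energy N w \<tau> - P \<tau> \<le> energy N w 0 - P 0"
    proof (rule DERIV_nonpos_imp_nonincreasing[of 0 \<tau> "\<lambda>s. energy N w s - P s"])
      fix s assume s: "0 \<le> s" "s \<le> \<tau>"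
      have P: "(P has_real_derivative (- g * ((X + 2 * s * Y + s\<^sup>2 * Z) / 2 - s ^ 4 * e * n) + \<epsilon>)) (at s)"
        unfolding P_def by (rule derivative_eq_intros refl | simp)+
      have "((\<lambda>s. energy N w s - P s) has_real_derivative 2 * form (?x s) (D (flow N s w))
          - (- g * ((X + 2 * s * Y + s\<^sup>2 * Z) / 2 - s ^ 4 * e * n) + \<epsilon>)) (at s)"
        by (rule DERIV_diff[OF energy_deriv[OF w] P])
      moreover have "2 * form (?x s) (D (flow N s w))
          - (- g * ((X + 2 * s * Y + s\<^sup>2 * Z) / 2 - s ^ 4 * e * n) + \<epsilon>) \<le> 0"
      proof -
        have "2 * form (?x s) (D (flow N s w)) \<le> - g * momentum_sq (?x s) + \<epsilon>"
          using energy_deriv_le[OF w s(1), of t N] s \<tau> by (simp add: g_def \<epsilon>_def n_def)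
        moreover have "- g * momentum_sq (?x s) \<le> - g * ((X + 2 * s * Y + s\<^sup>2 * Z) / 2 - s ^ 4 * e * n)"
          using mult_left_mono[OF mom[of s], of g] s \<tau> g by simp
        ultimately show ?thesis by simp
      qed
      ultimately show "\<exists>y. ((\<lambda>s. energy N w s - P s) has_real_derivative y) (at s) \<and> y \<le> 0" by blast
    qed (use \<tau> in auto)
    then have E1: "energy N w \<tau> \<le> form w w + P \<tau>" by (simp add: energy_def flow_0 P_def)
    \<comment> \<open>On \<open>[\<tau>, t]\<close> only the sign of the dissipation is
      used.\<close>
    have "energy N w t - t * \<epsilon> \<le> energy N w \<tau> - \<tau> * \<epsilon>"
    proof (rule DERIV_nonpos_imp_nonincreasing[of \<tau> t "\<lambda>s. energy N w s - s * \<epsilon>"])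
      fix s assume s: "\<tau> \<le> s" "s \<le> t"
      have "((\<lambda>s. energy N w s - s * \<epsilon>) has_real_derivative 2 * form (?x s) (D (flow N s w)) - \<epsilon>) (at s)"
        by (rule DERIV_diff[OF energy_deriv[OF w]]) (auto intro!: derivative_eq_intros)
      moreover have "2 * form (?x s) (D (flow N s w)) - \<epsilon> \<le> 0"
      proof -
        have "0 \<le> g * momentum_sq (?x s)"
          using g by (intro mult_nonneg_nonneg) (auto simp: momentum_sq_def intro: sum_nonneg)
        then show ?thesis using energy_deriv_le[OF w, of s t N] s \<tau> by (simp add: g_def \<epsilon>_def n_def)
      qed
      ultimately show "\<exists>y. ((\<lambda>s. energy N w s - s * \<epsilon>) has_real_derivative y) (at s) \<and> y \<le> 0" by blast
    qed (use \<tau> in auto)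
    with E1 have E2: "energy N w t \<le> form w w + P \<tau> + (t - \<tau>) * \<epsilon>" by (simp add: algebra_simps)
    have nle: "n \<le> \<theta> * (X + Z)"
    proof -
      define J where "J = fst ` {a. w a \<noteq> 0}"
      have J: "finite J" using w by (simp add: J_def)
      have sub: "{a. w a \<noteq> 0} \<subseteq> (\<lambda>i. (i, Momentum)) ` J \<union> (\<lambda>i. (i, Position)) ` J"
      proof
        fix a assume "a \<in> {a. w a \<noteq> 0}"
        then have "fst a \<in> J" by (simp add: J_def)
        then show "a \<in> (\<lambda>i. (i, Momentum)) ` J \<union> (\<lambda>i. (i, Position)) ` J"
          by (cases a; cases "snd a") auto
      qed
      have "n = (\<Sum>a\<in>(\<lambda>i. (i, Momentum)) ` J \<union> (\<lambda>i. (i, Position)) ` J. (w a)\<^sup>2)"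
        unfolding n_def using J by (intro sqnorm_on sub) auto
      also have "\<dots> = (\<Sum>i\<in>J. (w (i, Momentum))\<^sup>2) + (\<Sum>i\<in>J. (w (i, Position))\<^sup>2)"
        using J by (subst sum.union_disjoint) (auto simp: sum.reindex inj_on_def)
      also have "\<dots> = (\<Sum>i\<in>J. (w (i, Momentum))\<^sup>2 + (w (i, Position))\<^sup>2)" by (rule sum.distrib[symmetric])
      also have "\<dots> \<le> (\<Sum>i\<in>J. \<theta> * ((w (i, Momentum))\<^sup>2 + (D w (i, Momentum))\<^sup>2))"
      proof (rule sum_mono)
        fix i
        let ?x = "w (i, Momentum)" and ?y = "D w (i, Momentum)"
        have "w (i, Position) = m * (?y + lam * ?x)" using pos by simp
        then have "(w (i, Position))\<^sup>2 = m\<^sup>2 * (?y + lam * ?x)\<^sup>2" by (simp only: power_mult_distrib)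
        also have "\<dots> \<le> m\<^sup>2 * (2 * ?y\<^sup>2 + 2 * lam\<^sup>2 * ?x\<^sup>2)"
        proof (rule mult_left_mono)
          have "(y + lam * x)\<^sup>2 \<le> 2 * y\<^sup>2 + 2 * lam\<^sup>2 * x\<^sup>2" for x y
          proof -
            have "0 \<le> (y - lam * x)\<^sup>2" by simp
            then show ?thesis by (simp add: power2_eq_square algebra_simps)
          qed
          then show "(?y + lam * ?x)\<^sup>2 \<le> 2 * ?y\<^sup>2 + 2 * lam\<^sup>2 * ?x\<^sup>2" .
        qed simp
        finally have "?x\<^sup>2 + (w (i, Position))\<^sup>2 \<le> (1 + 2 * m\<^sup>2 * lam\<^sup>2) * ?x\<^sup>2 + 2 * m\<^sup>2 * ?y\<^sup>2"
          by (simp add: algebra_simps del: drift_adjoint.simps)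
        also have "\<dots> \<le> \<theta> * ?x\<^sup>2 + \<theta> * ?y\<^sup>2"
          by (intro add_mono mult_right_mono) (auto simp: \<theta>_def)
        finally show "?x\<^sup>2 + (w (i, Position))\<^sup>2 \<le> \<theta> * (?x\<^sup>2 + ?y\<^sup>2)" by (simp only: distrib_left)
      qed
      also have "\<dots> = \<theta> * (\<Sum>a\<in>(\<lambda>i. (i, Momentum)) ` J. (w a)\<^sup>2 + (D w a)\<^sup>2)"
        by (simp add: sum.reindex inj_on_def sum_distrib_left del: drift_adjoint.simps)
      also have "\<dots> \<le> \<theta> * (\<Sum>a\<in>(\<lambda>i. (i, Momentum)) ` J \<union> FM. (w a)\<^sup>2 + (D w a)\<^sup>2)"
        using \<theta> J FM by (intro mult_left_mono sum_mono2) auto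
      also have "(\<Sum>a\<in>(\<lambda>i. (i, Momentum)) ` J \<union> FM. (w a)\<^sup>2 + (D w a)\<^sup>2) = (\<Sum>a\<in>FM. (w a)\<^sup>2 + (D w a)\<^sup>2)"
        using J FM by (intro sum.mono_neutral_right) (auto simp: FM_def F_def simp del: drift_adjoint.simps)
      also have "\<dots> = X + Z" by (simp add: X_def Z_def sum.distrib)
      finally show ?thesis .
    qed
    \<comment> \<open>The integral of \<open>X + 2 * s * Y + s^2 * Z\<close> over
      \<open>[0, \<tau>]\<close>.\<close>
    let ?S = "\<tau> * X + \<tau>\<^sup>2 * Y + \<tau> ^ 3 / 3 * Z"
    have quad: "?S \<ge> \<tau> ^ 3 * (X + Z) / 16"
    proof -
      \<comment> \<open>After a sixteenth has been set aside, the coefficients of \<open>X\<close>,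
        \<open>\<tau> * Y\<close> and \<open>\<tau>^2 * Z\<close> are 15/16, 1 and 1/3 - 1/16 =
        13/48, that is 225, 240 and 65 after scaling by 240. This square has 64 in place of
        65.\<close>
      have "0 \<le> (\<Sum>a\<in>FM. (15 * w a + 8 * \<tau> * D w a)\<^sup>2)" by (rule sum_nonneg) simp
      also have "\<dots> = (\<Sum>a\<in>FM. 225 * (w a)\<^sup>2 + 240 * \<tau> * (w a * D w a) + 64 * \<tau>\<^sup>2 * (D w a)\<^sup>2)"
        by (intro sum.cong) (auto simp: power2_eq_square algebra_simps simp del: drift_adjoint.simps)
      also have "\<dots> = 225 * X + 240 * \<tau> * Y + 64 * \<tau>\<^sup>2 * Z"
        by (simp add: X_def Y_def Z_def sum.distrib sum_distrib_left)
      finally have "0 \<le> 225 * X + 240 * \<tau> * Y + 65 * (\<tau>\<^sup>2 * Z)" 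
        using mult_nonneg_nonneg[OF zero_le_power2[of \<tau>] XZ(2)] by (simp only: mult.assoc)
      then have "0 \<le> \<tau> * (225 * X + 240 * \<tau> * Y + 65 * (\<tau>\<^sup>2 * Z))" using \<tau> by (intro mult_nonneg_nonneg) auto
      then have 1: "15 * (\<tau> * X) / 16 + \<tau>\<^sup>2 * Y + 13 * (\<tau> ^ 3 * Z) / 48 \<ge> 0"
        by (simp add: power2_eq_square power3_eq_cube algebra_simps)
      have "\<tau> ^ 3 \<le> \<tau>" using \<tau> power_decreasing[of 1 3 \<tau>] by simp
      then have "\<tau> ^ 3 * X \<le> \<tau> * X" using XZ(1) by (rule mult_right_mono)
      with 1 show ?thesis by (simp add: algebra_simps)
    qed
    have "\<tau> ^ 3 / (64 * \<theta>) * n \<le> (?S) / 2 - \<tau> ^ 5 / 5 * e * n"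
    proof -
      have "\<tau> ^ 3 / (32 * \<theta>) * n \<le> \<tau> ^ 3 / (32 * \<theta>) * (\<theta> * (X + Z))"
        using \<tau> \<theta> by (intro mult_left_mono nle) auto
      also have "\<dots> = \<tau> ^ 3 * (X + Z) / 32" using \<theta> by simp
      also have "\<dots> = (\<tau> ^ 3 * (X + Z) / 16) / 2" by simp
      also have "\<dots> \<le> (?S) / 2" using quad by (rule divide_right_mono) simp
      finally have 1: "2 * (\<tau> ^ 3 / (64 * \<theta>) * n) \<le> (?S) / 2" by simp
      have small: "\<tau> ^ 3 * n * (64 * \<theta> * e * \<tau>\<^sup>2) \<le> \<tau> ^ 3 * n * 1"
        using \<tau> n by (intro mult_left_mono \<tau>2) auto
      have "\<tau> ^ 5 * e * n \<le> \<tau> ^ 3 / (64 * \<theta>) * n"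
      proof -
        have "\<tau> ^ 3 * n * (64 * \<theta> * e * \<tau>\<^sup>2) = 64 * \<theta> * (\<tau> ^ 5 * e * n)" by (simp add: numeral_eq_Suc)
        then show ?thesis using small \<theta> by (simp add: field_simps)
      qed
      moreover have "0 \<le> \<tau> ^ 5 * e * n" using \<tau> e n by simp
      moreover have "Q \<le> S / 2 - u / 5" if "2 * Q \<le> S / 2" "u \<le> Q" "0 \<le> u" for Q S u :: real
        using that by linarith
      ultimately have "\<tau> ^ 3 / (64 * \<theta>) * n \<le> (?S) / 2 - (\<tau> ^ 5 * e * n) / 5"
        using 1 by blast
      then show ?thesis by simp
    qed
    then have "g * (\<tau> ^ 3 / (64 * \<theta>) * n) \<le> g * ((?S) / 2 - \<tau> ^ 5 / 5 * e * n)"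
      using g by (intro mult_left_mono) auto
    then have "P \<tau> \<le> - (g * (\<tau> ^ 3 / (64 * \<theta>)) * n) + \<tau> * \<epsilon>" by (simp add: P_def)
    also have "g * (\<tau> ^ 3 / (64 * \<theta>)) * n = \<delta> * (K * n)" using K(1) by (simp add: \<delta>_def)
    finally have P\<tau>: "P \<tau> \<le> - (\<delta> * (K * n)) + \<tau> * \<epsilon>" .
    have "\<delta> * form w w \<le> \<delta> * (K * n)"
      unfolding n_def using \<delta> by (intro mult_left_mono form_le_sqnorm w) auto
    with P\<tau> have "P \<tau> \<le> - (\<delta> * form w w) + \<tau> * \<epsilon>" by linarith
    with E2 have "energy N w t \<le> (1 - \<delta>) * form w w + t * \<epsilon>" by (simp add: algebra_simps)
    also have "\<dots> \<le> \<rho>\<^sup>2 * form w w + t * \<epsilon>"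
      using \<rho> form_nonneg[OF w] by (intro add_right_mono mult_right_mono) auto
    finally show ?thesis by (simp add: \<epsilon>_def n_def mult.assoc)
  qed
  then show ?thesis using \<rho> by blast
qed

section \<open>The covariance across time and its contraction\<close>

definition cross_form :: "real \<Rightarrow> (site \<Rightarrow> real) \<Rightarrow> (site \<Rightarrow> real) \<Rightarrow> real" where
  "cross_form t v w = lim (\<lambda>N. form v (flow N t w))"

text \<open>The truncated forms are partial sums of a series in \<open>t ^ k / fact k\<close> whose
  coefficients grow at most geometrically, because \<open>D\<close> is bounded by \<beta> and the
  form by \<open>K\<close>.\<close>

lemma cross_form_tendsto:
  assumes "fin_supp v" "fin_supp w" "0 \<le> t"
  shows "(\<lambda>N. form v (flow N t w)) \<longlonglongrightarrow> cross_form t v w"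
proof -
  let ?f = "\<lambda>k. t ^ k / fact k * form v ((D ^^ k) w)"
  have eq: "form v (flow N t w) = (\<Sum>k\<le>N. ?f k)" for N
    unfolding flow_def using assms by (intro form_lincomb_right fin_supp_D_pow) auto
  have S: "summable (\<lambda>k. x ^ k / fact k)" for x :: real
    using exp_converges[of x] by (simp add: divide_inverse_commute sums_iff)
  have "summable ?f"
  proof (rule summable_comparison_test')
    show "summable (\<lambda>k. K * sqnorm v * (t ^ k / fact k) + K * sqnorm w * ((t * \<beta>\<^sup>2) ^ k / fact k))"
      by (intro summable_add summable_mult S)
    fix k
    have "\<bar>form v ((D ^^ k) w)\<bar> \<le> 2 * \<bar>form v ((D ^^ k) w)\<bar>" by simp
    also have "\<dots> \<le> K * (sqnorm v + sqnorm ((D ^^ k) w))"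
      using assms by (intro form_abs_le_sqnorm fin_supp_D_pow)
    also have "\<dots> \<le> K * (sqnorm v + (\<beta> ^ k)\<^sup>2 * sqnorm w)"
      using K(1) assms by (intro mult_left_mono add_left_mono sqnorm_D_pow_le) auto
    finally have "t ^ k / fact k * \<bar>form v ((D ^^ k) w)\<bar> \<le> t ^ k / fact k * (K * (sqnorm v + (\<beta> ^ k)\<^sup>2 * sqnorm w))"
      using assms(3) by (intro mult_left_mono) auto
    also have "\<dots> = K * sqnorm v * (t ^ k / fact k) + K * sqnorm w * ((t * \<beta>\<^sup>2) ^ k / fact k)"
      by (simp add: power_mult_distrib power_mult[symmetric] mult.commute algebra_simps)
    finally show "norm (?f k) \<le> K * sqnorm v * (t ^ k / fact k) + K * sqnorm w * ((t * \<beta>\<^sup>2) ^ k / fact k)"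
      using assms(3) by (simp add: abs_mult)
  qed
  then have "convergent (\<lambda>N. form v (flow N t w))"
    unfolding eq by (auto simp: convergent_def dest: summable_LIMSEQ')
  then show ?thesis unfolding cross_form_def by (simp add: convergent_LIMSEQ_iff)
qed

lemma cross_form_lincomb:
  assumes "finite I" "finite J" "\<And>i. i \<in> I \<Longrightarrow> fin_supp (v i)" "\<And>j. j \<in> J \<Longrightarrow> fin_supp (w j)" "0 \<le> t"
  shows "cross_form t (\<lambda>a. \<Sum>i\<in>I. x i * v i a) (\<lambda>a. \<Sum>j\<in>J. y j * w j a) =
    (\<Sum>i\<in>I. \<Sum>j\<in>J. x i * y j * cross_form t (v i) (w j))"
proof (rule LIMSEQ_unique)
  show "(\<lambda>N. form (\<lambda>a. \<Sum>i\<in>I. x i * v i a) (flow N t (\<lambda>a. \<Sum>j\<in>J. y j * w j a)))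
      \<longlonglongrightarrow> cross_form t (\<lambda>a. \<Sum>i\<in>I. x i * v i a) (\<lambda>a. \<Sum>j\<in>J. y j * w j a)"
    using assms by (intro cross_form_tendsto fin_supp_lincomb)
  have "form (\<lambda>a. \<Sum>i\<in>I. x i * v i a) (flow N t (\<lambda>a. \<Sum>j\<in>J. y j * w j a)) =
      (\<Sum>i\<in>I. \<Sum>j\<in>J. x i * y j * form (v i) (flow N t (w j)))" for N
  proof -
    have "form (\<lambda>a. \<Sum>i\<in>I. x i * v i a) z = (\<Sum>i\<in>I. x i * form (v i) z)" for z
      by (rule form_lincomb_left) (use assms in auto)
    moreover have "form z (\<lambda>a. \<Sum>j\<in>J. y j * flow N t (w j) a) = (\<Sum>j\<in>J. y j * form z (flow N t (w j)))" for z
      by (rule form_lincomb_right) (use assms fin_supp_flow in auto)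
    ultimately show ?thesis by (simp add: flow_lincomb sum_distrib_left mult_ac)
  qed
  then show "(\<lambda>N. form (\<lambda>a. \<Sum>i\<in>I. x i * v i a) (flow N t (\<lambda>a. \<Sum>j\<in>J. y j * w j a)))
      \<longlonglongrightarrow> (\<Sum>i\<in>I. \<Sum>j\<in>J. x i * y j * cross_form t (v i) (w j))"
    using assms by (auto intro!: tendsto_sum tendsto_mult_left cross_form_tendsto)
qed

text \<open>Cauchy-Schwarz between \<open>v\<close> and the flow of \<open>w\<close> combined with
  \<open>energy_decay\<close>; the truncation error disappears in the limit, so \<rho> depends
  neither on \<open>v\<close> nor on \<open>w\<close>.\<close>

theorem cross_form_contraction:
  assumes t: "t > 0"
  shows "\<exists>\<rho>>0. \<rho> < 1 \<and> (\<forall>v w. fin_supp v \<longrightarrow> fin_supp w \<longrightarrow>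
    2 * cross_form t v w \<le> \<rho> * (form v v + form w w))"
proof -
  obtain \<rho> where \<rho>: "\<rho> > 0" "\<rho> < 1" and
    decay: "\<And>w N. fin_supp w \<Longrightarrow> energy N w t \<le> \<rho>\<^sup>2 * form w w + t * energy_error N t * sqnorm w"
    using energy_decay[OF t] by blast
  have "2 * cross_form t v w \<le> \<rho> * (form v v + form w w)" if v: "fin_supp v" and w: "fin_supp w" for v w
  proof (rule LIMSEQ_le)
    show "(\<lambda>N. 2 * form v (flow (Suc N) t w)) \<longlonglongrightarrow> 2 * cross_form t v w"
      using t by (intro tendsto_mult_left LIMSEQ_Suc[OF cross_form_tendsto[OF v w]]) simp
    have "(\<lambda>N. \<rho> * form v v + (\<rho>\<^sup>2 * form w w + t * energy_error N t * sqnorm w) / \<rho>) \<longlonglongrightarrow>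
        \<rho> * form v v + (\<rho>\<^sup>2 * form w w + t * 0 * sqnorm w) / \<rho>"
      by (intro tendsto_intros energy_error_tendsto_0) (use \<rho> in auto)
    also have "\<rho> * form v v + (\<rho>\<^sup>2 * form w w + t * 0 * sqnorm w) / \<rho> = \<rho> * (form v v + form w w)"
      using \<rho> by (simp add: field_simps power2_eq_square)
    finally show "(\<lambda>N. \<rho> * form v v + (\<rho>\<^sup>2 * form w w + t * energy_error N t * sqnorm w) / \<rho>) \<longlonglongrightarrow> \<rho> * (form v v + form w w)" .
    show "\<exists>N0. \<forall>N\<ge>N0. 2 * form v (flow (Suc N) t w) \<le> \<rho> * form v v + (\<rho>\<^sup>2 * form w w + t * energy_error N t * sqnorm w) / \<rho>"
    proof (intro exI allI impI)
      fix N
      define x where "x = flow (Suc N) t w"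
      have x: "fin_supp x" unfolding x_def by (rule fin_supp_flow[OF w])
      \<comment> \<open>The weight \<rho> on \<open>v\<close> balances the decay factor
        \<open>\<rho>^2\<close> of the energy of \<open>x\<close>; dividing by \<rho> then leaves
        the same factor in front of both energies.\<close>
      have "2 * \<bar>form (\<lambda>a. \<rho> * v a) x\<bar> \<le> form (\<lambda>a. \<rho> * v a) (\<lambda>a. \<rho> * v a) + form x x"
        by (rule form_abs_le[OF fin_supp_scale[OF v] x])
      then have "2 * (\<rho> * form v x) \<le> \<rho>\<^sup>2 * form v v + form x x"
        unfolding form_scale_left form_scale_right by (simp add: power2_eq_square)
      also have "form x x \<le> \<rho>\<^sup>2 * form w w + t * energy_error N t * sqnorm w"
        using decay[OF w] by (simp add: energy_def x_def)
      finally have fin: "2 * (\<rho> * form v x) \<le> \<rho>\<^sup>2 * form v v + (\<rho>\<^sup>2 * form w w + t * energy_error N t * sqnorm w)"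
        by simp
      have "\<rho> * (2 * form v x) \<le> \<rho> * (\<rho> * form v v + (\<rho>\<^sup>2 * form w w + t * energy_error N t * sqnorm w) / \<rho>)"
      proof -
        have "\<rho> * (\<rho> * A + Q / \<rho>) = \<rho>\<^sup>2 * A + Q" for A Q
          using \<rho> by (simp add: field_simps power2_eq_square)
        then show ?thesis using fin by simp
      qed
      then show "2 * form v (flow (Suc N) t w) \<le> \<rho> * form v v + (\<rho>\<^sup>2 * form w w + t * energy_error N t * sqnorm w) / \<rho>"
        using \<rho> by (simp add: x_def)
    qed
  qed
  then show ?thesis using \<rho> by blast
qed

end

section \<open>Density of trigonometric polynomials\<close>

text \<open>The free phase \<theta> includes the sines, so this real class is closed under products
  by the product-to-sum formulas and can stand in for complex exponentials.\<close>

inductive trig_poly :: "(('i \<Rightarrow> real) \<Rightarrow> real) \<Rightarrow> bool" where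
  zero: "trig_poly (\<lambda>_. 0)"
| cos: "fin_supp v \<Longrightarrow> trig_poly f \<Longrightarrow> trig_poly (\<lambda>x. \<alpha> * cos (pairing v x + \<theta>) + f x)"

lemma trig_poly_cos: "fin_supp v \<Longrightarrow> trig_poly (\<lambda>x. \<alpha> * cos (pairing v x + \<theta>))"
  using trig_poly.cos[OF _ trig_poly.zero, of v \<alpha> \<theta>] by simp

lemma trig_poly_const: "trig_poly (\<lambda>_. r)"
  using trig_poly_cos[of "\<lambda>_. 0" r 0] by (simp add: pairing_def)

lemma trig_poly_sin: "trig_poly (\<lambda>x. sin (b * x a))"
proof -
  have "pairing (\<lambda>c. if c = a then b else 0) x = b * x a" for x
    by (subst pairing_on[of "{a}"]) auto
  then show ?thesis
    using trig_poly_cos[of "\<lambda>c. if c = a then b else 0" 1 "- pi / 2"]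
    by (simp add: cos_diff cos_add)
qed

lemma trig_poly_add: "trig_poly f \<Longrightarrow> trig_poly g \<Longrightarrow> trig_poly (\<lambda>x. f x + g x)"
  by (induction f rule: trig_poly.induct) (auto simp: add.assoc intro: trig_poly.cos)

lemma trig_poly_mult:
  assumes "trig_poly f" "trig_poly g"
  shows "trig_poly (\<lambda>x. f x * g x)"
  using assms(1)
proof (induction f rule: trig_poly.induct)
  case zero
  then show ?case by (simp add: trig_poly.zero)
next
  case (cos v f \<alpha> \<theta>)
  have "trig_poly (\<lambda>x. \<alpha> * cos (pairing v x + \<theta>) * g x)"
    using assms(2)
  proof (induction g rule: trig_poly.induct)
    case zero
    then show ?case by (simp add: trig_poly.zero)
  next
    case (cos w g \<beta> \<phi>)
    have "(\<lambda>x. \<alpha> * cos (pairing v x + \<theta>) * (\<beta> * cos (pairing w x + \<phi>) + g x)) =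
      (\<lambda>x. \<alpha> * \<beta> / 2 * cos (pairing (\<lambda>a. v a - w a) x + (\<theta> - \<phi>)) +
        (\<alpha> * \<beta> / 2 * cos (pairing (\<lambda>a. v a + w a) x + (\<theta> + \<phi>)) + \<alpha> * cos (pairing v x + \<theta>) * g x))"
    proof
      fix x
      have *: "cos (pairing v x + \<theta>) * cos (pairing w x + \<phi>) =
          (cos (pairing (\<lambda>a. v a - w a) x + (\<theta> - \<phi>)) + cos (pairing (\<lambda>a. v a + w a) x + (\<theta> + \<phi>))) / 2"
        unfolding pairing_add_left[OF \<open>fin_supp v\<close> \<open>fin_supp w\<close>] pairing_diff_left[OF \<open>fin_supp v\<close> \<open>fin_supp w\<close>]
          cos_times_cos by (simp add: algebra_simps)
      have "\<alpha> * cos (pairing v x + \<theta>) * (\<beta> * cos (pairing w x + \<phi>) + g x) =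
            \<alpha> * \<beta> * (cos (pairing v x + \<theta>) * cos (pairing w x + \<phi>)) + \<alpha> * cos (pairing v x + \<theta>) * g x"
          by (simp add: algebra_simps)
      then show "\<alpha> * cos (pairing v x + \<theta>) * (\<beta> * cos (pairing w x + \<phi>) + g x) =
          \<alpha> * \<beta> / 2 * cos (pairing (\<lambda>a. v a - w a) x + (\<theta> - \<phi>)) +
        (\<alpha> * \<beta> / 2 * cos (pairing (\<lambda>a. v a + w a) x + (\<theta> + \<phi>)) + \<alpha> * cos (pairing v x + \<theta>) * g x)"
        unfolding * by (simp add: field_simps)
    qed
    then show ?case
      using cos \<open>fin_supp v\<close> by (simp only:) (intro trig_poly.cos fin_supp_add fin_supp_diff)
  qed
  from trig_poly_add[OF this cos.IH] show ?case by (simp add: distrib_right)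
qed

lemma trig_poly_polynomial:
  assumes "real_polynomial_function p" "trig_poly h"
  shows "trig_poly (\<lambda>x. p (h x))"
  using assms(1)
proof (induction p rule: real_polynomial_function.induct)
  case (linear f)
  have "f y = f 1 * y" for y
    using linear_scale[OF bounded_linear.linear[OF linear], of y 1] by simp
  then have "(\<lambda>x. f (h x)) = (\<lambda>x. f 1 * h x)" by blast
  then show ?case using trig_poly_mult[OF trig_poly_const assms(2)] by simp
qed (auto intro: trig_poly_const trig_poly_add trig_poly_mult)

lemma trig_poly_bounded: "trig_poly f \<Longrightarrow> \<exists>B. \<forall>x. \<bar>f x\<bar> \<le> B"
proof (induction f rule: trig_poly.induct)
  case (cos v f \<alpha> \<theta>)
  then obtain B where B: "\<And>x. \<bar>f x\<bar> \<le> B" by blast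
  have "\<bar>\<alpha> * cos (pairing v x + \<theta>) + f x\<bar> \<le> \<bar>\<alpha>\<bar> * 1 + B" for x
    by (rule abs_triangle_ineq[THEN order_trans], intro add_mono B)
      (unfold abs_mult, intro mult_left_mono, auto)
  then show ?case by blast
qed auto

abbreviation seq_space :: "('i \<Rightarrow> real) measure" where
  "seq_space \<equiv> \<Pi>\<^sub>M a\<in>UNIV. borel"

lemma measurable_pairing: "pairing v \<in> borel_measurable seq_space"
  unfolding pairing_def by (intro borel_measurable_sum borel_measurable_times) auto

lemma measurable_trig_poly: "trig_poly f \<Longrightarrow> f \<in> borel_measurable seq_space"
proof (induction f rule: trig_poly.induct)
  case (cos v f \<alpha> \<theta>)
  note [measurable] = measurable_pairing cos.IH
  show ?case by measurable
qed simp

lemma trig_poly_expand: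
  "trig_poly f \<Longrightarrow> \<exists>(n::nat) \<alpha> v \<theta>. (\<forall>k. fin_supp (v k)) \<and> f = (\<lambda>x. \<Sum>k<n. \<alpha> k * cos (pairing (v k) x + \<theta> k))"
proof (induction f rule: trig_poly.induct)
  case zero
  show ?case by (intro exI[of _ 0] exI[of _ "\<lambda>_ _. 0"] exI) auto
next
  case (cos v f \<alpha> \<theta>)
  then obtain n :: nat and \<alpha>' v' \<theta>' where *: "\<forall>k. fin_supp (v' k)"
    "f = (\<lambda>x. \<Sum>k<n. \<alpha>' k * cos (pairing (v' k) x + \<theta>' k))" by blast
  show ?case
  proof (intro exI conjI)
    show "\<forall>k. fin_supp ((v'(n := v)) k)" using * cos by auto
    show "(\<lambda>x. \<alpha> * cos (pairing v x + \<theta>) + f x) = (\<lambda>x. \<Sum>k<Suc n. (\<alpha>'(n := \<alpha>)) k * cos (pairing ((v'(n := v)) k) x + (\<theta>'(n := \<theta>)) k))"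
      unfolding * by (auto simp: add.commute intro!: sum.cong)
  qed
qed

text \<open>\<open>arcsin \<circ> sin\<close> is the triangle wave: it turns a function of one coordinate into a periodic
  one without changing it near the origin, and polynomials in the sine approximate the latter.\<close>

lemma trig_poly_pointwise_limit:
  fixes \<phi> :: "real \<Rightarrow> real" and a :: 'i
  assumes \<phi>: "continuous_on UNIV \<phi>" "\<And>y. \<bar>\<phi> y\<bar> \<le> 1"
  shows "\<exists>h. (\<forall>n. trig_poly (h n)) \<and> (\<forall>n x. \<bar>h n x\<bar> \<le> 2) \<and> (\<forall>x :: 'i \<Rightarrow> real. (\<lambda>n. h n x) \<longlonglongrightarrow> \<phi> (x a))"
proof -
  have "\<exists>h. trig_poly h \<and> (\<forall>x. \<bar>h x\<bar> \<le> 2) \<and> (\<forall>x. \<bar>x a\<bar> \<le> real (Suc n) \<longrightarrow> \<bar>\<phi> (x a) - h x\<bar> < 1 / real (Suc n))" for n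
  proof -
    \<comment> \<open>Scaled so that \<open>|x a| \<le> Suc n\<close> means
      \<open>|x a / L| \<le> pi / 2\<close>, the range on which \<open>arcsin\<close> inverts
      \<open>sin\<close>.\<close>
    define L where "L = 2 * real (Suc n) / pi"
    have L: "L > 0" by (simp add: L_def)
    define \<psi> where "\<psi> = (\<lambda>y. \<phi> (L * arcsin y))"
    have "continuous_on {-1..1} \<psi>"
      unfolding \<psi>_def
      by (rule continuous_on_compose2[OF \<phi>(1)]) (auto intro!: continuous_intros)
    then obtain p where p: "real_polynomial_function p" "\<And>y. y \<in> {-1..1} \<Longrightarrow> \<bar>\<psi> y - p y\<bar> < 1 / real (Suc n)"
      using Stone_Weierstrass_real_polynomial_function[of "{-1..1}" \<psi> "1 / real (Suc n)"] by auto
    define h where "h = (\<lambda>x :: 'i \<Rightarrow> real. p (sin ((1 / L) * x a)))"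
    have near: "\<bar>\<phi> (L * arcsin (sin ((1 / L) * x a))) - h x\<bar> < 1 / real (Suc n)" for x
      using p(2)[of "sin ((1 / L) * x a)"] by (simp add: h_def \<psi>_def)
    have "trig_poly h" unfolding h_def by (rule trig_poly_polynomial[OF p(1) trig_poly_sin])
    moreover have "\<bar>h x\<bar> \<le> 2" for x
    proof -
      have "1 / real (Suc n) \<le> 1" by simp
      then show ?thesis using near[of x] \<phi>(2)[of "L * arcsin (sin ((1 / L) * x a))"] by linarith
    qed
    moreover have "\<bar>\<phi> (x a) - h x\<bar> < 1 / real (Suc n)" if "\<bar>x a\<bar> \<le> real (Suc n)" for x
    proof -
      have "\<bar>(1 / L) * x a\<bar> = \<bar>x a\<bar> / L" using L by (simp add: abs_mult)
      also have "\<dots> \<le> real (Suc n) / L" using L that by (intro divide_right_mono) auto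
      also have "\<dots> = pi / 2" by (simp add: L_def del: of_nat_Suc)
      finally have "\<bar>(1 / L) * x a\<bar> \<le> pi / 2" .
      then have "arcsin (sin ((1 / L) * x a)) = (1 / L) * x a" by (intro arcsin_sin) linarith+
      then have "L * arcsin (sin ((1 / L) * x a)) = x a" using L by simp
      then show ?thesis using near[of x] by simp
    qed
    ultimately show ?thesis by blast
  qed
  then obtain h where h: "\<And>n. trig_poly (h n)" "\<And>n x. \<bar>h n x\<bar> \<le> 2"
    "\<And>n x. \<bar>x a\<bar> \<le> real (Suc n) \<Longrightarrow> \<bar>\<phi> (x a) - h n x\<bar> < 1 / real (Suc n)" by metis
  have "(\<lambda>n. h n x) \<longlonglongrightarrow> \<phi> (x a)" for x
  proof (rule LIM_zero_cancel, rule Lim_null_comparison)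
    show "(\<lambda>n. inverse (real (Suc n))) \<longlonglongrightarrow> 0" by (rule LIMSEQ_inverse_real_of_nat)
    obtain k where "\<bar>x a\<bar> \<le> real k" using real_arch_simple by blast
    then show "\<forall>\<^sub>F n in sequentially. norm (h n x - \<phi> (x a)) \<le> inverse (real (Suc n))"
      using h(3)[of x] by (intro eventually_sequentiallyI[of k]) (force simp: abs_minus_commute inverse_eq_divide intro: less_imp_le)
  qed
  then show ?thesis using h by blast
qed

text \<open>Integrability is demanded separately because the integral of a non-integrable function
  is 0 by convention.\<close>

definition trig_approx :: "('i \<Rightarrow> real) measure \<Rightarrow> (('i \<Rightarrow> real) \<Rightarrow> real) \<Rightarrow> bool" where
  "trig_approx N f \<longleftrightarrow> (\<forall>\<epsilon>>0. \<exists>h. trig_poly h \<and>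
     integrable N (\<lambda>x. (f x - h x)\<^sup>2) \<and> (\<integral>x. (f x - h x)\<^sup>2 \<partial>N) < \<epsilon>)"

lemma square_add_le: "(x + y)\<^sup>2 \<le> 2 * x\<^sup>2 + 2 * (y :: real)\<^sup>2"
  using sum_squares_ge_zero[of "x - y" 0] by (simp add: power2_eq_square algebra_simps)

section \<open>Density in L2 of a probability law on the sequence space\<close>

locale seq_prob_space = prob_space N for N :: "('i \<Rightarrow> real) measure" +
  assumes sets_N: "sets N = sets seq_space"
begin

lemma measurable_N: "borel_measurable N = borel_measurable seq_space"
  using sets_N by (rule measurable_cong_sets) simp

lemma space_N: "space N = UNIV"
  using sets_eq_imp_space_eq[OF sets_N] by (simp add: space_PiM)

lemma integrable_sq_le:
  fixes f g :: "('i \<Rightarrow> real) \<Rightarrow> real"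
  assumes "f \<in> borel_measurable N" "integrable N g" "\<And>x. (f x)\<^sup>2 \<le> g x"
  shows "integrable N (\<lambda>x. (f x)\<^sup>2)" "(\<integral>x. (f x)\<^sup>2 \<partial>N) \<le> (\<integral>x. g x \<partial>N)"
proof -
  show i: "integrable N (\<lambda>x. (f x)\<^sup>2)"
    by (rule Bochner_Integration.integrable_bound[OF assms(2)])
      (use assms in \<open>auto intro!: AE_I2 order_trans[OF assms(3)]\<close>)
  show "(\<integral>x. (f x)\<^sup>2 \<partial>N) \<le> (\<integral>x. g x \<partial>N)"
    by (rule integral_mono[OF i assms(2,3)])
qed

lemma trig_approxI:
  assumes f: "f \<in> borel_measurable N"
    and "\<And>\<epsilon>. \<epsilon> > 0 \<Longrightarrow> \<exists>h g. trig_poly h \<and> integrable N g \<and> (\<forall>x. (f x - h x)\<^sup>2 \<le> g x) \<and> (\<integral>x. g x \<partial>N) < \<epsilon>"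
  shows "trig_approx N f"
  unfolding trig_approx_def
proof (intro allI impI)
  fix \<epsilon> :: real assume "\<epsilon> > 0"
  then obtain h g where h: "trig_poly h" "integrable N g" "\<And>x. (f x - h x)\<^sup>2 \<le> g x" "(\<integral>x. g x \<partial>N) < \<epsilon>"
    using assms(2) by blast
  have "(\<lambda>x. f x - h x) \<in> borel_measurable N"
    using f measurable_trig_poly[OF h(1)] by (auto simp: measurable_N)
  from integrable_sq_le[OF this h(2,3)] h show "\<exists>h. trig_poly h \<and>
     integrable N (\<lambda>x. (f x - h x)\<^sup>2) \<and> (\<integral>x. (f x - h x)\<^sup>2 \<partial>N) < \<epsilon>" by (intro exI[of _ h]) auto
qed

lemma trig_approx_trig_poly: "trig_poly h \<Longrightarrow> trig_approx N h"
  unfolding trig_approx_def by (intro allI impI exI[of _ h]) auto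

lemma trig_approx_limit:
  assumes f: "f \<in> borel_measurable N" and F: "\<And>n. F n \<in> borel_measurable N" "\<And>n. trig_approx N (F n)"
    and G: "integrable N G" "\<And>n x. (F n x - f x)\<^sup>2 \<le> G x" and lim: "\<And>x. (\<lambda>n. F n x) \<longlonglongrightarrow> f x"
  shows "trig_approx N f"
proof (rule trig_approxI[OF f])
  fix \<epsilon> :: real assume \<epsilon>: "\<epsilon> > 0"
  have "(\<lambda>n. \<integral>x. (F n x - f x)\<^sup>2 \<partial>N) \<longlonglongrightarrow> (\<integral>x. 0 \<partial>N)"
  proof (rule integral_dominated_convergence[OF _ _ G(1)])
    show "AE x in N. (\<lambda>n. (F n x - f x)\<^sup>2) \<longlonglongrightarrow> 0"
    proof (rule AE_I2)
      fix x
      have "(\<lambda>n. (F n x - f x)\<^sup>2) \<longlonglongrightarrow> (f x - f x)\<^sup>2" by (intro tendsto_intros lim)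
      then show "(\<lambda>n. (F n x - f x)\<^sup>2) \<longlonglongrightarrow> 0" by simp
    qed
  qed (use f F G in auto)
  then have "\<forall>\<^sub>F n in sequentially. (\<integral>x. (F n x - f x)\<^sup>2 \<partial>N) < \<epsilon> / 4"
    using \<epsilon> by (intro order_tendstoD) auto
  then obtain n where n: "(\<integral>x. (F n x - f x)\<^sup>2 \<partial>N) < \<epsilon> / 4" by (auto simp: eventually_sequentially)
  have i: "integrable N (\<lambda>x. (F n x - f x)\<^sup>2)"
    by (rule integrable_sq_le[OF _ G(1) G(2)]) (use f F in auto)
  obtain h where h: "trig_poly h" "integrable N (\<lambda>x. (F n x - h x)\<^sup>2)" "(\<integral>x. (F n x - h x)\<^sup>2 \<partial>N) < \<epsilon> / 4"
    using F(2)[of n, unfolded trig_approx_def, rule_format, of "\<epsilon> / 4"] \<epsilon> by auto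
  show "\<exists>h g. trig_poly h \<and> integrable N g \<and> (\<forall>x. (f x - h x)\<^sup>2 \<le> g x) \<and> (\<integral>x. g x \<partial>N) < \<epsilon>"
  proof (intro exI conjI allI)
    show "integrable N (\<lambda>x. 2 * (F n x - f x)\<^sup>2 + 2 * (F n x - h x)\<^sup>2)" using i h by auto
    show "(\<integral>x. 2 * (F n x - f x)\<^sup>2 + 2 * (F n x - h x)\<^sup>2 \<partial>N) < \<epsilon>" using i h n by simp
    fix x show "(f x - h x)\<^sup>2 \<le> 2 * (F n x - f x)\<^sup>2 + 2 * (F n x - h x)\<^sup>2"
      using square_add_le[of "f x - F n x" "F n x - h x"] by (simp add: power2_commute[of "f x"])
  qed (rule h)
qed

lemma trig_approx_bounded_limit:
  assumes f: "f \<in> borel_measurable N" and F: "\<And>n. F n \<in> borel_measurable N" "\<And>n. trig_approx N (F n)"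
    and b: "\<And>n x. \<bar>F n x\<bar> \<le> b" and lim: "\<And>x. (\<lambda>n. F n x) \<longlonglongrightarrow> f x"
  shows "trig_approx N f"
proof (rule trig_approx_limit[OF f F _ _ lim])
  show "integrable N (\<lambda>x. (2 * b)\<^sup>2)" by simp
  fix n x
  have "\<bar>f x\<bar> \<le> b"
    using tendsto_rabs[OF lim[of x]] b by (intro LIMSEQ_le_const2) auto
  then have "\<bar>F n x - f x\<bar> \<le> 2 * b" using b[of n x] by linarith
  then show "(F n x - f x)\<^sup>2 \<le> (2 * b)\<^sup>2" by (metis abs_ge_zero power2_abs power_mono)
qed

lemma trig_approx_add:
  assumes "f \<in> borel_measurable N" "g \<in> borel_measurable N" "trig_approx N f" "trig_approx N g"
  shows "trig_approx N (\<lambda>x. f x + g x)"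
proof (rule trig_approxI)
  fix \<epsilon> :: real assume "\<epsilon> > 0"
  then have e: "\<epsilon> / 4 > 0" by simp
  obtain h where h: "trig_poly h" "integrable N (\<lambda>x. (f x - h x)\<^sup>2)" "(\<integral>x. (f x - h x)\<^sup>2 \<partial>N) < \<epsilon> / 4"
    using assms(3) e unfolding trig_approx_def by blast
  obtain k where k: "trig_poly k" "integrable N (\<lambda>x. (g x - k x)\<^sup>2)" "(\<integral>x. (g x - k x)\<^sup>2 \<partial>N) < \<epsilon> / 4"
    using assms(4) e unfolding trig_approx_def by blast
  show "\<exists>l G. trig_poly l \<and> integrable N G \<and> (\<forall>x. (f x + g x - l x)\<^sup>2 \<le> G x) \<and> (\<integral>x. G x \<partial>N) < \<epsilon>"
  proof (intro exI conjI allI)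
    show "trig_poly (\<lambda>x. h x + k x)" by (rule trig_poly_add[OF h(1) k(1)])
    show "integrable N (\<lambda>x. 2 * (f x - h x)\<^sup>2 + 2 * (g x - k x)\<^sup>2)" using h k by auto
    show "(\<integral>x. 2 * (f x - h x)\<^sup>2 + 2 * (g x - k x)\<^sup>2 \<partial>N) < \<epsilon>" using h k by simp
    fix x show "(f x + g x - (h x + k x))\<^sup>2 \<le> 2 * (f x - h x)\<^sup>2 + 2 * (g x - k x)\<^sup>2"
      using square_add_le[of "f x - h x" "g x - k x"] by (simp add: algebra_simps)
  qed
qed (use assms in auto)

lemma trig_approx_mult:
  assumes "f \<in> borel_measurable N" "g \<in> borel_measurable N" "trig_approx N f" "trig_approx N g"
    and B: "\<And>x. \<bar>f x\<bar> \<le> B"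
  shows "trig_approx N (\<lambda>x. f x * g x)"
proof (rule trig_approxI)
  fix \<epsilon> :: real assume \<epsilon>: "\<epsilon> > 0"
  have pos: "0 < 4 * (b\<^sup>2 + 1)" for b :: real by (simp add: add_nonneg_pos)
  have small: "2 * b\<^sup>2 * I < \<epsilon> / 2" if "I < \<epsilon> / (4 * (b\<^sup>2 + 1))" "0 \<le> I" for b I
  proof -
    have "2 * b\<^sup>2 * I \<le> (b\<^sup>2 + 1) * 2 * I" using that by (intro mult_right_mono) auto
    also have "\<dots> < \<epsilon> / 2" using that(1) pos[of b] by (simp add: field_simps)
    finally show ?thesis .
  qed
  \<comment> \<open>The order of choice matters: \<open>k\<close> approximates \<open>g\<close>
    relative to the bound \<open>B\<close> of \<open>f\<close>, and only then is \<open>h\<close>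
    chosen relative to the bound \<open>B'\<close> of \<open>k\<close>. Adding 1 to the squared
    bounds avoids a division by 0.\<close>
  obtain k where k: "trig_poly k" "integrable N (\<lambda>x. (g x - k x)\<^sup>2)" "(\<integral>x. (g x - k x)\<^sup>2 \<partial>N) < \<epsilon> / (4 * (B\<^sup>2 + 1))"
    using assms(4) divide_pos_pos[OF \<epsilon> pos[of B]] unfolding trig_approx_def by blast
  obtain B' where B': "\<And>x. \<bar>k x\<bar> \<le> B'" using trig_poly_bounded[OF k(1)] by blast
  obtain h where h: "trig_poly h" "integrable N (\<lambda>x. (f x - h x)\<^sup>2)" "(\<integral>x. (f x - h x)\<^sup>2 \<partial>N) < \<epsilon> / (4 * (B'\<^sup>2 + 1))"
    using assms(3) divide_pos_pos[OF \<epsilon> pos[of B']] unfolding trig_approx_def by blast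
  show "\<exists>l G. trig_poly l \<and> integrable N G \<and> (\<forall>x. (f x * g x - l x)\<^sup>2 \<le> G x) \<and> (\<integral>x. G x \<partial>N) < \<epsilon>"
  proof (intro exI conjI allI)
    show "trig_poly (\<lambda>x. h x * k x)" by (rule trig_poly_mult[OF h(1) k(1)])
    show "integrable N (\<lambda>x. 2 * B\<^sup>2 * (g x - k x)\<^sup>2 + 2 * B'\<^sup>2 * (f x - h x)\<^sup>2)" using h k by auto
    have "(\<integral>x. 2 * B\<^sup>2 * (g x - k x)\<^sup>2 + 2 * B'\<^sup>2 * (f x - h x)\<^sup>2 \<partial>N) =
        2 * B\<^sup>2 * (\<integral>x. (g x - k x)\<^sup>2 \<partial>N) + 2 * B'\<^sup>2 * (\<integral>x. (f x - h x)\<^sup>2 \<partial>N)" using h k by simp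
    also have "\<dots> < \<epsilon> / 2 + \<epsilon> / 2" by (intro add_strict_mono small h k) auto
    finally show "(\<integral>x. 2 * B\<^sup>2 * (g x - k x)\<^sup>2 + 2 * B'\<^sup>2 * (f x - h x)\<^sup>2 \<partial>N) < \<epsilon>" by simp
    fix x
    have "(f x * g x - h x * k x)\<^sup>2 \<le> 2 * (f x * (g x - k x))\<^sup>2 + 2 * (k x * (f x - h x))\<^sup>2"
      using square_add_le[of "f x * (g x - k x)" "k x * (f x - h x)"] by (simp add: algebra_simps)
    also have "\<dots> = 2 * (f x)\<^sup>2 * (g x - k x)\<^sup>2 + 2 * (k x)\<^sup>2 * (f x - h x)\<^sup>2" by (simp add: power_mult_distrib)
    also have "\<dots> \<le> 2 * B\<^sup>2 * (g x - k x)\<^sup>2 + 2 * B'\<^sup>2 * (f x - h x)\<^sup>2"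
    proof -
      have "(f x)\<^sup>2 \<le> B\<^sup>2" "(k x)\<^sup>2 \<le> B'\<^sup>2"
        using power_mono[OF B[of x], of 2] power_mono[OF B'[of x], of 2] by auto
      then show ?thesis by (intro add_mono mult_right_mono) auto
    qed
    finally show "(f x * g x - h x * k x)\<^sup>2 \<le> 2 * B\<^sup>2 * (g x - k x)\<^sup>2 + 2 * B'\<^sup>2 * (f x - h x)\<^sup>2" .
  qed
qed (use assms in auto)

lemma trig_approx_scale:
  assumes "f \<in> borel_measurable N" "trig_approx N f"
  shows "trig_approx N (\<lambda>x. r * f x)"
  using trig_approx_mult[of "\<lambda>_. r" f "\<bar>r\<bar>"] assms trig_approx_trig_poly[OF trig_poly_const] by auto

text \<open>These sets turn out to form a sigma-algebra: complements and finite unions come from the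
  algebra of bounded approximable functions, countable unions from dominated convergence. As it
  contains the coordinate half-spaces, it contains every measurable set.\<close>

definition approx_set :: "('i \<Rightarrow> real) set \<Rightarrow> bool" where
  "approx_set A \<longleftrightarrow> A \<in> sets N \<and> trig_approx N (indicator A)"

lemma approx_set_Compl:
  assumes "approx_set A"
  shows "approx_set (UNIV - A)"
proof -
  have A: "A \<in> sets N" "trig_approx N (indicator A)" using assms by (auto simp: approx_set_def)
  have "trig_approx N (\<lambda>x. 1 + (-1) * indicator A x)"
    by (intro trig_approx_add trig_approx_scale trig_approx_trig_poly trig_poly_const A) (use A in auto)
  also have "(\<lambda>x. 1 + (-1) * indicator A x :: real) = indicator (UNIV - A)"
    by (rule ext) (simp split: split_indicator)
  finally show ?thesis using A sets.compl_sets[OF A(1)] by (simp add: approx_set_def space_N)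
qed

lemma approx_set_empty: "approx_set {}"
  using trig_approx_trig_poly[OF trig_poly.zero] by (simp add: approx_set_def indicator_def[abs_def])

lemma approx_set_Un:
  assumes "approx_set A" "approx_set B"
  shows "approx_set (A \<union> B)"
proof -
  have AB: "A \<in> sets N" "trig_approx N (indicator A)" "B \<in> sets N" "trig_approx N (indicator B)"
    using assms by (auto simp: approx_set_def)
  have "trig_approx N (\<lambda>x. indicator A x + (indicator B x + (-1) * (indicator A x * indicator B x)))"
    by (intro trig_approx_add trig_approx_scale trig_approx_mult[of _ _ 1] AB) (use AB in auto)
  also have "(\<lambda>x. indicator A x + (indicator B x + (-1) * (indicator A x * indicator B x)) :: real) = indicator (A \<union> B)"
    by (rule ext) (simp split: split_indicator)
  finally show ?thesis using AB by (simp add: approx_set_def)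
qed

lemma approx_set_UN:
  assumes "\<And>n :: nat. approx_set (A n)"
  shows "approx_set (\<Union>n. A n)"
proof -
  have fin: "approx_set (\<Union>i<n. A i)" for n
    by (induction n) (auto simp: lessThan_Suc approx_set_empty intro: approx_set_Un assms)
  have "A n \<in> sets N" for n using assms by (auto simp: approx_set_def)
  then have S: "(\<Union>n. A n) \<in> sets N" by auto
  moreover have "trig_approx N (indicator (\<Union>n. A n))"
  proof (rule trig_approx_bounded_limit[where F = "\<lambda>n. indicator (\<Union>i<n. A i)" and b = 1])
    show "(\<lambda>n. indicator (\<Union>i<n. A i) x :: real) \<longlonglongrightarrow> indicator (\<Union>n. A n) x" for x
      by (rule LIMSEQ_indicator_UN)
    show "\<bar>indicator (\<Union>i<n. A i) x :: real\<bar> \<le> 1" for n x by (simp split: split_indicator)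
  qed (use fin S in \<open>auto simp: approx_set_def intro!: borel_measurable_indicator simp del: borel_measurable_indicator_iff\<close>)
  ultimately show ?thesis by (simp add: approx_set_def)
qed

text \<open>The indicator is a pointwise limit of continuous ramps of slope \<open>n\<close>, and
  each ramp is a bounded limit of trigonometric polynomials in one coordinate.\<close>

lemma approx_set_halfspace: "approx_set {x. t < x a}"
proof -
  define \<phi> where "\<phi> = (\<lambda>n y. min 1 (max 0 (real n * (y - t))))"
  have m: "(\<lambda>x. x a) \<in> borel_measurable N" by (simp add: measurable_N)
  then have S: "{x. t < x a} \<in> sets N"
    using borel_measurable_less[of "\<lambda>_. t" N "\<lambda>x. x a"] by (simp add: space_N)
  have A: "trig_approx N (\<lambda>x. \<phi> n (x a))" for n
  proof -
    have "continuous_on UNIV (\<phi> n)" "\<bar>\<phi> n y\<bar> \<le> 1" for y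
      unfolding \<phi>_def by (auto intro!: continuous_intros)
    then obtain h where h: "\<And>k. trig_poly (h k)" "\<And>k x. \<bar>h k x\<bar> \<le> 2" "\<And>x :: 'i \<Rightarrow> real. (\<lambda>k. h k x) \<longlonglongrightarrow> \<phi> n (x a)"
      using trig_poly_pointwise_limit[of "\<phi> n" a] by blast
    show ?thesis
      by (rule trig_approx_bounded_limit[OF _ _ _ h(2,3)])
        (use h(1) m measurable_trig_poly trig_approx_trig_poly in \<open>auto simp: \<phi>_def measurable_N\<close>)
  qed
  have L: "(\<lambda>n. \<phi> n (x a)) \<longlonglongrightarrow> indicator {x. t < x a} x" for x
  proof (cases "t < x a")
    case True
    then obtain k :: nat where k: "1 / (x a - t) < k" using reals_Archimedean2 by blast
    have "\<phi> n (x a) = 1" if "n \<ge> k" for n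
    proof -
      have "1 < real k * (x a - t)" using k True by (simp add: field_simps)
      also have "\<dots> \<le> real n * (x a - t)" using that True by (intro mult_right_mono) auto
      finally show ?thesis by (simp add: \<phi>_def)
    qed
    then have "\<forall>\<^sub>F n in sequentially. \<phi> n (x a) = 1" by (auto simp: eventually_sequentially)
    then show ?thesis using True by (simp add: tendsto_eventually)
  next
    case False
    then have "real n * (x a - t) \<le> 0" for n by (intro mult_nonneg_nonpos) auto
    then have "\<phi> n (x a) = 0" for n by (simp add: \<phi>_def max_absorb1)
    then show ?thesis using False by simp
  qed
  have M: "(\<lambda>x. \<phi> n (x a)) \<in> borel_measurable N" and b: "\<bar>\<phi> n y\<bar> \<le> 1" for n y
    using m by (auto simp: \<phi>_def)
  have "trig_approx N (indicator {x. t < x a})"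
    by (rule trig_approx_bounded_limit[OF borel_measurable_indicator[OF S] M A b L])
  then show ?thesis using S by (simp add: approx_set_def)
qed

text \<open>Two generation steps: half-lines generate the Borel sets of one coordinate, and
  one-coordinate cylinders generate the product sigma-algebra.\<close>

lemma approx_set_all:
  assumes "A \<in> sets N"
  shows "approx_set A"
proof -
  have 1: "approx_set {x. x a \<in> A}" if "A \<in> sets borel" for a :: 'i and A :: "real set"
  proof -
    have "A \<in> sigma_sets UNIV (range (\<lambda>t. {t<..}))"
      using that unfolding borel_Ioi by simp
    then show ?thesis
    proof (induction A rule: sigma_sets.induct)
      case (Basic A)
      then show ?case using approx_set_halfspace by auto
    next
      case Empty
      then show ?case using approx_set_empty by simp
    next
      case (Compl A)
      then show ?case using approx_set_Compl[OF Compl.IH] by (simp add: set_diff_eq)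
    next
      case (Union A)
      then show ?case using approx_set_UN[OF Union.IH] by (simp add: Collect_ex_eq)
    qed
  qed
  have "A \<in> sigma_sets UNIV {{f. f i \<in> B} | i B. B \<in> sets borel}"
    using assms by (simp add: sets_N sets_PiM_single)
  then show ?thesis
  proof (induction A rule: sigma_sets.induct)
    case (Union A)
    then show ?case by (intro approx_set_UN)
  qed (auto intro: 1 approx_set_empty approx_set_Compl)
qed

theorem trig_approx_square_integrable:
  assumes f: "f \<in> borel_measurable N" and f2: "integrable N (\<lambda>x. (f x)\<^sup>2)"
  shows "trig_approx N f"
proof -
  obtain F where F: "\<And>i. simple_function N (F i)" "\<And>x. (\<lambda>i. F i x) \<longlonglongrightarrow> f x"
    "\<And>i x. dist (F i x) 0 \<le> 2 * dist (f x) 0"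
    using borel_measurable_implies_sequence_metric[OF f, of 0] by (auto simp: space_N)
  have simple: "trig_approx N (F i)" for i
  proof -
    have "trig_approx N (\<lambda>x. \<Sum>y\<in>Y. y * indicator (F i -` {y}) x)" if "finite Y" for Y
      using that
    proof (induction Y rule: finite_induct)
      case empty
      then show ?case using trig_approx_trig_poly[OF trig_poly.zero] by simp
    next
      case (insert y Y)
      have S: "F i -` {y} \<in> sets N" for y
        using simple_functionD(2)[OF F(1)[of i], of "{y}"] by (simp add: space_N)
      have "trig_approx N (\<lambda>x. y * indicator (F i -` {y}) x + (\<Sum>y\<in>Y. y * indicator (F i -` {y}) x))"
        using approx_set_all[OF S] insert.IH
        by (intro trig_approx_add trig_approx_scale borel_measurable_sum borel_measurable_times
            borel_measurable_indicator S) (auto simp: approx_set_def)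
      then show ?case unfolding sum.insert[OF insert.hyps] .
    qed
    from this[OF simple_functionD(1)[OF F(1)[of i]]]
    have "trig_approx N (\<lambda>x. \<Sum>y\<in>range (F i). y * indicator (F i -` {y}) x)" by (simp add: space_N)
    also have "(\<lambda>x. \<Sum>y\<in>range (F i). y * indicator (F i -` {y}) x) = F i"
    proof
      fix x
      have "(\<Sum>y\<in>range (F i). y * indicator (F i -` {y}) x) = (\<Sum>y\<in>range (F i). if y = F i x then F i x else 0)"
        by (intro sum.cong) (auto simp: indicator_def)
      then show "(\<Sum>y\<in>range (F i). y * indicator (F i -` {y}) x) = F i x"
        using simple_functionD(1)[OF F(1)[of i]] by (simp add: space_N)
    qed
    finally show ?thesis .
  qed
  show ?thesis
  proof (rule trig_approx_limit[OF f _ simple _ _ F(2)])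
    show "F i \<in> borel_measurable N" for i by (rule borel_measurable_simple_function[OF F(1)])
    \<comment> \<open>\<open>|F n x| \<le> 2 * |f x|\<close> gives
      \<open>|F n x - f x| \<le> 3 * |f x|\<close>, whence the factor 9 in the dominating
      function.\<close>
    show "integrable N (\<lambda>x. 9 * (f x)\<^sup>2)" using f2 by simp
    fix n x
    have "\<bar>F n x - f x\<bar> \<le> 3 * \<bar>f x\<bar>" using F(3)[of n x] by simp
    then have "\<bar>F n x - f x\<bar>\<^sup>2 \<le> (3 * \<bar>f x\<bar>)\<^sup>2" by (rule power_mono) simp
    then show "(F n x - f x)\<^sup>2 \<le> 9 * (f x)\<^sup>2" by (simp add: power_mult_distrib)
  qed
qed

end

section \<open>Duhamel's formula and Gaussian variables\<close>

text \<open>On each cell the mean value theorem writes the increment of \<open>G\<close> as the step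
  times \<open>g\<close> at an interior point; uniform continuity of \<open>g\<close> moves that
  point to the left end, at a total cost of at most \<open>e / 2\<close>.\<close>

lemma riemann_sum_tendsto:
  fixes G g :: "real \<Rightarrow> real" and t :: real
  assumes t: "t > 0"
    and deriv: "\<And>s. s \<in> {0..t} \<Longrightarrow> (G has_real_derivative g s) (at s within {0..t})"
    and cont: "continuous_on {0..t} g"
  shows "(\<lambda>n. \<Sum>k<Suc n. t / real (Suc n) * g (t * real k / real (Suc n))) \<longlonglongrightarrow> G t - G 0"
proof (rule LIMSEQ_I)
  fix e :: real assume e: "e > 0"
  have uc: "uniformly_continuous_on {0..t} g"
    using cont by (intro compact_uniformly_continuous) auto
  obtain d where d: "d > 0" "\<And>x y. x \<in> {0..t} \<Longrightarrow> y \<in> {0..t} \<Longrightarrow> dist y x < d \<Longrightarrow> dist (g y) (g x) < e / (2 * t)"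
    using uc[unfolded uniformly_continuous_on_def, rule_format, of "e / (2 * t)"] e t by auto
  obtain n0 :: nat where n0: "t / d < n0" using reals_Archimedean2 by blast
  have "norm ((\<Sum>k<Suc n. t / real (Suc n) * g (t * real k / real (Suc n))) - (G t - G 0)) < e" if n: "n \<ge> n0" for n
  proof -
    define h where "h = t / real (Suc n)"
    have h: "h > 0" "real (Suc n) * h = t" using t by (auto simp: h_def field_simps)
    have hd: "h < d"
    proof -
      have "t < n0 * d" using n0 d(1) by (simp add: field_simps)
      also have "\<dots> \<le> Suc n * d" using n d(1) by (intro mult_right_mono) auto
      finally show ?thesis by (simp add: h_def field_simps)
    qed
    have piece: "\<bar>h * g (real k * h) - (G (real (Suc k) * h) - G (real k * h))\<bar> \<le> h * (e / (2 * t))" if k: "k < Suc n" for k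
    proof -
      have up: "real (Suc k) * h \<le> t" using k h by (metis less_eq_Suc_le mult_right_mono of_nat_le_iff less_imp_le)
      have lo: "0 \<le> real k * h" using h by simp
      have "\<exists>x\<in>{real k * h<..<real (Suc k) * h}. G (real (Suc k) * h) - G (real k * h) = (\<lambda>y. g x * y) (real (Suc k) * h - real k * h)"
      proof (rule mvt_simple)
        show "real k * h < real (Suc k) * h" using h by simp
        fix x assume "real k * h \<le> x" "x \<le> real (Suc k) * h"
        then show "(G has_derivative (\<lambda>y. g x * y)) (at x within {real k * h..real (Suc k) * h})"
          using deriv[of x] up lo unfolding has_field_derivative_def
          by (auto intro: has_derivative_subset)
      qed
      then obtain x where x: "real k * h < x" "x < real (Suc k) * h" "G (real (Suc k) * h) - G (real k * h) = g x * (real (Suc k) * h - real k * h)" by auto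
      have "real (Suc k) * h - real k * h = h" by (simp add: algebra_simps)
      then have "h * g (real k * h) - (G (real (Suc k) * h) - G (real k * h)) = h * (g (real k * h) - g x)"
        using x(3) by (simp add: algebra_simps)
      moreover have "\<bar>g (real k * h) - g x\<bar> < e / (2 * t)"
      proof -
        have "dist (real k * h) x < d" using x(1,2) hd by (simp add: dist_real_def algebra_simps)
        then show ?thesis using d(2)[of x "k * h"] x up lo h by (auto simp: dist_real_def)
      qed
      moreover have "\<bar>h * x\<bar> \<le> h * y" if "\<bar>x\<bar> < y" for x y
        using h that by (simp add: abs_mult)
      ultimately show ?thesis by metis
    qed
    have "(\<Sum>k<Suc n. G (real (Suc k) * h) - G (real k * h)) = G (real (Suc n) * h) - G (0 * h)"
      using sum_lessThan_telescope[of "\<lambda>k. G (real k * h)" "Suc n"] by simp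
    also have "\<dots> = G t - G 0" unfolding h(2) by simp
    finally have tel: "(\<Sum>k<Suc n. G (real (Suc k) * h) - G (real k * h)) = G t - G 0" .
    have "(\<Sum>k<Suc n. t / real (Suc n) * g (t * real k / real (Suc n))) = (\<Sum>k<Suc n. h * g (real k * h))"
      by (intro sum.cong refl) (simp add: h_def mult.commute)
    then have "\<bar>(\<Sum>k<Suc n. t / real (Suc n) * g (t * real k / real (Suc n))) - (G t - G 0)\<bar> =
        \<bar>\<Sum>k<Suc n. h * g (real k * h) - (G (real (Suc k) * h) - G (real k * h))\<bar>"
      unfolding tel[symmetric] sum_subtractf by simp
    also have "\<dots> \<le> (\<Sum>k<Suc n. \<bar>h * g (real k * h) - (G (real (Suc k) * h) - G (real k * h))\<bar>)" by (rule sum_abs)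
    also have "\<dots> \<le> (\<Sum>k<Suc n. h * (e / (2 * t)))" by (intro sum_mono piece) auto
    also have "\<dots> = (real (Suc n) * h) * (e / (2 * t))" by simp
    also have "\<dots> = e / 2" unfolding h(2) using t by simp
    also have "\<dots> < e" using e by simp
    finally show ?thesis by simp
  qed
  then show "\<exists>n0. \<forall>n\<ge>n0. norm ((\<Sum>k<Suc n. t / real (Suc n) * g (t * real k / real (Suc n))) - (G t - G 0)) < e" by blast
qed

context gibbs_chain
begin

text \<open>Riemann sums for the stochastic convolution after integration by parts: the noise enters
  through its path and not through a stochastic integral. Since nothing else random enters,
  independence from the initial state will be immediate.\<close>

definition noise_sum :: "real \<Rightarrow> nat \<Rightarrow> (site \<Rightarrow> real) \<Rightarrow> nat \<Rightarrow> (real \<Rightarrow> site \<Rightarrow> real) \<Rightarrow> real" where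
  "noise_sum t N w n Z = pairing w (Z t) +
     (\<Sum>k<Suc n. t / real (Suc n) * pairing (D (flow N (t - t * real k / real (Suc n)) w)) (Z (t * real k / real (Suc n))))"

text \<open>Riemann sums of the truncation term. It involves the state at intermediate times, so it
  is not independent of the initial state and has to be shown small instead.\<close>

definition error_sum :: "real \<Rightarrow> nat \<Rightarrow> (site \<Rightarrow> real) \<Rightarrow> nat \<Rightarrow> (real \<Rightarrow> site \<Rightarrow> real) \<Rightarrow> real" where
  "error_sum t N w n \<eta> = (\<Sum>k<Suc n. t / real (Suc n) *
     ((t - t * real k / real (Suc n)) ^ Suc N / fact (Suc N) * pairing ((D ^^ (N + 2)) w) (\<eta> (t * real k / real (Suc n)))))"

text \<open>Duhamel's formula for the truncated dual flow, with the integrals written as limits of Riemann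
  sums so that measurability in the sample point is immediate.\<close>

lemma duhamel:
  fixes \<eta> Z :: "real \<Rightarrow> site \<Rightarrow> real"
  assumes t: "t > 0" and w: "fin_supp w" and Z0: "Z 0 = (\<lambda>_. 0)"
    and cont: "\<And>a. continuous_on {0..} (\<lambda>u. \<eta> u a)" "\<And>a. continuous_on {0..} (\<lambda>u. Z u a)"
    and eq: "\<And>u a. u \<ge> 0 \<Longrightarrow> \<eta> u a = \<eta> 0 a + integral {0..u} (\<lambda>s. B (\<eta> s) a) + Z u a"
  shows "(\<lambda>n. pairing (flow (Suc N) t w) (\<eta> 0) + noise_sum t N w n Z + error_sum t N w n \<eta>)
    \<longlonglongrightarrow> pairing w (\<eta> t)"
proof -
  define F where "F = (\<Union>k\<le>N + 2. {a. (D ^^ k) w a \<noteq> 0})"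
  have F: "finite F" unfolding F_def by (intro finite_UN_I fin_supp_D_pow w) auto
  have pw: "(D ^^ k) w a = 0" if "k \<le> N + 2" "a \<notin> F" for k a using that by (auto simp: F_def)
  have S1: "{a. flow (Suc N) s w a \<noteq> 0} \<subseteq> F" for s
  proof -
    have "flow (Suc N) s w a = 0" if "a \<notin> F" for a
      unfolding flow_def by (intro sum.neutral ballI) (simp add: pw that del: funpow.simps)
    then show ?thesis by auto
  qed
  have S2: "{a. D (flow N s w) a \<noteq> 0} \<subseteq> F" for s
  proof -
    have "(D ^^ k) (D w) a = 0" if "k \<le> N" "a \<notin> F" for k a
      using pw[of "Suc k" a] that by (simp add: funpow_swap1)
    then have "D (flow N s w) a = 0" if "a \<notin> F" for a
      unfolding D_flow unfolding flow_def by (intro sum.neutral ballI) (simp add: that)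
    then show ?thesis by auto
  qed
  have S3: "{a. (D ^^ (N + 2)) w a \<noteq> 0} \<subseteq> F" by (auto simp: F_def)
  have S4: "{a. w a \<noteq> 0} \<subseteq> F" using pw[of 0] by auto
  \<comment> \<open>The state need not be differentiable in time; subtracting the noise leaves a
    function with derivative \<open>B (\<eta> s)\<close>.\<close>
  define Y where "Y = (\<lambda>u a. \<eta> u a - Z u a)"
  \<comment> \<open>Interpolates between \<open>pairing (flow (Suc N) t w) (\<eta> 0)\<close> at
    time 0 and \<open>pairing w (\<eta> t) - pairing w (Z t)\<close> at time \<open>t\<close>. In
    its derivative the drift cancels against the dual flow up to the truncation term.\<close>
  define G where "G = (\<lambda>s. \<Sum>a\<in>F. flow (Suc N) (t - s) w a * Y s a)"
  define g where "g = (\<lambda>s. pairing (D (flow N (t - s) w)) (Z s) +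
      (t - s) ^ Suc N / fact (Suc N) * pairing ((D ^^ (N + 2)) w) (\<eta> s))"
  have contB: "continuous_on {0..t} (\<lambda>s. B (\<eta> s) a)" for a
  proof -
    have "continuous_on {0..t} (\<lambda>s. \<eta> s b)" for b using cont(1) by (rule continuous_on_subset) auto
    then show ?thesis by (cases a; cases "snd a") (auto intro!: continuous_intros)
  qed
  have dY: "((\<lambda>u. Y u a) has_real_derivative B (\<eta> s) a) (at s within {0..t})" if s: "s \<in> {0..t}" for s a
  proof -
    have "((\<lambda>u. \<eta> 0 a + integral {0..u} (\<lambda>s. B (\<eta> s) a)) has_real_derivative 0 + B (\<eta> s) a) (at s within {0..t})"
      by (intro DERIV_add DERIV_const integral_has_real_derivative contB s)
    then have "((\<lambda>u. \<eta> 0 a + integral {0..u} (\<lambda>s. B (\<eta> s) a)) has_real_derivative B (\<eta> s) a) (at s within {0..t})" by simp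
    then show ?thesis
    proof (rule has_field_derivative_transform_within[OF _ zero_less_one s])
      fix u assume "u \<in> {0..t}"
      then show "\<eta> 0 a + integral {0..u} (\<lambda>s. B (\<eta> s) a) = Y u a" using eq[of u a] by (simp add: Y_def)
    qed
  qed
  have dflow: "((\<lambda>s. flow (Suc N) (t - s) w a) has_real_derivative - D (flow N (t - s) w) a) (at s within {0..t})" for s a
  proof -
    have "((\<lambda>s. flow (Suc N) (t - s) w a) has_real_derivative D (flow N (t - s) w) a * (- 1)) (at s within {0..t})"
      by (rule DERIV_chain'[OF _ flow_deriv]) (auto intro!: derivative_eq_intros)
    then show ?thesis by simp
  qed
  have dG: "(G has_real_derivative g s) (at s within {0..t})" if s: "s \<in> {0..t}" for s
  proof -
    have "(G has_real_derivative (\<Sum>a\<in>F. (- D (flow N (t - s) w) a) * Y s a + B (\<eta> s) a * flow (Suc N) (t - s) w a)) (at s within {0..t})"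
      unfolding G_def by (intro DERIV_sum DERIV_mult dflow dY s)
    also have "(\<Sum>a\<in>F. (- D (flow N (t - s) w) a) * Y s a + B (\<eta> s) a * flow (Suc N) (t - s) w a) =
        pairing (D (flow N (t - s) w)) (Z s) - pairing (D (flow N (t - s) w)) (\<eta> s) + pairing (flow (Suc N) (t - s) w) (B (\<eta> s))"
      unfolding pairing_on[OF F S1] pairing_on[OF F S2] Y_def by (simp add: sum.distrib sum_subtractf sum_negf algebra_simps)
    also have "pairing (flow (Suc N) (t - s) w) (B (\<eta> s)) = pairing (D (flow (Suc N) (t - s) w)) (\<eta> s)"
      by (rule pairing_drift[OF fin_supp_flow[OF w]])
    also have "D (flow (Suc N) (t - s) w) = (\<lambda>a. D (flow N (t - s) w) a + (t - s) ^ Suc N / fact (Suc N) * (D ^^ (N + 2)) w a)"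
    proof
      fix a
      have "(D ^^ Suc N) (D w) = (D ^^ (N + 2)) w" by (simp add: funpow_swap1)
      then show "D (flow (Suc N) (t - s) w) a = D (flow N (t - s) w) a + (t - s) ^ Suc N / fact (Suc N) * (D ^^ (N + 2)) w a"
        unfolding D_flow flow_Suc by simp
    qed
    also have "pairing \<dots> (\<eta> s) = pairing (D (flow N (t - s) w)) (\<eta> s) + (t - s) ^ Suc N / fact (Suc N) * pairing ((D ^^ (N + 2)) w) (\<eta> s)"
      unfolding pairing_add_left[OF fin_supp_D[OF fin_supp_flow[OF w]] fin_supp_scale[OF fin_supp_D_pow[OF w]]] pairing_scale_left ..
    finally show ?thesis by (simp add: g_def)
  qed
  have cg: "continuous_on {0..t} g"
    unfolding g_def pairing_on[OF F S2] pairing_on[OF F S3] unfolding D_flow unfolding flow_def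
    by (intro continuous_intros continuous_on_subset[OF cont(1)] continuous_on_subset[OF cont(2)]) auto
  have "(\<lambda>n. \<Sum>k<Suc n. t / real (Suc n) * g (t * real k / real (Suc n))) \<longlonglongrightarrow> G t - G 0"
    by (rule riemann_sum_tendsto[OF t dG cg])
  then have lim: "(\<lambda>n. pairing (flow (Suc N) t w) (\<eta> 0) + pairing w (Z t) + (\<Sum>k<Suc n. t / real (Suc n) * g (t * real k / real (Suc n))))
      \<longlonglongrightarrow> pairing (flow (Suc N) t w) (\<eta> 0) + pairing w (Z t) + (G t - G 0)"
    by (intro tendsto_add tendsto_const)
  have sums: "pairing (flow (Suc N) t w) (\<eta> 0) + pairing w (Z t) + (\<Sum>k<Suc n. t / real (Suc n) * g (t * real k / real (Suc n))) =
      pairing (flow (Suc N) t w) (\<eta> 0) + noise_sum t N w n Z + error_sum t N w n \<eta>" for n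
    unfolding noise_sum_def error_sum_def g_def by (simp add: distrib_left sum.distrib del: fact_Suc power_Suc of_nat_Suc sum.lessThan_Suc)
  have Gt: "G t = pairing w (\<eta> t) - pairing w (Z t)"
    unfolding G_def Y_def pairing_on[OF F S4] by (simp add: flow_0 algebra_simps sum_subtractf)
  have G0: "G 0 = pairing (flow (Suc N) t w) (\<eta> 0)"
    unfolding G_def Y_def pairing_on[OF F S1] by (simp add: Z0)
  show ?thesis using lim unfolding sums Gt G0 by simp
qed

end

context prob_space
begin

section \<open>Gaussian variables, independence and characteristic functions\<close>

lemma gaussian_variable_square_integrable:
  assumes "gaussian_variable X"
  shows "integrable M (\<lambda>x. (X x)\<^sup>2)"
proof -
  have X: "random_variable borel X" using assms by (simp add: gaussian_variable_def)
  from assms consider \<mu> where "AE x in M. X x = \<mu>" | \<mu> \<sigma> where "\<sigma> > 0" "distributed M lborel X (normal_density \<mu> \<sigma>)"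
    unfolding gaussian_variable_def by blast
  then show ?thesis
  proof cases
    case 1
    then show ?thesis
      using X by (subst integrable_cong_AE[where g = "\<lambda>_. \<mu>\<^sup>2"]) auto
  next
    case 2
    have "integrable lborel (\<lambda>x. normal_density \<mu> \<sigma> x * (x - \<mu>)\<^sup>2)"
      using integrable_normal_moment[OF 2(1), of \<mu> 2] .
    then have "integrable M (\<lambda>x. (X x - \<mu>)\<^sup>2)"
      using distributed_integrable[OF 2(2), of "\<lambda>x. (x - \<mu>)\<^sup>2"] by (simp add: normal_density_nonneg)
    moreover have "integrable M X"
      using distributed_integrable[OF 2(2), of "\<lambda>x. x"] integrable_normal_moment_nz_1[OF 2(1), of \<mu>]
      by (simp add: normal_density_nonneg)
    ultimately have "integrable M (\<lambda>x. (X x - \<mu>)\<^sup>2 + 2 * \<mu> * X x - \<mu>\<^sup>2)" by auto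
    then show ?thesis by (simp add: power2_eq_square algebra_simps)
  qed
qed

text \<open>Two cases, since \<open>gaussian_variable\<close> also admits almost surely constant
  variables, which have no density; with mean 0 they vanish and both sides are 1.\<close>

lemma gaussian_variable_iexp:
  assumes G: "gaussian_variable X" and E: "expectation X = 0"
  shows "(CLINT x|M. iexp (X x)) = complex_of_real (exp (- expectation (\<lambda>x. (X x)\<^sup>2) / 2))"
proof -
  have X: "random_variable borel X" using G by (simp add: gaussian_variable_def)
  from G consider \<mu> where "AE x in M. X x = \<mu>" | \<mu> \<sigma> where "\<sigma> > 0" "distributed M lborel X (normal_density \<mu> \<sigma>)"
    unfolding gaussian_variable_def by blast
  then show ?thesis
  proof cases
    case 1
    have "expectation X = expectation (\<lambda>_. \<mu>)" using 1 X by (intro integral_cong_AE) auto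
    then have "\<mu> = 0" using E by (simp add: prob_space)
    then have "(CLINT x|M. iexp (X x)) = (CLINT x|M. 1)" "expectation (\<lambda>x. (X x)\<^sup>2) = expectation (\<lambda>_. 0)"
      using 1 X by (intro integral_cong_AE; auto)+
    then show ?thesis by (simp add: prob_space)
  next
    case 2
    have "\<mu> = 0" using normal_distributed_expectation[OF 2] E by simp
    have v: "expectation (\<lambda>x. (X x)\<^sup>2) = \<sigma>\<^sup>2" using normal_distributed_variance[OF 2] E by simp
    have "distributed M lborel (\<lambda>x. X x / \<sigma>) std_normal_density"
      using 2 normal_standard_normal_convert[OF 2(1), of X \<mu>] \<open>\<mu> = 0\<close> by simp
    then have d: "distr M lborel (\<lambda>x. X x / \<sigma>) = std_normal_distribution"
      by (rule distributed_distr_eq_density)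
    have "(CLINT x|M. iexp (X x)) = (CLINT x|M. iexp (\<sigma> * (X x / \<sigma>)))" using 2(1) by simp
    also have "\<dots> = (CLINT y|distr M lborel (\<lambda>x. X x / \<sigma>). iexp (\<sigma> * y))"
      using X by (subst integral_distr) auto
    also have "\<dots> = char std_normal_distribution \<sigma>" unfolding d char_def ..
    also have "\<dots> = exp (- \<sigma>\<^sup>2 / 2)" by (simp add: char_std_normal_distribution)
    finally show ?thesis unfolding v .
  qed
qed

lemma square_integrable_mult:
  fixes X Y :: "'a \<Rightarrow> real"
  assumes "random_variable borel X" "random_variable borel Y" "integrable M (\<lambda>x. (X x)\<^sup>2)" "integrable M (\<lambda>x. (Y x)\<^sup>2)"
  shows "integrable M (\<lambda>x. X x * Y x)"
proof (rule Bochner_Integration.integrable_bound)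
  show "integrable M (\<lambda>x. (X x)\<^sup>2 + (Y x)\<^sup>2)" using assms by simp
  show "AE x in M. norm (X x * Y x) \<le> norm ((X x)\<^sup>2 + (Y x)\<^sup>2)"
  proof (rule AE_I2)
    fix x
    have "2 * \<bar>X x\<bar> * \<bar>Y x\<bar> \<le> \<bar>X x\<bar>\<^sup>2 + \<bar>Y x\<bar>\<^sup>2" by (rule sum_squares_bound)
    moreover have "0 \<le> \<bar>X x\<bar> * \<bar>Y x\<bar>" by simp
    ultimately show "norm (X x * Y x) \<le> norm ((X x)\<^sup>2 + (Y x)\<^sup>2)" unfolding real_norm_def abs_mult power2_abs by linarith
  qed
qed (use assms in auto)

lemma square_integrable_integrable:
  fixes X :: "'a \<Rightarrow> real"
  assumes "random_variable borel X" "integrable M (\<lambda>x. (X x)\<^sup>2)"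
  shows "integrable M X"
  using square_integrable_mult[of X "\<lambda>_. 1"] assms by simp

lemma centered_gaussian_family_sum:
  assumes X: "centered_gaussian_family X C" and F: "finite F"
  shows "gaussian_variable (\<lambda>x. \<Sum>a\<in>F. w a * X a x)"
    and "expectation (\<lambda>x. \<Sum>a\<in>F. w a * X a x) = 0"
    and "expectation (\<lambda>x. (\<Sum>a\<in>F. w a * X a x)\<^sup>2) = (\<Sum>a\<in>F. \<Sum>b\<in>F. w a * w b * C a b)"
proof -
  have fam: "finite J \<Longrightarrow> gaussian_variable (\<lambda>x. \<Sum>a\<in>J. r a * X a x)" for J r
    using X[unfolded centered_gaussian_family_def gaussian_family_def, THEN conjunct1, rule_format, of J r] .
  show "gaussian_variable (\<lambda>x. \<Sum>a\<in>F. w a * X a x)" by (rule fam[OF F])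
  have g: "gaussian_variable (X a)" for a
    using fam[of "{a}" "\<lambda>_. 1"] by simp
  then have m: "random_variable borel (X a)" for a by (simp add: gaussian_variable_def)
  have i2: "integrable M (\<lambda>x. X a x * X b x)" for a b
    by (intro square_integrable_mult m gaussian_variable_square_integrable g)
  have E: "expectation (X a) = 0" for a using X by (simp add: centered_gaussian_family_def)
  have C: "expectation (\<lambda>x. X a x * X b x) = C a b" for a b
    using X E by (simp add: centered_gaussian_family_def covariance_def)
  have i1: "integrable M (X a)" for a
    by (rule square_integrable_integrable[OF m gaussian_variable_square_integrable[OF g]])
  show "expectation (\<lambda>x. \<Sum>a\<in>F. w a * X a x) = 0"
    using i1 E by (simp add: Bochner_Integration.integral_sum)
  have "expectation (\<lambda>x. (\<Sum>a\<in>F. w a * X a x)\<^sup>2) = expectation (\<lambda>x. \<Sum>a\<in>F. \<Sum>b\<in>F. w a * w b * (X a x * X b x))"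
    by (simp add: power2_eq_square sum_product mult_ac)
  also have "\<dots> = (\<Sum>a\<in>F. \<Sum>b\<in>F. w a * w b * C a b)"
    using i2 by (simp add: Bochner_Integration.integral_sum C)
  finally show "expectation (\<lambda>x. (\<Sum>a\<in>F. w a * X a x)\<^sup>2) = (\<Sum>a\<in>F. \<Sum>b\<in>F. w a * w b * C a b)" .
qed

lemma sigma_sets_compose_subset:
  fixes h :: "'z \<Rightarrow> real"
  assumes V: "random_variable R V" and h: "h \<in> borel_measurable R"
  shows "sigma_sets (space M) {(\<lambda>x. h (V x)) -` A \<inter> space M |A. A \<in> sets borel} \<subseteq> sets (vimage_algebra (space M) V R)"
proof -
  have "{(\<lambda>x. h (V x)) -` A \<inter> space M |A. A \<in> sets borel} \<subseteq> sets (vimage_algebra (space M) V R)"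
  proof safe
    fix A :: "real set" assume "A \<in> sets borel"
    then have "h -` A \<inter> space R \<in> sets R" using h by (rule measurable_sets[rotated])
    moreover have "(\<lambda>x. h (V x)) -` A \<inter> space M = V -` (h -` A \<inter> space R) \<inter> space M"
      using measurable_space[OF V] by auto
    ultimately show "(\<lambda>x. h (V x)) -` A \<inter> space M \<in> sets (vimage_algebra (space M) V R)"
      using in_vimage_algebra by metis
  qed
  then show ?thesis
    using sets.sigma_sets_subset[of _ "vimage_algebra (space M) V R"] by simp
qed

text \<open>Functions of independent variables generate smaller sigma-algebras. This passes from
  \<open>independent\<close>, whose two variables may have different types, to
  \<open>indep_var\<close> for real variables, where characteristic functions multiply.\<close>

lemma independent_indep_var:
  fixes f :: "'b \<Rightarrow> real" and g :: "'c \<Rightarrow> real"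
  assumes ind: "independent S X S' Y" and f: "f \<in> borel_measurable S" and g: "g \<in> borel_measurable S'"
  shows "indep_var borel (\<lambda>x. f (X x)) borel (\<lambda>x. g (Y x))"
proof -
  have X: "random_variable S X" and Y: "random_variable S' Y"
    and I: "indep_set (sets (vimage_algebra (space M) X S)) (sets (vimage_algebra (space M) Y S'))"
    using ind by (auto simp: independent_def)
  show ?thesis
    unfolding indep_var_eq
  proof (intro conjI)
    show "random_variable borel (\<lambda>x. f (X x))" "random_variable borel (\<lambda>x. g (Y x))"
      using measurable_compose[OF X f] measurable_compose[OF Y g] by auto
    show "indep_set (sigma_sets (space M) {(\<lambda>x. f (X x)) -` A \<inter> space M |A. A \<in> sets borel})
       (sigma_sets (space M) {(\<lambda>x. g (Y x)) -` A \<inter> space M |A. A \<in> sets borel})"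
    proof (rule indep_setI)
      show "sigma_sets (space M) {(\<lambda>x. f (X x)) -` A \<inter> space M |A. A \<in> sets borel} \<subseteq> events"
        "sigma_sets (space M) {(\<lambda>x. g (Y x)) -` A \<inter> space M |A. A \<in> sets borel} \<subseteq> events"
        using sigma_sets_compose_subset[OF X f] sigma_sets_compose_subset[OF Y g] I by (auto dest: indep_setD_ev1 indep_setD_ev2)
      fix a b
      assume "a \<in> sigma_sets (space M) {(\<lambda>x. f (X x)) -` A \<inter> space M |A. A \<in> sets borel}"
        "b \<in> sigma_sets (space M) {(\<lambda>x. g (Y x)) -` A \<inter> space M |A. A \<in> sets borel}"
      then show "prob (a \<inter> b) = prob a * prob b"
        using sigma_sets_compose_subset[OF X f] sigma_sets_compose_subset[OF Y g] by (intro indep_setD[OF I]) auto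
    qed
  qed
qed

lemma indep_var_iexp_add:
  assumes "indep_var borel X borel (Y :: 'a \<Rightarrow> real)"
  shows "(CLINT x|M. iexp (X x + Y x)) = (CLINT x|M. iexp (X x)) * (CLINT x|M. iexp (Y x))"
proof -
  have [measurable]: "random_variable borel X" "random_variable borel Y"
    using indep_var_rv1[OF assms] indep_var_rv2[OF assms] by auto
  have "char (distr M borel Z) 1 = (CLINT x|M. iexp (Z x))" if [measurable]: "random_variable borel Z" for Z :: "'a \<Rightarrow> real"
    unfolding char_def by (subst integral_distr) auto
  then show ?thesis using char_distr_add[OF assms, of 1] by simp
qed

lemma iexp_add: "iexp (x + y) = iexp x * iexp y"
  by (simp add: exp_add distrib_left)

lemma iexp_dist_le: "norm (iexp x - iexp y) \<le> \<bar>x - y\<bar>"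
proof -
  have "iexp x - iexp y = iexp y * (iexp (x - y) - 1)" by (simp add: algebra_simps flip: exp_add)
  then have "norm (iexp x - iexp y) = norm (iexp (x - y) - 1)" by (simp add: norm_mult)
  also have "\<dots> \<le> \<bar>x - y\<bar>" using iexp_approx1[of "x - y" 0] by simp
  finally show ?thesis .
qed

end

section \<open>Covariances and maximal correlation\<close>

lemma cosh_minus_one_sums:
  "(\<lambda>n. (if even n \<and> n \<noteq> 0 then inverse (fact n) else 0) * u ^ n) sums (cosh u - 1 :: real)"
proof -
  have "(\<lambda>n. (if even n then u ^ n /\<^sub>R fact n else 0) - (if n = 0 then 1 else 0)) sums (cosh u - 1)"
    by (intro sums_diff cosh_converges) (use sums_single[of 0 "\<lambda>_. 1 :: real"] in simp)
  moreover have "(if even n then u ^ n /\<^sub>R fact n else 0) - (if n = 0 then 1 else 0) =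
      (if even n \<and> n \<noteq> 0 then inverse (fact n) else 0) * u ^ n" for n
    by auto
  ultimately show ?thesis by simp
qed

lemma sinh_sums: "(\<lambda>n. (if even n then 0 else inverse (fact n)) * u ^ n) sums (sinh u :: real)"
proof -
  have "(if even n then 0 else u ^ n /\<^sub>R fact n) = (if even n then 0 else inverse (fact n)) * u ^ n" for n
    by auto
  then show ?thesis using sinh_converges[of u] by simp
qed

context prob_space
begin

section \<open>Covariance as a continuous bilinear form on L2\<close>

lemma covariance_eq:
  assumes "random_variable borel X" "random_variable borel Y"
    "integrable M (\<lambda>x. (X x)\<^sup>2)" "integrable M (\<lambda>x. (Y x)\<^sup>2)"
  shows "covariance X Y = expectation (\<lambda>x. X x * Y x) - expectation X * expectation Y"
proof -
  have i: "integrable M X" "integrable M Y" "integrable M (\<lambda>x. X x * Y x)"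
    using assms by (auto intro: square_integrable_integrable square_integrable_mult)
  have "covariance X Y = expectation (\<lambda>x. X x * Y x - expectation Y * X x - expectation X * Y x + expectation X * expectation Y)"
    unfolding covariance_def by (simp add: algebra_simps)
  also have "\<dots> = expectation (\<lambda>x. X x * Y x) - expectation X * expectation Y"
    using i by (simp add: prob_space algebra_simps)
  finally show ?thesis .
qed

lemma variance_eq_covariance: "variance X = covariance X X"
  by (simp add: covariance_def power2_eq_square)

lemma covariance_scale:
  "covariance (\<lambda>x. r * X x) (\<lambda>x. s * Y x) = r * s * covariance X Y"
proof -
  have "covariance (\<lambda>x. r * X x) (\<lambda>x. s * Y x) = expectation (\<lambda>x. r * s * ((X x - expectation X) * (Y x - expectation Y)))"
    unfolding covariance_def by (simp add: algebra_simps)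
  then show ?thesis by (simp add: covariance_def)
qed

lemma expectation_mult_le:
  fixes X Y :: "'a \<Rightarrow> real"
  assumes X: "random_variable borel X" "integrable M (\<lambda>x. (X x)\<^sup>2)"
    and Y: "random_variable borel Y" "integrable M (\<lambda>x. (Y x)\<^sup>2)"
  shows "\<bar>expectation (\<lambda>x. X x * Y x)\<bar> \<le> sqrt (expectation (\<lambda>x. (X x)\<^sup>2)) * sqrt (expectation (\<lambda>x. (Y x)\<^sup>2))"
proof -
  define a b c where "a = expectation (\<lambda>x. (X x)\<^sup>2)" and "b = expectation (\<lambda>x. (Y x)\<^sup>2)"
    and "c = expectation (\<lambda>x. X x * Y x)"
  have i: "integrable M (\<lambda>x. X x * Y x)" by (intro square_integrable_mult X Y)
  have q: "0 \<le> a + 2 * s * c + s\<^sup>2 * b" for s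
  proof -
    have "0 \<le> expectation (\<lambda>x. (X x + s * Y x)\<^sup>2)" by simp
    also have "\<dots> = expectation (\<lambda>x. (X x)\<^sup>2 + 2 * s * (X x * Y x) + s\<^sup>2 * (Y x)\<^sup>2)"
      by (simp add: power2_eq_square algebra_simps)
    also have "\<dots> = a + 2 * s * c + s\<^sup>2 * b" using X Y i by (simp add: a_def b_def c_def)
    finally show ?thesis .
  qed
  have b: "b \<ge> 0" "a \<ge> 0" by (simp_all add: a_def b_def)
  have "c\<^sup>2 \<le> a * b"
  proof (cases "b = 0")
    case True
    have "c = 0"
    proof (rule ccontr)
      assume "c \<noteq> 0"
      \<comment> \<open>For \<open>b = 0\<close> the polynomial in \<open>s\<close> is affine, and
        at this point its value would be -1.\<close>
      then show False using q[of "- (a + 1) / (2 * c)"] True by (simp add: field_simps)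
    qed
    then show ?thesis using True by simp
  next
    case False
    then have "b > 0" using b by simp
    then show ?thesis using q[of "- c / b"] by (simp add: field_simps power2_eq_square)
  qed
  then have "\<bar>c\<bar> \<le> sqrt (a * b)" by (metis real_sqrt_abs real_sqrt_le_mono)
  then show ?thesis by (simp add: real_sqrt_mult a_def b_def c_def)
qed

lemma expectation_mult_tendsto:
  fixes X Y :: "'a \<Rightarrow> real" and X' Y' :: "nat \<Rightarrow> 'a \<Rightarrow> real"
  assumes X: "random_variable borel X" "integrable M (\<lambda>x. (X x)\<^sup>2)"
    and Y: "random_variable borel Y" "integrable M (\<lambda>x. (Y x)\<^sup>2)"
    and X': "\<And>n. random_variable borel (X' n)" "\<And>n. integrable M (\<lambda>x. (X' n x)\<^sup>2)"
    and Y': "\<And>n. random_variable borel (Y' n)" "\<And>n. integrable M (\<lambda>x. (Y' n x)\<^sup>2)"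
    and lim: "(\<lambda>n. expectation (\<lambda>x. (X x - X' n x)\<^sup>2)) \<longlonglongrightarrow> 0" "(\<lambda>n. expectation (\<lambda>x. (Y x - Y' n x)\<^sup>2)) \<longlonglongrightarrow> 0"
  shows "(\<lambda>n. expectation (\<lambda>x. X' n x * Y' n x)) \<longlonglongrightarrow> expectation (\<lambda>x. X x * Y x)"
proof -
  let ?e = "\<lambda>n. expectation (\<lambda>x. (X x - X' n x)\<^sup>2)" and ?d = "\<lambda>n. expectation (\<lambda>x. (Y x - Y' n x)\<^sup>2)"
  let ?a = "expectation (\<lambda>x. (X x)\<^sup>2)" and ?b = "expectation (\<lambda>x. (Y x)\<^sup>2)"
  have D: "integrable M (\<lambda>x. (U x - V x)\<^sup>2)"
    if "random_variable borel U" "integrable M (\<lambda>x. (U x)\<^sup>2)" "random_variable borel V" "integrable M (\<lambda>x. (V x)\<^sup>2)" for U V :: "'a \<Rightarrow> real"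
  proof -
    have "integrable M (\<lambda>x. (U x)\<^sup>2 + (V x)\<^sup>2 - 2 * (U x * V x))"
      using that by (intro Bochner_Integration.integrable_diff Bochner_Integration.integrable_add integrable_mult_right square_integrable_mult)
    then show ?thesis by (simp add: power2_diff mult.assoc)
  qed
  have dX: "random_variable borel (\<lambda>x. X x - X' n x)" "integrable M (\<lambda>x. (X x - X' n x)\<^sup>2)" for n
    using X X' by (auto intro!: D)
  have dY: "random_variable borel (\<lambda>x. Y x - Y' n x)" "integrable M (\<lambda>x. (Y x - Y' n x)\<^sup>2)" for n
    using Y Y' by (auto intro!: D)
  have b: "\<bar>expectation (\<lambda>x. X' n x * Y' n x) - expectation (\<lambda>x. X x * Y x)\<bar> \<le>
      sqrt (?e n) * sqrt (?d n) + sqrt (?e n) * sqrt ?b + sqrt ?a * sqrt (?d n)" for n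
  proof -
    have i: "integrable M (\<lambda>x. (X x - X' n x) * (Y x - Y' n x))" "integrable M (\<lambda>x. (X x - X' n x) * Y x)"
      "integrable M (\<lambda>x. X x * (Y x - Y' n x))" "integrable M (\<lambda>x. X x * Y x)" "integrable M (\<lambda>x. X' n x * Y' n x)"
      by (intro square_integrable_mult X Y X' Y' dX dY)+
    have "expectation (\<lambda>x. X' n x * Y' n x) - expectation (\<lambda>x. X x * Y x) =
        expectation (\<lambda>x. X' n x * Y' n x - X x * Y x)" using i by simp
    \<comment> \<open>Every product on the right contains a factor that is small in L2, so
      Cauchy-Schwarz applies to each.\<close>
    also have "\<dots> = expectation (\<lambda>x. (X x - X' n x) * (Y x - Y' n x) - (X x - X' n x) * Y x - X x * (Y x - Y' n x))"
      by (intro Bochner_Integration.integral_cong) (auto simp: algebra_simps)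
    also have "\<dots> = expectation (\<lambda>x. (X x - X' n x) * (Y x - Y' n x)) - expectation (\<lambda>x. (X x - X' n x) * Y x)
        - expectation (\<lambda>x. X x * (Y x - Y' n x))" using i(1-3) by simp
    finally have "\<bar>expectation (\<lambda>x. X' n x * Y' n x) - expectation (\<lambda>x. X x * Y x)\<bar> \<le>
        \<bar>expectation (\<lambda>x. (X x - X' n x) * (Y x - Y' n x))\<bar> + \<bar>expectation (\<lambda>x. (X x - X' n x) * Y x)\<bar>
        + \<bar>expectation (\<lambda>x. X x * (Y x - Y' n x))\<bar>" by linarith
    also have "\<dots> \<le> sqrt (?e n) * sqrt (?d n) + sqrt (?e n) * sqrt ?b + sqrt ?a * sqrt (?d n)"
      by (intro add_mono expectation_mult_le X Y dX dY)
    finally show ?thesis .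
  qed
  have "(\<lambda>n. sqrt (?e n) * sqrt (?d n) + sqrt (?e n) * sqrt ?b + sqrt ?a * sqrt (?d n)) \<longlonglongrightarrow>
      sqrt 0 * sqrt 0 + sqrt 0 * sqrt ?b + sqrt ?a * sqrt 0"
    by (intro tendsto_intros lim)
  then have "(\<lambda>n. sqrt (?e n) * sqrt (?d n) + sqrt (?e n) * sqrt ?b + sqrt ?a * sqrt (?d n)) \<longlonglongrightarrow> 0" by simp
  then have "(\<lambda>n. expectation (\<lambda>x. X' n x * Y' n x) - expectation (\<lambda>x. X x * Y x)) \<longlonglongrightarrow> 0"
    by (rule Lim_null_comparison[rotated]) (simp add: b)
  then show ?thesis by (rule LIM_zero_cancel)
qed

lemma covariance_tendsto:
  fixes X Y :: "'a \<Rightarrow> real" and X' Y' :: "nat \<Rightarrow> 'a \<Rightarrow> real"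
  assumes X: "random_variable borel X" "integrable M (\<lambda>x. (X x)\<^sup>2)"
    and Y: "random_variable borel Y" "integrable M (\<lambda>x. (Y x)\<^sup>2)"
    and X': "\<And>n. random_variable borel (X' n)" "\<And>n. integrable M (\<lambda>x. (X' n x)\<^sup>2)"
    and Y': "\<And>n. random_variable borel (Y' n)" "\<And>n. integrable M (\<lambda>x. (Y' n x)\<^sup>2)"
    and lim: "(\<lambda>n. expectation (\<lambda>x. (X x - X' n x)\<^sup>2)) \<longlonglongrightarrow> 0" "(\<lambda>n. expectation (\<lambda>x. (Y x - Y' n x)\<^sup>2)) \<longlonglongrightarrow> 0"
  shows "(\<lambda>n. covariance (X' n) (Y' n)) \<longlonglongrightarrow> covariance X Y"
proof -
  have "(\<lambda>n. expectation (\<lambda>x. U' n x * 1)) \<longlonglongrightarrow> expectation (\<lambda>x. U x * 1)"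
    if "random_variable borel U" "integrable M (\<lambda>x. (U x)\<^sup>2)" "\<And>n. random_variable borel (U' n)" "\<And>n. integrable M (\<lambda>x. (U' n x)\<^sup>2)"
      "(\<lambda>n. expectation (\<lambda>x. (U x - U' n x)\<^sup>2)) \<longlonglongrightarrow> 0" for U :: "'a \<Rightarrow> real" and U'
    by (rule expectation_mult_tendsto) (use that in auto)
  from this[OF X X' lim(1)] this[OF Y Y' lim(2)]
  have "(\<lambda>n. expectation (X' n)) \<longlonglongrightarrow> expectation X" "(\<lambda>n. expectation (Y' n)) \<longlonglongrightarrow> expectation Y" by simp_all
  then show ?thesis
    unfolding covariance_eq[OF X(1) Y(1) X(2) Y(2)] covariance_eq[OF X'(1) Y'(1) X'(2) Y'(2)]
    by (intro tendsto_diff tendsto_mult expectation_mult_tendsto X Y X' Y' lim)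
qed

lemma bounded_square_integrable:
  fixes X :: "'a \<Rightarrow> real"
  assumes "random_variable borel X" "\<And>x. \<bar>X x\<bar> \<le> b"
  shows "integrable M (\<lambda>x. (X x)\<^sup>2)"
proof (rule integrable_const_bound[of _ "b\<^sup>2"])
  show "AE x in M. norm ((X x)\<^sup>2) \<le> b\<^sup>2"
    using power_mono[OF assms(2), of _ 2] by (intro AE_I2) simp
qed (use assms in auto)

lemma covariance_sum:
  fixes X :: "'i \<Rightarrow> 'a \<Rightarrow> real" and Y :: "'j \<Rightarrow> 'a \<Rightarrow> real"
  assumes fin: "finite I" "finite J"
    and X: "\<And>i. i \<in> I \<Longrightarrow> random_variable borel (X i)" "\<And>i. i \<in> I \<Longrightarrow> integrable M (\<lambda>x. (X i x)\<^sup>2)"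
    and Y: "\<And>j. j \<in> J \<Longrightarrow> random_variable borel (Y j)" "\<And>j. j \<in> J \<Longrightarrow> integrable M (\<lambda>x. (Y j x)\<^sup>2)"
  shows "covariance (\<lambda>x. \<Sum>i\<in>I. r i * X i x) (\<lambda>x. \<Sum>j\<in>J. s j * Y j x) =
    (\<Sum>i\<in>I. \<Sum>j\<in>J. r i * s j * covariance (X i) (Y j))"
proof -
  have iX: "integrable M (X i)" if "i \<in> I" for i by (rule square_integrable_integrable[OF X[OF that]])
  have iY: "integrable M (Y j)" if "j \<in> J" for j by (rule square_integrable_integrable[OF Y[OF that]])
  have iXY: "integrable M (\<lambda>x. (X i x - expectation (X i)) * (Y j x - expectation (Y j)))" if "i \<in> I" "j \<in> J" for i j
  proof -
    have "integrable M (\<lambda>x. X i x * Y j x - expectation (Y j) * X i x - expectation (X i) * Y j x + expectation (X i) * expectation (Y j))"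
      using iX[OF that(1)] iY[OF that(2)] square_integrable_mult[OF X(1)[OF that(1)] Y(1)[OF that(2)] X(2)[OF that(1)] Y(2)[OF that(2)]]
      by simp
    then show ?thesis by (simp add: algebra_simps)
  qed
  have "covariance (\<lambda>x. \<Sum>i\<in>I. r i * X i x) (\<lambda>x. \<Sum>j\<in>J. s j * Y j x) =
    expectation (\<lambda>x. \<Sum>i\<in>I. \<Sum>j\<in>J. r i * s j * ((X i x - expectation (X i)) * (Y j x - expectation (Y j))))"
    unfolding covariance_def using iX iY
    by (simp add: Bochner_Integration.integral_sum sum_subtractf[symmetric] right_diff_distrib[symmetric] sum_product mult_ac)
  also have "\<dots> = (\<Sum>i\<in>I. \<Sum>j\<in>J. r i * s j * covariance (X i) (Y j))"
    unfolding covariance_def using iXY by (simp add: Bochner_Integration.integral_sum)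
  finally show ?thesis .
qed

lemma expectation_cos:
  assumes X: "random_variable borel X" and "(CLINT x|M. iexp (X x)) = complex_of_real r"
  shows "expectation (\<lambda>x. cos (X x + \<theta>)) = r * cos \<theta>"
proof -
  have i: "complex_integrable M (\<lambda>x. iexp (X x))"
    using X by (intro integrable_const_bound[of _ 1]) auto
  have "expectation (\<lambda>x. cos (X x + \<theta>)) = expectation (\<lambda>x. Re (iexp \<theta> * iexp (X x)))"
    by (intro Bochner_Integration.integral_cong) (auto simp: cos_add Re_exp Im_exp)
  also have "\<dots> = Re (CLINT x|M. iexp \<theta> * iexp (X x))"
    using i by (intro integral_Re) auto
  also have "\<dots> = Re (iexp \<theta> * complex_of_real r)" using i assms(2) by simp
  also have "\<dots> = r * cos \<theta>" by (simp add: Re_exp)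
  finally show ?thesis .
qed

text \<open>Product-to-sum reduces the mixed moment to the characteristic functions of
  \<open>X + Y\<close> and \<open>X - Y\<close>. The result is shaped for
  \<open>cross_series_bound\<close>: two power series in the linear covariance \<open>k\<close> with
  nonnegative coefficients and no constant term, each weighted by a factor from \<open>X\<close>
  times a factor from \<open>Y\<close>.\<close>

lemma covariance_cos:
  assumes X: "random_variable borel X" and Y: "random_variable borel Y"
    and "(CLINT x|M. iexp (X x)) = complex_of_real (exp (- a / 2))" "(CLINT x|M. iexp (Y x)) = complex_of_real (exp (- b / 2))"
    and "(CLINT x|M. iexp (X x + Y x)) = complex_of_real (exp (- (a + b + 2 * k) / 2))"
    and "(CLINT x|M. iexp (X x - Y x)) = complex_of_real (exp (- (a + b - 2 * k) / 2))"
  shows "covariance (\<lambda>x. cos (X x + \<theta>)) (\<lambda>x. cos (Y x + \<phi>)) =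
    (exp (- a / 2) * cos \<theta>) * (exp (- b / 2) * cos \<phi>) * (cosh k - 1) +
    (exp (- a / 2) * sin \<theta>) * (exp (- b / 2) * sin \<phi>) * sinh k"
proof -
  have m: "random_variable borel (\<lambda>x. cos (X x + \<theta>))" "random_variable borel (\<lambda>x. cos (Y x + \<phi>))"
    using X Y by auto
  have i: "integrable M (\<lambda>x. cos (X x + Y x + (\<theta> + \<phi>)))" "integrable M (\<lambda>x. cos (X x - Y x + (\<theta> - \<phi>)))"
    using X Y by (intro integrable_const_bound[of _ 1]; auto)+
  have "expectation (\<lambda>x. cos (X x + \<theta>) * cos (Y x + \<phi>)) =
      expectation (\<lambda>x. cos (X x - Y x + (\<theta> - \<phi>)) / 2 + cos (X x + Y x + (\<theta> + \<phi>)) / 2)"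
  proof (intro Bochner_Integration.integral_cong refl)
    fix x
    have "X x + \<theta> - (Y x + \<phi>) = X x - Y x + (\<theta> - \<phi>)" "X x + \<theta> + (Y x + \<phi>) = X x + Y x + (\<theta> + \<phi>)" by simp_all
    then show "cos (X x + \<theta>) * cos (Y x + \<phi>) = cos (X x - Y x + (\<theta> - \<phi>)) / 2 + cos (X x + Y x + (\<theta> + \<phi>)) / 2"
      by (simp only: cos_times_cos add_divide_distrib)
  qed
  also have "\<dots> = exp (- (a + b - 2 * k) / 2) * cos (\<theta> - \<phi>) / 2 + exp (- (a + b + 2 * k) / 2) * cos (\<theta> + \<phi>) / 2"
    using i expectation_cos[OF _ assms(5)] expectation_cos[OF _ assms(6)] X Y by simp
  also have "exp (- (a + b - 2 * k) / 2) = exp (- a / 2) * exp (- b / 2) * exp k"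
    by (simp add: exp_add[symmetric] field_simps)
  also have "exp (- (a + b + 2 * k) / 2) = exp (- a / 2) * exp (- b / 2) * exp (- k)"
    by (simp add: exp_add[symmetric] field_simps)
  finally have E: "expectation (\<lambda>x. cos (X x + \<theta>) * cos (Y x + \<phi>)) =
     exp (- a / 2) * exp (- b / 2) * exp k * cos (\<theta> - \<phi>) / 2 + exp (- a / 2) * exp (- b / 2) * exp (- k) * cos (\<theta> + \<phi>) / 2" .
  have "covariance (\<lambda>x. cos (X x + \<theta>)) (\<lambda>x. cos (Y x + \<phi>)) =
      expectation (\<lambda>x. cos (X x + \<theta>) * cos (Y x + \<phi>)) - (exp (- a / 2) * cos \<theta>) * (exp (- b / 2) * cos \<phi>)"
    using expectation_cos[OF X assms(3)] expectation_cos[OF Y assms(4)]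
    by (subst covariance_eq) (auto intro!: m bounded_square_integrable[of _ 1])
  also have "\<dots> = (exp (- a / 2) * cos \<theta>) * (exp (- b / 2) * cos \<phi>) * (cosh k - 1) +
    (exp (- a / 2) * sin \<theta>) * (exp (- b / 2) * sin \<phi>) * sinh k"
    unfolding E by (simp add: cosh_def sinh_def cos_add cos_diff field_simps)
  finally show ?thesis .
qed

text \<open>Normalising \<open>f\<close> and \<open>g\<close> to standard deviation 1 makes the
  right side of the additive bound \<open>2 * \<rho>\<close>; the sign \<open>r\<close> applied to
  \<open>f\<close> yields the absolute value.\<close>

lemma maximal_correlation_le:
  assumes X: "random_variable S X" and Y: "random_variable S' Y" and rho: "0 \<le> \<rho>"
    and bound: "\<And>f g. f \<in> borel_measurable S \<Longrightarrow> g \<in> borel_measurable S' \<Longrightarrow>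
      integrable M (\<lambda>x. (f (X x))\<^sup>2) \<Longrightarrow> integrable M (\<lambda>x. (g (Y x))\<^sup>2) \<Longrightarrow>
      2 * covariance (\<lambda>x. f (X x)) (\<lambda>x. g (Y x)) \<le> \<rho> * (variance (\<lambda>x. f (X x)) + variance (\<lambda>x. g (Y x)))"
  shows "maximal_correlation S X S' Y \<le> ennreal \<rho>"
  unfolding maximal_correlation_def
proof (intro SUP_least ennreal_leI)
  fix f g assume f: "f \<in> test_functions S X" and g: "g \<in> test_functions S' Y"
  define sf sg where "sf = std_dev (\<lambda>x. f (X x))" and "sg = std_dev (\<lambda>x. g (Y x))"
  define k where "k = covariance (\<lambda>x. f (X x)) (\<lambda>x. g (Y x))"
  have s: "sf > 0" "sg > 0" using f g by (auto simp: test_functions_def sf_def sg_def)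
  have v: "variance (\<lambda>x. f (X x)) = sf\<^sup>2" "variance (\<lambda>x. g (Y x)) = sg\<^sup>2"
    by (simp_all add: sf_def sg_def std_dev_def)
  have "2 * (r * inverse sf * inverse sg * k) \<le> \<rho> * 2" if r: "r\<^sup>2 = 1" for r
  proof -
    have "2 * covariance (\<lambda>x. r * inverse sf * f (X x)) (\<lambda>x. inverse sg * g (Y x)) \<le>
        \<rho> * (variance (\<lambda>x. r * inverse sf * f (X x)) + variance (\<lambda>x. inverse sg * g (Y x)))"
      using f g by (intro bound) (auto simp: test_functions_def power_mult_distrib)
    also have "variance (\<lambda>x. r * inverse sf * f (X x)) = (r * inverse sf)\<^sup>2 * sf\<^sup>2"
      unfolding variance_eq_covariance covariance_scale unfolding variance_eq_covariance[symmetric] v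
      by (simp add: power2_eq_square)
    also have "variance (\<lambda>x. inverse sg * g (Y x)) = (inverse sg)\<^sup>2 * sg\<^sup>2"
      unfolding variance_eq_covariance covariance_scale unfolding variance_eq_covariance[symmetric] v
      by (simp add: power2_eq_square)
    also have "(r * inverse sf)\<^sup>2 * sf\<^sup>2 + (inverse sg)\<^sup>2 * sg\<^sup>2 = 2"
      using s r by (simp add: power_mult_distrib power_inverse)
    finally show ?thesis unfolding covariance_scale k_def .
  qed
  from this[of 1] this[of "-1"] have "\<bar>inverse sf * inverse sg * k\<bar> \<le> \<rho>" by (simp add: abs_le_iff mult_ac)
  then show "\<bar>covariance (\<lambda>x. f (X x)) (\<lambda>x. g (Y x))\<bar> / (std_dev (\<lambda>x. f (X x)) * std_dev (\<lambda>x. g (Y x))) \<le> \<rho>"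
    using s unfolding sf_def[symmetric] sg_def[symmetric] k_def[symmetric]
    by (simp add: abs_mult divide_inverse mult_ac)
qed

end

section \<open>The joint law at two times\<close>

locale langevin_chain = prob_space M for M :: "'w measure" +
  fixes m \<omega> c T lam :: real and W p q :: "int \<Rightarrow> real \<Rightarrow> 'w \<Rightarrow> real"
  assumes pos: "m > 0" "\<omega> > 0" "c > 0" "T > 0" "lam > 0"
    and noise: "independent_brownian_motions W"
    and solution: "langevin_solution m \<omega> c T lam W p q"
    and equilibrium: "at_equilibrium m \<omega> c T W p q"
begin

lemma centered: "u \<ge> 0 \<Longrightarrow> centered_gaussian_family (\<lambda>a x. state p q u x a) (gibbs_covariance m \<omega> c T)"
  using equilibrium by (simp add: at_equilibrium_def)

lemma independent_state_noise:
  "u \<ge> 0 \<Longrightarrow> independent state_space (state p q u) (\<Pi>\<^sub>M j\<in>UNIV \<times> {u..}. borel) (future_noise W u)"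
  using equilibrium by (simp add: at_equilibrium_def)

sublocale gibbs_chain m \<omega> c T lam
proof
  fix F :: "site set" and w assume F: "finite F"
  show "0 \<le> (\<Sum>a\<in>F. \<Sum>b\<in>F. w a * w b * gibbs_covariance m \<omega> c T a b)"
    unfolding centered_gaussian_family_sum(3)[OF centered[OF order_refl] F, symmetric] by simp
qed (rule pos)+

section \<open>Law of the state at one time and the noise path\<close>

lemma measurable_state: "u \<ge> 0 \<Longrightarrow> random_variable state_space (state p q u)"
  using independent_state_noise by (simp add: independent_def)

lemma measurable_pairing_state: "u \<ge> 0 \<Longrightarrow> random_variable borel (\<lambda>x. pairing w (state p q u x))"
  by (rule measurable_compose[OF measurable_state measurable_pairing])

lemma pairing_state_gaussian:
  assumes "u \<ge> 0" "fin_supp w"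
  shows "gaussian_variable (\<lambda>x. pairing w (state p q u x))"
    "expectation (\<lambda>x. pairing w (state p q u x)) = 0"
    "expectation (\<lambda>x. (pairing w (state p q u x))\<^sup>2) = form w w"
  unfolding pairing_def form_on[OF assms(2) subset_refl subset_refl]
  by (rule centered_gaussian_family_sum[OF centered[OF assms(1)] assms(2)])+

lemma pairing_state_iexp:
  assumes "u \<ge> 0" "fin_supp w"
  shows "(CLINT x|M. iexp (pairing w (state p q u x))) = complex_of_real (exp (- form w w / 2))"
  using gaussian_variable_iexp[OF pairing_state_gaussian(1,2)[OF assms]] pairing_state_gaussian(3)[OF assms] by simp

text \<open>Only the momenta are driven. The argument \<open>y\<close> stands for the increments
  after time 0, the object that \<open>at_equilibrium\<close> declares independent of the initial
  state.\<close>

definition noise_path :: "(int \<times> real \<Rightarrow> real) \<Rightarrow> real \<Rightarrow> site \<Rightarrow> real" where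
  "noise_path y u = (\<lambda>(i, k). case k of Momentum \<Rightarrow> sqrt (2 * T * lam * m) * y (i, u) | Position \<Rightarrow> 0)"

lemma measurable_noise_path:
  assumes "u \<ge> 0"
  shows "(\<lambda>y. pairing v (noise_path y u)) \<in> borel_measurable (\<Pi>\<^sub>M j\<in>UNIV \<times> {0..}. borel)"
proof -
  have "(\<lambda>y. noise_path y u a) \<in> borel_measurable (\<Pi>\<^sub>M j\<in>UNIV \<times> {0..}. borel)" for a
    using assms unfolding noise_path_def
    by (cases a; cases "snd a") (auto intro!: borel_measurable_times measurable_component_singleton)
  then show ?thesis unfolding pairing_def by (intro borel_measurable_sum borel_measurable_times) auto
qed

lemma measurable_noise_sum:
  assumes "t > 0"
  shows "(\<lambda>y. noise_sum t N w n (noise_path y)) \<in> borel_measurable (\<Pi>\<^sub>M j\<in>UNIV \<times> {0..}. borel)"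
proof -
  have t: "0 \<le> t" "0 \<le> t * real k / real (Suc n)" for k using assms by simp_all
  show ?thesis
    unfolding noise_sum_def
    by (rule borel_measurable_add[OF measurable_noise_path[OF t(1)] borel_measurable_sum],
        rule borel_measurable_times[OF borel_measurable_const measurable_noise_path[OF t(2)]])
qed

lemma duhamel_AE:
  assumes t: "t > 0" and w: "fin_supp w"
  shows "AE x in M. \<forall>N. (\<lambda>n. pairing (flow (Suc N) t w) (state p q 0 x) +
      noise_sum t N w n (noise_path (future_noise W 0 x)) + error_sum t N w n (\<lambda>u. state p q u x))
    \<longlonglongrightarrow> pairing w (state p q t x)"
proof -
  have "AE x in M. \<forall>i. W i 0 x = 0 \<and> continuous_on {0..} (\<lambda>u. W i u x)"
    using noise by (auto simp: AE_all_countable independent_brownian_motions_def brownian_motion_def)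
  moreover have "AE x in M. \<forall>i.
        continuous_on {0..} (\<lambda>u. p i u x) \<and> continuous_on {0..} (\<lambda>u. q i u x) \<and>
        (\<forall>u\<ge>0.
           p i u x = p i 0 x +
             integral {0..u} (\<lambda>s. - m * \<omega>\<^sup>2 * q i s x +
               m * c\<^sup>2 * (q (i - 1) s x + q (i + 1) s x - 2 * q i s x) - lam * p i s x) +
             sqrt (2 * T * lam * m) * W i u x \<and>
           q i u x = q i 0 x + integral {0..u} (\<lambda>s. inverse m * p i s x))"
    using solution by (simp add: langevin_solution_def)
  ultimately show ?thesis
  proof eventually_elim
    case (elim x)
    define y where "y = future_noise W 0 x"
    \<comment> \<open>The increments from time 0 agree with the paths themselves because
      \<open>W i 0 x = 0\<close> at almost every sample point.\<close>
    have y: "y (i, u) = W i u x" if "u \<ge> 0" for i u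
      using elim(1) that by (simp add: y_def future_noise_def)
    have cont: "continuous_on {0..} (\<lambda>u. state p q u x a)" for a
    proof -
      obtain i k where a: "a = (i, k)" by (cases a)
      show ?thesis using elim(2)[THEN spec, of i] a by (cases k) (simp_all add: state_def)
    qed
    have contZ: "continuous_on {0..} (\<lambda>u. noise_path y u a)" for a
    proof -
      obtain i k where a: "a = (i, k)" by (cases a)
      have "continuous_on {0..} (\<lambda>u. y (i, u))"
        using elim(1)[THEN spec, of i] by (subst continuous_on_cong[OF refl, of _ _ "\<lambda>u. W i u x"]) (simp_all add: y)
      then show ?thesis using a by (cases k) (auto simp: noise_path_def intro!: continuous_intros)
    qed
    have Z0: "noise_path y 0 = (\<lambda>_. 0)"
      using elim(1) by (simp add: noise_path_def y fun_eq_iff split: coord.split)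
    have eq: "state p q u x a = state p q 0 x a + integral {0..u} (\<lambda>s. B (state p q s x) a) + noise_path y u a"
      if u: "u \<ge> 0" for u a
    proof -
      obtain i k where a: "a = (i, k)" by (cases a)
      have "p i u x = p i 0 x +
             integral {0..u} (\<lambda>s. - m * \<omega>\<^sup>2 * q i s x +
               m * c\<^sup>2 * (q (i - 1) s x + q (i + 1) s x - 2 * q i s x) - lam * p i s x) +
             sqrt (2 * T * lam * m) * W i u x"
        "q i u x = q i 0 x + integral {0..u} (\<lambda>s. inverse m * p i s x)"
        using elim(2)[THEN spec, of i, THEN conjunct2, THEN conjunct2, THEN spec, of u, THEN mp, OF u]
        by (rule conjunct1, rule conjunct2)
      then show ?thesis unfolding a by (cases k) (simp_all add: state_def noise_path_def y[OF u])
    qed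
    show ?case unfolding y_def[symmetric] by (intro allI duhamel t w Z0 cont contZ eq)
  qed
qed

text \<open>A bound for the mean of \<open>|error_sum|\<close> that does not depend on the mesh: the
  Riemann weights add up to \<open>t\<close>, and \<open>|z| \<le> (1 + z^2) / 2\<close> reduces the
  mean to a variance, bounded through \<open>K\<close> and \<beta>.\<close>

definition duhamel_error :: "real \<Rightarrow> nat \<Rightarrow> (site \<Rightarrow> real) \<Rightarrow> real" where
  "duhamel_error t N w = t * (t ^ Suc N / fact (Suc N) * ((1 + K * ((\<beta> ^ (N + 2))\<^sup>2 * sqnorm w)) / 2))"

lemma duhamel_error_tendsto_0: "(\<lambda>N. duhamel_error t N w) \<longlonglongrightarrow> 0"
proof -
  have "(\<lambda>n. t / 2 * (t ^ n / fact n) + t * K * \<beta>\<^sup>2 * sqnorm w / 2 * ((t * \<beta>\<^sup>2) ^ n / fact n)) \<longlonglongrightarrow>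
      t / 2 * 0 + t * K * \<beta>\<^sup>2 * sqnorm w / 2 * 0"
    by (intro tendsto_intros power_over_fact_tendsto_0)
  then have "(\<lambda>n. t / 2 * (t ^ Suc n / fact (Suc n)) + t * K * \<beta>\<^sup>2 * sqnorm w / 2 * ((t * \<beta>\<^sup>2) ^ Suc n / fact (Suc n))) \<longlonglongrightarrow> 0"
    by (subst (asm) filterlim_sequentially_Suc[symmetric]) simp
  moreover have "t / 2 * (t ^ Suc n / fact (Suc n)) + t * K * \<beta>\<^sup>2 * sqnorm w / 2 * ((t * \<beta>\<^sup>2) ^ Suc n / fact (Suc n)) = duhamel_error t n w" for n
  proof -
    have "(t * \<beta>\<^sup>2) ^ Suc n * \<beta>\<^sup>2 = t ^ Suc n * (\<beta> ^ (n + 2))\<^sup>2"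
      by (simp add: power_mult_distrib power_add power2_eq_square power_mult[symmetric] mult_ac)
    then have *: "(t * \<beta>\<^sup>2) ^ Suc n / fact (Suc n) * \<beta>\<^sup>2 = t ^ Suc n / fact (Suc n) * (\<beta> ^ (n + 2))\<^sup>2"
      by (simp only: times_divide_eq_left)
    have "t / 2 * r + t * K * b * sqnorm w / 2 * y = t * (r * ((1 + K * (z * sqnorm w)) / 2))"
      if "y * b = r * z" for r y z b
    proof -
      have "t / 2 * r + t * K * b * sqnorm w / 2 * y = t / 2 * r + t * K * sqnorm w / 2 * (y * b)" by simp
      then show ?thesis unfolding that by (simp add: algebra_simps add_divide_distrib)
    qed
    from this[OF *] show ?thesis unfolding duhamel_error_def .
  qed
  ultimately show ?thesis by simp
qed

text \<open>Stationarity enters here: at every intermediate time the state has the Gibbs law, so a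
  single variance \<open>form v v\<close> bounds all the terms.\<close>

lemma error_sum_bound:
  assumes t: "t > 0" and w: "fin_supp w"
  shows "random_variable borel (\<lambda>x. error_sum t N w n (\<lambda>u. state p q u x))"
    and "integrable M (\<lambda>x. \<bar>error_sum t N w n (\<lambda>u. state p q u x)\<bar>)"
    and "expectation (\<lambda>x. \<bar>error_sum t N w n (\<lambda>u. state p q u x)\<bar>) \<le> duhamel_error t N w"
proof -
  let ?S = "\<lambda>x. error_sum t N w n (\<lambda>u. state p q u x)"
  define v where "v = (D ^^ (N + 2)) w"
  have v: "fin_supp v" unfolding v_def by (rule fin_supp_D_pow[OF w])
  let ?z = "\<lambda>s x. pairing v (state p q s x)"
  define R where "R = t ^ Suc N / fact (Suc N)"
  define s where "s = (\<lambda>k. t * real k / real (Suc n))"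
  have s: "0 \<le> s k" "s k \<le> t" if "k < Suc n" for k
  proof -
    have "t * real k \<le> t * real (Suc n)" using t that by (intro mult_left_mono) auto
    then show "s k \<le> t" by (simp add: s_def divide_le_eq del: of_nat_Suc)
  qed (use t in \<open>simp add: s_def\<close>)
  have r: "0 \<le> (t - s k) ^ Suc N / fact (Suc N)" "(t - s k) ^ Suc N / fact (Suc N) \<le> R" if "k < Suc n" for k
    using s[OF that] unfolding R_def by (auto intro!: divide_right_mono power_mono simp del: power_Suc fact_Suc)
  have R: "R \<ge> 0" using t by (simp add: R_def)
  have sn: "0 \<le> s k" for k using t by (simp add: s_def)
  have E: "?S x = (\<Sum>k<Suc n. t / real (Suc n) *
     ((t - s k) ^ Suc N / fact (Suc N) * ?z (s k) x))" for x
    unfolding error_sum_def s_def v_def ..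
  show m: "random_variable borel (\<lambda>x. ?S x)"
    unfolding E by (intro borel_measurable_sum borel_measurable_times borel_measurable_const measurable_pairing_state sn)
  have i2: "integrable M (\<lambda>x. (?z (s k) x)\<^sup>2)" for k
    by (rule gaussian_variable_square_integrable[OF pairing_state_gaussian(1)[OF sn v]])
  let ?b = "\<lambda>x. \<Sum>k<Suc n. t / real (Suc n) * (R * ((1 + (?z (s k) x)\<^sup>2) / 2))"
  have ib: "integrable M ?b" using i2 by (intro Bochner_Integration.integrable_sum) auto
  have le: "\<bar>?S x\<bar> \<le> ?b x" for x
  proof -
    have "\<bar>?S x\<bar> \<le> (\<Sum>k<Suc n. \<bar>t / real (Suc n) *
     ((t - s k) ^ Suc N / fact (Suc N) * ?z (s k) x)\<bar>)"
      unfolding E by (rule sum_abs)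
    also have "\<dots> \<le> ?b x"
    proof (rule sum_mono)
      fix k assume "k \<in> {..<Suc n}"
      then have k: "k < Suc n" by simp
      have "\<bar>z\<bar> \<le> (1 + z\<^sup>2) / 2" for z :: real
        using sum_squares_bound[of 1 "\<bar>z\<bar>"] by simp
      then have "(t - s k) ^ Suc N / fact (Suc N) * \<bar>?z (s k) x\<bar> \<le> R * ((1 + (?z (s k) x)\<^sup>2) / 2)"
        using r[OF k] R by (intro mult_mono) auto
      then have "t / real (Suc n) * ((t - s k) ^ Suc N / fact (Suc N) * \<bar>?z (s k) x\<bar>)
          \<le> t / real (Suc n) * (R * ((1 + (?z (s k) x)\<^sup>2) / 2))"
        using t by (intro mult_left_mono) auto
      moreover have "\<bar>t / real (Suc n) * ((t - s k) ^ Suc N / fact (Suc N) * ?z (s k) x)\<bar> =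
          t / real (Suc n) * ((t - s k) ^ Suc N / fact (Suc N) * \<bar>?z (s k) x\<bar>)"
        using t r(1)[OF k] by (simp only: abs_mult abs_of_nonneg divide_nonneg_nonneg of_nat_0_le_iff less_imp_le)
      ultimately show "\<bar>t / real (Suc n) * ((t - s k) ^ Suc N / fact (Suc N) * ?z (s k) x)\<bar>
          \<le> t / real (Suc n) * (R * ((1 + (?z (s k) x)\<^sup>2) / 2))" by simp
    qed
    finally show ?thesis .
  qed
  show i: "integrable M (\<lambda>x. \<bar>?S x\<bar>)"
  proof (rule Bochner_Integration.integrable_bound[OF ib])
    show "random_variable borel (\<lambda>x. \<bar>?S x\<bar>)" using m by simp
    show "AE x in M. norm \<bar>?S x\<bar> \<le> norm (?b x)"
      unfolding real_norm_def abs_idempotent by (intro AE_I2 order_trans[OF le abs_ge_self])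
  qed
  have "expectation (\<lambda>x. \<bar>?S x\<bar>) \<le> expectation ?b"
    by (rule integral_mono[OF i ib le])
  also have "\<dots> = (\<Sum>k<Suc n. t / real (Suc n) * (R * ((1 + form v v) / 2)))"
  proof -
    have "expectation ?b = (\<Sum>k<Suc n. expectation (\<lambda>x. t / real (Suc n) * (R * ((1 + (?z (s k) x)\<^sup>2) / 2))))"
      using i2 by (intro Bochner_Integration.integral_sum) auto
    also have "\<dots> = (\<Sum>k<Suc n. t / real (Suc n) * (R * ((1 + form v v) / 2)))"
      using i2 pairing_state_gaussian(3)[OF sn v] by (intro sum.cong refl) (simp add: prob_space del: of_nat_Suc)
    finally show ?thesis .
  qed
  also have "\<dots> = t * (R * ((1 + form v v) / 2))" by (simp del: sum.lessThan_Suc of_nat_Suc)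
  also have "\<dots> \<le> t * (R * ((1 + K * ((\<beta> ^ (N + 2))\<^sup>2 * sqnorm w)) / 2))"
  proof -
    have "form v v \<le> K * sqnorm v" by (rule form_le_sqnorm[OF v])
    also have "\<dots> \<le> K * ((\<beta> ^ (N + 2))\<^sup>2 * sqnorm w)"
      unfolding v_def using K(1) by (intro mult_left_mono sqnorm_D_pow_le w) auto
    finally show ?thesis using t R by (intro mult_left_mono divide_right_mono add_left_mono) auto
  qed
  finally show "expectation (\<lambda>x. \<bar>?S x\<bar>) \<le> duhamel_error t N w"
    unfolding duhamel_error_def R_def .
qed

text \<open>\<open>\<phi> N\<close> is the characteristic function of a Riemann sum of the noise,
  and it is obtained before \<open>v\<close>: this order of quantifiers later allows its elimination
  by comparison with \<open>v = 0\<close>. The error sum is dropped at the cost of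
  \<open>duhamel_error\<close>, leaving a sum of independent terms.\<close>

lemma noise_factor:
  assumes t: "t > 0" and w: "fin_supp w"
  obtains \<phi> :: "nat \<Rightarrow> complex" where "\<And>v. fin_supp v \<Longrightarrow>
    (\<lambda>N. exp (complex_of_real (- form (\<lambda>a. v a + flow (Suc N) t w a) (\<lambda>a. v a + flow (Suc N) t w a) / 2)) * \<phi> N)
      \<longlonglongrightarrow> (CLINT x|M. iexp (pairing v (state p q 0 x) + pairing w (state p q t x)))"
proof -
  define X where "X = (\<lambda>x. pairing w (state p q t x))"
  define A where "A = (\<lambda>N x. pairing (flow (Suc N) t w) (state p q 0 x))"
  define R where "R = (\<lambda>N n x. noise_sum t N w n (noise_path (future_noise W 0 x)))"
  define E where "E = (\<lambda>N n x. error_sum t N w n (\<lambda>u. state p q u x))"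
  have mX[measurable]: "random_variable borel X" unfolding X_def using t by (intro measurable_pairing_state) simp
  have mA[measurable]: "random_variable borel (A N)" for N unfolding A_def by (intro measurable_pairing_state) simp
  have ind: "independent state_space (state p q 0) (\<Pi>\<^sub>M j\<in>UNIV \<times> {0..}. borel) (future_noise W 0)"
    by (rule independent_state_noise) simp
  have mR[measurable]: "random_variable borel (R N n)" for N n
    unfolding R_def using ind by (intro measurable_compose[OF _ measurable_noise_sum[OF t]]) (simp add: independent_def)
  have mE[measurable]: "random_variable borel (E N n)" for N n unfolding E_def by (rule error_sum_bound[OF t w])
  have lim: "AE x in M. \<forall>N. (\<lambda>n. A N x + R N n x + E N n x) \<longlonglongrightarrow> X x"
    using duhamel_AE[OF t w] unfolding A_def R_def E_def X_def .
  \<comment> \<open>Exponentials are bounded, so almost sure convergence in the mesh is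
    enough.\<close>
  have L: "(\<lambda>n. expectation (\<lambda>x. norm (iexp (X x) - iexp (A N x + R N n x + E N n x)))) \<longlonglongrightarrow> expectation (\<lambda>x. 0)" for N
  proof (rule integral_dominated_convergence[where w = "\<lambda>_. 2"])
    show "AE x in M. (\<lambda>n. norm (iexp (X x) - iexp (A N x + R N n x + E N n x))) \<longlonglongrightarrow> 0"
      using lim
    proof eventually_elim
      case (elim x)
      have "(\<lambda>n. norm (iexp (X x) - iexp (A N x + R N n x + E N n x))) \<longlonglongrightarrow> norm (iexp (X x) - iexp (X x))"
        by (intro tendsto_intros elim[rule_format])
      then show ?case by simp
    qed
    show "AE x in M. norm (norm (iexp (X x) - iexp (A N x + R N n x + E N n x))) \<le> 2" for n
    proof (rule AE_I2)
      fix x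
      show "norm (norm (iexp (X x) - iexp (A N x + R N n x + E N n x))) \<le> 2"
        using norm_triangle_ineq4[of "iexp (X x)" "iexp (A N x + R N n x + E N n x)"] by simp
    qed
  qed auto
  have "\<exists>n. expectation (\<lambda>x. norm (iexp (X x) - iexp (A N x + R N n x + E N n x))) < inverse (real (Suc N))" for N
  proof -
    have "\<forall>\<^sub>F n in sequentially. expectation (\<lambda>x. norm (iexp (X x) - iexp (A N x + R N n x + E N n x))) < inverse (real (Suc N))"
      by (rule order_tendstoD(2)[OF L]) simp
    then show ?thesis by (rule eventually_happens'[OF sequentially_bot])
  qed
  then have "\<forall>N. \<exists>n. expectation (\<lambda>x. norm (iexp (X x) - iexp (A N x + R N n x + E N n x))) < inverse (real (Suc N))"
    by (rule allI)
  \<comment> \<open>The mesh is fixed for each \<open>N\<close>, fine enough for an error below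
    \<open>1 / Suc N\<close>, without reference to \<open>v\<close>.\<close>
  from choice[OF this] obtain n where n: "\<forall>N. expectation (\<lambda>x. norm (iexp (X x) - iexp (A N x + R N (n N) x + E N (n N) x))) < inverse (real (Suc N))" ..
  define \<phi> where "\<phi> = (\<lambda>N. CLINT x|M. iexp (R N (n N) x))"
  have bd: "complex_integrable M (\<lambda>x. iexp (Y x))" if "random_variable borel Y" for Y
    using that by (intro integrable_const_bound[of _ 1]) auto
  have "(\<lambda>N. exp (complex_of_real (- form (\<lambda>a. v a + flow (Suc N) t w a) (\<lambda>a. v a + flow (Suc N) t w a) / 2)) * \<phi> N)
      \<longlonglongrightarrow> (CLINT x|M. iexp (pairing v (state p q 0 x) + pairing w (state p q t x)))" if v: "fin_supp v" for v
  proof (rule LIM_zero_cancel, rule Lim_null_comparison[where g = "\<lambda>N. inverse (real (Suc N)) + duhamel_error t N w"])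
    show "(\<lambda>N. inverse (real (Suc N)) + duhamel_error t N w) \<longlonglongrightarrow> 0"
      using tendsto_add[OF LIMSEQ_inverse_real_of_nat duhamel_error_tendsto_0] by simp
    define V where "V = (\<lambda>x. pairing v (state p q 0 x))"
    have mV[measurable]: "random_variable borel V" unfolding V_def by (intro measurable_pairing_state) simp
    show "\<forall>\<^sub>F N in sequentially. norm (exp (complex_of_real (- form (\<lambda>a. v a + flow (Suc N) t w a) (\<lambda>a. v a + flow (Suc N) t w a) / 2)) * \<phi> N
        - (CLINT x|M. iexp (pairing v (state p q 0 x) + pairing w (state p q t x)))) \<le> inverse (real (Suc N)) + duhamel_error t N w"
    proof (intro always_eventually allI)
      fix N
      let ?P = "\<lambda>x. A N x + R N (n N) x"
      let ?E = "E N (n N)"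
      let ?vf = "\<lambda>a. v a + flow (Suc N) t w a"
      have vf: "fin_supp ?vf" by (intro fin_supp_add v fin_supp_flow w)
      have VA: "pairing ?vf (state p q 0 x) = V x + A N x" for x
        unfolding V_def A_def by (rule pairing_add_left[OF v fin_supp_flow[OF w]])
      have "indep_var borel (\<lambda>x. pairing ?vf (state p q 0 x)) borel (R N (n N))"
        unfolding R_def by (rule independent_indep_var[OF ind measurable_pairing measurable_noise_sum[OF t]])
      from indep_var_iexp_add[OF this] pairing_state_iexp[OF order_refl vf]
      have e: "exp (complex_of_real (- form ?vf ?vf / 2)) * \<phi> N = (CLINT x|M. iexp (V x + A N x + R N (n N) x))"
        unfolding VA \<phi>_def exp_of_real by simp
      have i: "complex_integrable M (\<lambda>x. iexp (V x + X x))" "complex_integrable M (\<lambda>x. iexp (V x + A N x + R N (n N) x))"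
        by (intro bd; measurable)+
      have i3: "integrable M (\<lambda>x. norm (iexp (X x) - iexp (?P x + ?E x)))"
        by (intro integrable_norm Bochner_Integration.integrable_diff bd; measurable)
      have i4: "integrable M (\<lambda>x. \<bar>?E x\<bar>)"
        and E_le: "expectation (\<lambda>x. \<bar>?E x\<bar>) \<le> duhamel_error t N w"
        unfolding E_def by (rule error_sum_bound[OF t w])+
      have "norm ((CLINT x|M. iexp (V x + A N x + R N (n N) x)) - (CLINT x|M. iexp (V x + X x))) =
          norm (CLINT x|M. iexp (V x + A N x + R N (n N) x) - iexp (V x + X x))" using i by simp
      also have "\<dots> \<le> expectation (\<lambda>x. norm (iexp (V x + A N x + R N (n N) x) - iexp (V x + X x)))"
        by (rule integral_norm_bound)
      also have "\<dots> \<le> expectation (\<lambda>x. norm (iexp (X x) - iexp (?P x + ?E x)) + \<bar>?E x\<bar>)"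
      proof (rule integral_mono)
        fix x
        \<comment> \<open>The factor \<open>iexp (V x)\<close> has modulus 1, so the estimate is the
          same for all \<open>v\<close>.\<close>
        have "iexp (V x + A N x + R N (n N) x) - iexp (V x + X x) = iexp (V x) * (iexp (?P x) - iexp (X x))"
          by (simp only: add.assoc iexp_add right_diff_distrib)
        then have "norm (iexp (V x + A N x + R N (n N) x) - iexp (V x + X x)) = norm (iexp (?P x) - iexp (X x))"
          by (simp add: norm_mult)
        also have "\<dots> \<le> norm (iexp (?P x) - iexp (?P x + ?E x))
            + norm (iexp (?P x + ?E x) - iexp (X x))"
          by (rule norm_diff_triangle_le[OF order_refl order_refl])
        also have "norm (iexp (?P x) - iexp (?P x + ?E x)) \<le> \<bar>?E x\<bar>"
          using iexp_dist_le[of "?P x" "?P x + ?E x"] by simp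
        finally show "norm (iexp (V x + A N x + R N (n N) x) - iexp (V x + X x)) \<le>
            norm (iexp (X x) - iexp (?P x + ?E x)) + \<bar>?E x\<bar>"
          by (simp add: norm_minus_commute)
      next
        show "integrable M (\<lambda>x. norm (iexp (V x + A N x + R N (n N) x) - iexp (V x + X x)))"
          using i by (intro integrable_norm Bochner_Integration.integrable_diff)
        show "integrable M (\<lambda>x. norm (iexp (X x) - iexp (?P x + ?E x)) + \<bar>?E x\<bar>)"
          using i3 i4 by (rule Bochner_Integration.integrable_add)
      qed
      also have "\<dots> = expectation (\<lambda>x. norm (iexp (X x) - iexp (?P x + ?E x))) + expectation (\<lambda>x. \<bar>?E x\<bar>)"
        using i3 i4 by (rule Bochner_Integration.integral_add)
      also have "\<dots> \<le> inverse (real (Suc N)) + duhamel_error t N w"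
        by (rule add_mono[OF less_imp_le[OF n[THEN spec]] E_le])
      finally show "norm (exp (complex_of_real (- form ?vf ?vf / 2)) * \<phi> N
        - (CLINT x|M. iexp (pairing v (state p q 0 x) + pairing w (state p q t x)))) \<le> inverse (real (Suc N)) + duhamel_error t N w"
        unfolding e V_def X_def .
    qed
  qed
  then show ?thesis by (rule that)
qed

text \<open>The law of the noise contribution need not be identified: its characteristic function is the
  quotient of those of the two Gaussian laws, read off at \<open>v = 0\<close>.\<close>

theorem joint_iexp:
  assumes t: "t > 0" and v: "fin_supp v" and w: "fin_supp w"
  shows "(CLINT x|M. iexp (pairing v (state p q 0 x) + pairing w (state p q t x))) =
    complex_of_real (exp (- (form v v + form w w + 2 * cross_form t v w) / 2))"
proof -
  define f where "f = (\<lambda>N. flow (Suc N) t w)"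
  have f: "fin_supp (f N)" for N unfolding f_def by (rule fin_supp_flow[OF w])
  obtain \<phi> where \<phi>: "\<And>v. fin_supp v \<Longrightarrow>
    (\<lambda>N. exp (complex_of_real (- form (\<lambda>a. v a + f N a) (\<lambda>a. v a + f N a) / 2)) * \<phi> N)
      \<longlonglongrightarrow> (CLINT x|M. iexp (pairing v (state p q 0 x) + pairing w (state p q t x)))"
    using noise_factor[OF t w] unfolding f_def by blast
  have "(CLINT x|M. iexp (pairing (\<lambda>_. 0) (state p q 0 x) + pairing w (state p q t x))) = exp (complex_of_real (- form w w / 2))"
    using pairing_state_iexp[of t w] t w unfolding exp_of_real by (simp add: pairing_def[of "\<lambda>_. 0"])
  then have base: "(\<lambda>N. exp (complex_of_real (- form (f N) (f N) / 2)) * \<phi> N) \<longlonglongrightarrow> exp (complex_of_real (- form w w / 2))"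
    using \<phi>[of "\<lambda>_. 0"] by simp
  have "(\<lambda>N. form v (f N)) \<longlonglongrightarrow> cross_form t v w"
    unfolding f_def using t by (intro LIMSEQ_Suc[OF cross_form_tendsto[OF v w]]) simp
  \<comment> \<open>Expanding the form at \<open>v + f N\<close> isolates the terms that contain
    \<open>v\<close>; what remains is the sequence of \<open>base\<close>, whose limit is
    known.\<close>
  then have "(\<lambda>N. exp (complex_of_real (- form v v / 2 - form v (f N))) * (exp (complex_of_real (- form (f N) (f N) / 2)) * \<phi> N))
      \<longlonglongrightarrow> exp (complex_of_real (- form v v / 2 - cross_form t v w)) * exp (complex_of_real (- form w w / 2))"
    by (intro tendsto_mult base tendsto_intros)
  moreover have "exp (complex_of_real (- form (\<lambda>a. v a + f N a) (\<lambda>a. v a + f N a) / 2)) * \<phi> N =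
      exp (complex_of_real (- form v v / 2 - form v (f N))) * (exp (complex_of_real (- form (f N) (f N) / 2)) * \<phi> N)" for N
  proof -
    have e: "- form (\<lambda>a. v a + f N a) (\<lambda>a. v a + f N a) / 2 = (- form v v / 2 - form v (f N)) + - form (f N) (f N) / 2"
      unfolding form_add_self[OF v f] by (simp add: field_simps)
    show ?thesis unfolding e of_real_add exp_add mult.assoc ..
  qed
  ultimately have lim: "(\<lambda>N. exp (complex_of_real (- form (\<lambda>a. v a + f N a) (\<lambda>a. v a + f N a) / 2)) * \<phi> N)
      \<longlonglongrightarrow> exp (complex_of_real (- form v v / 2 - cross_form t v w)) * exp (complex_of_real (- form w w / 2))"
    by (simp only:)
  have e: "- (form v v + form w w + 2 * cross_form t v w) / 2 = (- form v v / 2 - cross_form t v w) + - form w w / 2"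
    by (simp add: field_simps)
  have "exp (complex_of_real a) * exp (complex_of_real b) = complex_of_real (exp (a + b))" for a b
    by (simp only: exp_of_real exp_add of_real_mult)
  with LIMSEQ_unique[OF \<phi>[OF v] lim] show ?thesis unfolding e by (simp only:)
qed

end

section \<open>The maximal correlation bound\<close>

context gibbs_chain
begin

lemma form_lincomb:
  assumes "finite I" "\<And>i. i \<in> I \<Longrightarrow> fin_supp (v i)"
  shows "form (\<lambda>a. \<Sum>i\<in>I. x i * v i a) (\<lambda>a. \<Sum>i\<in>I. x i * v i a) = (\<Sum>i\<in>I. \<Sum>j\<in>I. x i * x j * form (v i) (v j))"
proof -
  have "form (\<lambda>a. \<Sum>i\<in>I. x i * v i a) z = (\<Sum>i\<in>I. x i * form (v i) z)" for z
    using assms by (rule form_lincomb_left)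
  moreover have "form z (\<lambda>a. \<Sum>i\<in>I. x i * v i a) = (\<Sum>i\<in>I. x i * form z (v i))" for z
    using assms by (rule form_lincomb_right)
  ultimately show ?thesis by (simp add: sum_distrib_left mult_ac)
qed

lemma psd_on_form:
  assumes "finite I" "\<And>i. i \<in> I \<Longrightarrow> fin_supp (v i)"
  shows "psd_on I (\<lambda>i j. form (v i) (v j))"
  unfolding psd_on_def
proof (intro conjI ballI allI)
  fix x
  have "0 \<le> form (\<lambda>a. \<Sum>i\<in>I. x i * v i a) (\<lambda>a. \<Sum>i\<in>I. x i * v i a)"
    by (intro form_nonneg fin_supp_lincomb assms)
  also have "\<dots> = (\<Sum>i\<in>I. \<Sum>j\<in>I. x i * x j * form (v i) (v j))"
    using assms by (rule form_lincomb)
  finally show "0 \<le> (\<Sum>i\<in>I. \<Sum>j\<in>I. x i * x j * form (v i) (v j))" .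
qed (intro form_sym assms)

lemma form_minus: "form (\<lambda>a. - w a) (\<lambda>a. - w a) = form w w"
  using form_scale_left[of "-1" w "\<lambda>a. - w a"] form_scale_right[of w "-1" w] by simp

lemma cross_form_minus:
  assumes "fin_supp v" "fin_supp w" "0 \<le> t"
  shows "cross_form t v (\<lambda>a. - w a) = - cross_form t v w"
  using cross_form_lincomb[of "{0 :: nat}" "{0 :: nat}" "\<lambda>_. v" "\<lambda>_. w" t "\<lambda>_. 1" "\<lambda>_. -1"] assms by simp

end

lemma pairing_minus: "pairing (\<lambda>a. - w a) x = - pairing w x"
  using pairing_scale_left[of "-1" w x] by simp

definition coscov :: "real \<Rightarrow> real \<Rightarrow> real \<Rightarrow> real \<Rightarrow> real \<Rightarrow> real" where
  "coscov a \<theta> b \<phi> k = (exp (- a / 2) * cos \<theta>) * (exp (- b / 2) * cos \<phi>) * (cosh k - 1) +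
    (exp (- a / 2) * sin \<theta>) * (exp (- b / 2) * sin \<phi>) * sinh k"

context langevin_chain
begin

lemma covariance_cos_same_time:
  assumes u: "u \<ge> 0" and v: "fin_supp v" and w: "fin_supp w"
  shows "covariance (\<lambda>x. cos (pairing v (state p q u x) + \<theta>)) (\<lambda>x. cos (pairing w (state p q u x) + \<phi>)) =
    coscov (form v v) \<theta> (form w w) \<phi> (form v w)"
  unfolding coscov_def
proof (rule covariance_cos)
  have m: "fin_supp (\<lambda>a. - w a)" using w by simp
  have "(CLINT x|M. iexp (pairing v (state p q u x) + pairing w' (state p q u x))) =
      complex_of_real (exp (- (form v v + form w' w' + 2 * form v w') / 2))" if w': "fin_supp w'" for w'
  proof -
    have "form (\<lambda>a. v a + w' a) (\<lambda>a. v a + w' a) = form v v + form w' w' + 2 * form v w'"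
      using form_add_self[OF v w'] by simp
    then show ?thesis
      using pairing_state_iexp[OF u fin_supp_add[OF v w']] unfolding pairing_add_left[OF v w'] by (simp only:)
  qed
  from this[OF w] this[OF m]
  show "(CLINT x|M. iexp (pairing v (state p q u x) + pairing w (state p q u x))) =
      complex_of_real (exp (- (form v v + form w w + 2 * form v w) / 2))"
    "(CLINT x|M. iexp (pairing v (state p q u x) - pairing w (state p q u x))) =
      complex_of_real (exp (- (form v v + form w w - 2 * form v w) / 2))"
    using form_scale_right[of v "-1" w] by (simp_all add: pairing_minus form_minus)
qed (intro measurable_pairing_state u pairing_state_iexp v w)+

lemma covariance_cos_two_times:
  assumes t: "t > 0" and v: "fin_supp v" and w: "fin_supp w"
  shows "covariance (\<lambda>x. cos (pairing v (state p q 0 x) + \<theta>)) (\<lambda>x. cos (pairing w (state p q t x) + \<phi>)) =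
    coscov (form v v) \<theta> (form w w) \<phi> (cross_form t v w)"
  unfolding coscov_def
proof (rule covariance_cos)
  have m: "fin_supp (\<lambda>a. - w a)" using w by simp
  have t0: "0 \<le> t" using t by simp
  from joint_iexp[OF t v w] joint_iexp[OF t v m]
  show "(CLINT x|M. iexp (pairing v (state p q 0 x) + pairing w (state p q t x))) =
      complex_of_real (exp (- (form v v + form w w + 2 * cross_form t v w) / 2))"
    "(CLINT x|M. iexp (pairing v (state p q 0 x) - pairing w (state p q t x))) =
      complex_of_real (exp (- (form v v + form w w - 2 * cross_form t v w) / 2))"
    by (simp_all add: pairing_minus form_minus cross_form_minus[OF v w t0])
  show "random_variable borel (\<lambda>x. pairing w (state p q t x))"
    "(CLINT x|M. iexp (pairing w (state p q t x))) = complex_of_real (exp (- form w w / 2))"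
    by (intro measurable_pairing_state pairing_state_iexp t0 w)+
qed (intro measurable_pairing_state pairing_state_iexp order_refl v)+

text \<open>Covariance and variances each split into a \<open>cosh - 1\<close> part and a
  \<open>sinh\<close> part, which are forms in power series of linear covariances. The series bound
  applies to either part with \<open>contraction\<close> as input, and the two bounds add
  up.\<close>

lemma trig_poly_covariance_bound:
  assumes t: "t > 0" and rho: "0 \<le> \<rho>" "\<rho> \<le> 1"
    and contraction: "\<And>v w. fin_supp v \<Longrightarrow> fin_supp w \<Longrightarrow> 2 * cross_form t v w \<le> \<rho> * (form v v + form w w)"
    and f: "trig_poly f" and g: "trig_poly g"
  shows "2 * covariance (\<lambda>x. f (state p q 0 x)) (\<lambda>x. g (state p q t x)) \<le>
    \<rho> * (variance (\<lambda>x. f (state p q 0 x)) + variance (\<lambda>x. g (state p q t x)))"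
proof -
  obtain n :: nat and \<alpha> v \<theta> where v: "\<And>k. fin_supp (v k)" and f_eq: "f = (\<lambda>x. \<Sum>k<n. \<alpha> k * cos (pairing (v k) x + \<theta> k))"
    using trig_poly_expand[OF f] by blast
  obtain l :: nat and \<beta>' w \<phi> where w: "\<And>k. fin_supp (w k)" and g_eq: "g = (\<lambda>x. \<Sum>k<l. \<beta>' k * cos (pairing (w k) x + \<phi> k))"
    using trig_poly_expand[OF g] by blast
  have t0: "0 \<le> t" using t by simp
  have rv: "random_variable borel (\<lambda>x. cos (pairing z (state p q u x) + s))" if "u \<ge> 0" for z u s
    using measurable_pairing_state[OF that, of z] by measurable
  have sq: "integrable M (\<lambda>x. (cos (pairing z (state p q u x) + s))\<^sup>2)" if "u \<ge> 0" for z u s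
    by (rule bounded_square_integrable[OF rv[OF that], of _ _ 1]) simp
  have scale: "r * s * coscov A x B y k =
      (r * exp (- A / 2) * cos x) * (s * exp (- B / 2) * cos y) * (cosh k - 1) +
      (r * exp (- A / 2) * sin x) * (s * exp (- B / 2) * sin y) * sinh k" for r s A x B y k
    by (simp add: coscov_def algebra_simps)
  \<comment> \<open>Gaussian damping and phase combine into one weight per frequency and part, so
    the same weights serve the covariance and both variances.\<close>
  define a where "a k = \<alpha> k * exp (- form (v k) (v k) / 2) * cos (\<theta> k)" for k
  define a' where "a' k = \<alpha> k * exp (- form (v k) (v k) / 2) * sin (\<theta> k)" for k
  define b where "b k = \<beta>' k * exp (- form (w k) (w k) / 2) * cos (\<phi> k)" for k
  define b' where "b' k = \<beta>' k * exp (- form (w k) (w k) / 2) * sin (\<phi> k)" for k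
  have cov: "covariance (\<lambda>x. f (state p q 0 x)) (\<lambda>x. g (state p q t x)) =
      (\<Sum>i<n. \<Sum>j<l. a i * b j * (cosh (cross_form t (v i) (w j)) - 1)) +
      (\<Sum>i<n. \<Sum>j<l. a' i * b' j * sinh (cross_form t (v i) (w j)))"
  proof -
    have "covariance (\<lambda>x. f (state p q 0 x)) (\<lambda>x. g (state p q t x)) = (\<Sum>i<n. \<Sum>j<l. \<alpha> i * \<beta>' j *
        covariance (\<lambda>x. cos (pairing (v i) (state p q 0 x) + \<theta> i)) (\<lambda>x. cos (pairing (w j) (state p q t x) + \<phi> j)))"
      unfolding f_eq g_eq by (rule covariance_sum) (intro finite_lessThan rv sq t0 order_refl)+
    then show ?thesis
      unfolding covariance_cos_two_times[OF t v w] scale a_def a'_def b_def b'_def sum.distrib .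
  qed
  have var_f: "variance (\<lambda>x. f (state p q 0 x)) =
      (\<Sum>i<n. \<Sum>j<n. a i * a j * (cosh (form (v i) (v j)) - 1)) +
      (\<Sum>i<n. \<Sum>j<n. a' i * a' j * sinh (form (v i) (v j)))"
  proof -
    have "covariance (\<lambda>x. f (state p q 0 x)) (\<lambda>x. f (state p q 0 x)) = (\<Sum>i<n. \<Sum>j<n. \<alpha> i * \<alpha> j *
        covariance (\<lambda>x. cos (pairing (v i) (state p q 0 x) + \<theta> i)) (\<lambda>x. cos (pairing (v j) (state p q 0 x) + \<theta> j)))"
      unfolding f_eq by (rule covariance_sum) (intro finite_lessThan rv sq order_refl)+
    then show ?thesis
      unfolding variance_eq_covariance covariance_cos_same_time[OF order_refl v v] scale a_def a'_def sum.distrib .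
  qed
  have var_g: "variance (\<lambda>x. g (state p q t x)) =
      (\<Sum>i<l. \<Sum>j<l. b i * b j * (cosh (form (w i) (w j)) - 1)) +
      (\<Sum>i<l. \<Sum>j<l. b' i * b' j * sinh (form (w i) (w j)))"
  proof -
    have "covariance (\<lambda>x. g (state p q t x)) (\<lambda>x. g (state p q t x)) = (\<Sum>i<l. \<Sum>j<l. \<beta>' i * \<beta>' j *
        covariance (\<lambda>x. cos (pairing (w i) (state p q t x) + \<phi> i)) (\<lambda>x. cos (pairing (w j) (state p q t x) + \<phi> j)))"
      unfolding g_eq by (rule covariance_sum) (intro finite_lessThan rv sq t0)+
    then show ?thesis
      unfolding variance_eq_covariance covariance_cos_same_time[OF t0 w w] scale b_def b'_def sum.distrib .
  qed
  have psd: "psd_on {..<n} (\<lambda>i j. form (v i) (v j))" "psd_on {..<l} (\<lambda>i j. form (w i) (w j))"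
    by (intro psd_on_form v w finite_lessThan)+
  have lin: "2 * (\<Sum>i<n. \<Sum>j<l. x i * y j * cross_form t (v i) (w j)) \<le>
      \<rho> * ((\<Sum>i<n. \<Sum>j<n. x i * x j * form (v i) (v j)) + (\<Sum>i<l. \<Sum>j<l. y i * y j * form (w i) (w j)))" for x y
  proof -
    have "form (\<lambda>a. \<Sum>i<n. x i * v i a) (\<lambda>a. \<Sum>i<n. x i * v i a) = (\<Sum>i<n. \<Sum>j<n. x i * x j * form (v i) (v j))"
      "form (\<lambda>a. \<Sum>i<l. y i * w i a) (\<lambda>a. \<Sum>i<l. y i * w i a) = (\<Sum>i<l. \<Sum>j<l. y i * y j * form (w i) (w j))"
      by (intro form_lincomb finite_lessThan v w)+
    moreover have "cross_form t (\<lambda>a. \<Sum>i<n. x i * v i a) (\<lambda>a. \<Sum>j<l. y j * w j a) = (\<Sum>i<n. \<Sum>j<l. x i * y j * cross_form t (v i) (w j))"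
      by (intro cross_form_lincomb finite_lessThan v w t0)
    moreover have "fin_supp (\<lambda>a. \<Sum>i<n. x i * v i a)" "fin_supp (\<lambda>a. \<Sum>i<l. y i * w i a)"
      by (intro fin_supp_lincomb finite_lessThan v w)+
    ultimately show ?thesis
      using contraction[of "\<lambda>a. \<Sum>i<n. x i * v i a" "\<lambda>a. \<Sum>i<l. y i * w i a"] by (simp only:)
  qed
  note bound = cross_series_bound[OF finite_lessThan finite_lessThan psd rho lin]
  have "2 * (\<Sum>i<n. \<Sum>j<l. a i * b j * (cosh (cross_form t (v i) (w j)) - 1)) \<le>
      \<rho> * ((\<Sum>i<n. \<Sum>j<n. a i * a j * (cosh (form (v i) (v j)) - 1)) + (\<Sum>i<l. \<Sum>j<l. b i * b j * (cosh (form (w i) (w j)) - 1)))"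
    by (rule bound[OF _ _ cosh_minus_one_sums]) auto
  moreover have "2 * (\<Sum>i<n. \<Sum>j<l. a' i * b' j * sinh (cross_form t (v i) (w j))) \<le>
      \<rho> * ((\<Sum>i<n. \<Sum>j<n. a' i * a' j * sinh (form (v i) (v j))) + (\<Sum>i<l. \<Sum>j<l. b' i * b' j * sinh (form (w i) (w j))))"
    by (rule bound[OF _ _ sinh_sums]) auto
  ultimately show ?thesis unfolding cov var_f var_g by (simp add: distrib_left)
qed

text \<open>The density theorem for the law of the state on the sequence space, transported back to
  the sample space.\<close>

lemma trig_poly_L2_approximation:
  assumes u: "u \<ge> 0" and f: "f \<in> borel_measurable state_space" and f2: "integrable M (\<lambda>x. (f (state p q u x))\<^sup>2)"
  obtains h where "\<And>n. trig_poly (h n)" "(\<lambda>n. expectation (\<lambda>x. (f (state p q u x) - h n (state p q u x))\<^sup>2)) \<longlonglongrightarrow> 0"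
proof -
  define N where "N = distr M state_space (state p q u)"
  have mS: "random_variable state_space (state p q u)" by (rule measurable_state[OF u])
  interpret N: seq_prob_space N
  proof (intro seq_prob_space.intro seq_prob_space_axioms.intro)
    show "prob_space N" unfolding N_def by (rule prob_space_distr[OF mS])
  qed (simp add: N_def)
  have "trig_approx N f"
  proof (rule N.trig_approx_square_integrable)
    show "f \<in> borel_measurable N" using f by (simp add: N_def)
    show "integrable N (\<lambda>x. (f x)\<^sup>2)" unfolding N_def using f f2 by (subst integrable_distr_eq[OF mS]) auto
  qed
  then have "\<forall>n. \<exists>h. trig_poly h \<and> (\<integral>x. (f x - h x)\<^sup>2 \<partial>N) < inverse (real (Suc n))"
    unfolding trig_approx_def by (meson positive_imp_inverse_positive of_nat_0_less_iff zero_less_Suc)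
  then obtain h where "\<forall>n. trig_poly (h n) \<and> (\<integral>x. (f x - h n x)\<^sup>2 \<partial>N) < inverse (real (Suc n))"
    by (rule choice[THEN exE])
  then have h: "\<And>n. trig_poly (h n)" "\<And>n. (\<integral>x. (f x - h n x)\<^sup>2 \<partial>N) < inverse (real (Suc n))" by simp_all
  have eq: "(\<integral>x. (f x - h n x)\<^sup>2 \<partial>N) = expectation (\<lambda>x. (f (state p q u x) - h n (state p q u x))\<^sup>2)" for n
    unfolding N_def using f measurable_trig_poly[OF h(1)] by (intro integral_distr[OF mS]) auto
  have "(\<lambda>n. expectation (\<lambda>x. (f (state p q u x) - h n (state p q u x))\<^sup>2)) \<longlonglongrightarrow> 0"
  proof (rule tendsto_sandwich[OF _ _ tendsto_const LIMSEQ_inverse_real_of_nat])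
    show "\<forall>\<^sub>F n in sequentially. expectation (\<lambda>x. (f (state p q u x) - h n (state p q u x))\<^sup>2) \<le> inverse (real (Suc n))"
      using h(2) unfolding eq by (intro always_eventually allI less_imp_le)
  qed auto
  with h(1) show ?thesis by (rule that)
qed

text \<open>Both sides of the additive bound are continuous in L2, so it passes from trigonometric
  polynomials to all test functions with the same \<rho>. As \<rho> is fixed before the test
  functions, the supremum itself stays below 1.\<close>

theorem maximal_correlation_less_one:
  assumes t: "t > 0"
  shows "maximal_correlation state_space (state p q 0) state_space (state p q t) < 1"
proof -
  have t0: "0 \<le> t" using t by simp
  obtain \<rho> where \<rho>: "\<rho> > 0" "\<rho> < 1"
    and contraction: "\<And>v w. fin_supp v \<Longrightarrow> fin_supp w \<Longrightarrow> 2 * cross_form t v w \<le> \<rho> * (form v v + form w w)"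
    using cross_form_contraction[OF t] by blast
  have "maximal_correlation state_space (state p q 0) state_space (state p q t) \<le> ennreal \<rho>"
  proof (rule maximal_correlation_le)
    show S: "random_variable state_space (state p q 0)" "random_variable state_space (state p q t)"
      using t by (auto intro: measurable_state)
    fix f g :: "(site \<Rightarrow> real) \<Rightarrow> real"
    assume f: "f \<in> borel_measurable state_space" "integrable M (\<lambda>x. (f (state p q 0 x))\<^sup>2)"
      and g: "g \<in> borel_measurable state_space" "integrable M (\<lambda>x. (g (state p q t x))\<^sup>2)"
    obtain h where h: "\<And>n. trig_poly (h n)" "(\<lambda>n. expectation (\<lambda>x. (f (state p q 0 x) - h n (state p q 0 x))\<^sup>2)) \<longlonglongrightarrow> 0"
      by (rule trig_poly_L2_approximation[OF order_refl f]) (rule that; assumption)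
    obtain k where k: "\<And>n. trig_poly (k n)" "(\<lambda>n. expectation (\<lambda>x. (g (state p q t x) - k n (state p q t x))\<^sup>2)) \<longlonglongrightarrow> 0"
      by (rule trig_poly_L2_approximation[OF t0 g]) (rule that; assumption)
    have sq: "integrable M (\<lambda>x. (z (state p q u x))\<^sup>2)" "random_variable borel (\<lambda>x. z (state p q u x))"
      if z: "trig_poly z" and u: "u \<ge> 0" for z u
    proof -
      show m: "random_variable borel (\<lambda>x. z (state p q u x))"
        by (rule measurable_compose[OF measurable_state[OF u] measurable_trig_poly[OF z]])
      obtain B where "\<And>x. \<bar>z x\<bar> \<le> B" using trig_poly_bounded[OF z] by blast
      then show "integrable M (\<lambda>x. (z (state p q u x))\<^sup>2)" by (rule bounded_square_integrable[OF m])
    qed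
    have m: "random_variable borel (\<lambda>x. f (state p q 0 x))" "random_variable borel (\<lambda>x. g (state p q t x))"
      using measurable_compose[OF S(1) f(1)] measurable_compose[OF S(2) g(1)] by auto
    note H = m(1) f(2) sq(2)[OF h(1) order_refl] sq(1)[OF h(1) order_refl]
    note G = m(2) g(2) sq(2)[OF k(1) t0] sq(1)[OF k(1) t0]
    show "2 * covariance (\<lambda>x. f (state p q 0 x)) (\<lambda>x. g (state p q t x)) \<le>
        \<rho> * (variance (\<lambda>x. f (state p q 0 x)) + variance (\<lambda>x. g (state p q t x)))"
      unfolding variance_eq_covariance
    proof (rule LIMSEQ_le)
      show "(\<lambda>n. 2 * covariance (\<lambda>x. h n (state p q 0 x)) (\<lambda>x. k n (state p q t x))) \<longlonglongrightarrow>
          2 * covariance (\<lambda>x. f (state p q 0 x)) (\<lambda>x. g (state p q t x))"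
        by (intro tendsto_mult_left covariance_tendsto H G h k)
      show "(\<lambda>n. \<rho> * (covariance (\<lambda>x. h n (state p q 0 x)) (\<lambda>x. h n (state p q 0 x)) +
            covariance (\<lambda>x. k n (state p q t x)) (\<lambda>x. k n (state p q t x)))) \<longlonglongrightarrow>
          \<rho> * (covariance (\<lambda>x. f (state p q 0 x)) (\<lambda>x. f (state p q 0 x)) + covariance (\<lambda>x. g (state p q t x)) (\<lambda>x. g (state p q t x)))"
        by (intro tendsto_mult_left tendsto_add covariance_tendsto H G h k)
      show "\<exists>N. \<forall>n\<ge>N. 2 * covariance (\<lambda>x. h n (state p q 0 x)) (\<lambda>x. k n (state p q t x)) \<le>
          \<rho> * (covariance (\<lambda>x. h n (state p q 0 x)) (\<lambda>x. h n (state p q 0 x)) + covariance (\<lambda>x. k n (state p q t x)) (\<lambda>x. k n (state p q t x)))"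
        unfolding variance_eq_covariance[symmetric]
        using trig_poly_covariance_bound[OF t less_imp_le[OF \<rho>(1)] less_imp_le[OF \<rho>(2)] contraction h(1) k(1)] by blast
    qed
  qed (use \<rho> in simp)
  also have "ennreal \<rho> < 1" using \<rho> by (simp flip: ennreal_1 add: ennreal_less_iff)
  finally show ?thesis .
qed

end

theorem theorem5p4p6:
  fixes M :: "'w measure"
    and m \<omega> c T lam :: real
    and W p q :: "int \<Rightarrow> real \<Rightarrow> 'w \<Rightarrow> real"
  assumes "prob_space M"
    and "m > 0" and "\<omega> > 0" and "c > 0" and "T > 0" and "lam > 0"
    and "prob_space.independent_brownian_motions M W"
    and "prob_space.langevin_solution M m \<omega> c T lam W p q"
    and "prob_space.at_equilibrium M m \<omega> c T W p q"
  shows "\<forall>t>0. prob_space.maximal_correlation M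
           state_space (state p q 0) state_space (state p q t) < 1"
proof -
  interpret langevin_chain M m \<omega> c T lam W p q
    using assms by (intro langevin_chain.intro langevin_chain_axioms.intro)
  show ?thesis using maximal_correlation_less_one by blast
qed

end
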